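(* Let $T\in\mathscr Q$, and let $H\ge0$ be an operator on $\mathcal H_1$ such that $[H,T]=0$ and $\ker(H)\subseteq\ker(T)$. Let $\mathcal L_1$ be the generator of the Fermionic Mehler semigroup $\{\Phi_{e^{-tH},(1-e^{-2tH})T}\}_{t\ge0}$ of GIG quantum operations on $\mathscr A_{\mathcal H_1}$. Let $\mathcal L_2$ be the coherent generator $\mathcal L_2(X)=-i[\widehat K,X]$ for some self-adjoint $K$ on $\mathcal H_1$. Then the symbol map of $e^{t(\mathcal L_1+\mathcal L_2)}$, $t\ge0$, is $$Q\mapsto e^{-t(H+iK)}Qe^{-t(H-iK)}+\int_0^te^{-s(H+iK)}(HT+TH)e^{-s(H-iK)}\,ds .$$
   Context: Let $\mathcal H_1$ be a complex Hilbert space of finite dimension $N$ (inner product conjugate linear in the first variable). A CAR field over $\mathcal H_1$ is a conjugate linear map $\psi\mapsto Z(\psi)$ into bounded operators on a Hilbert space $\mathscr K$ with, writing $Z^*(\psi)=Z(\psi)^*$, $Z(\psi)Z^*(\phi)+Z^*(\phi)Z(\psi)=\langle\psi,\phi\rangle1$ and $Z(\psi)Z(\phi)+Z(\phi)Z(\psi)=0$. Fix one acting irreducibly; then $\dim\mathscr K=2^N$ and the generated $*$-algebra is $\mathscr A_{\mathcal H_1}=\mathcal B(\mathscr K)$. Let $\tau=2^{-N}\mathrm{Tr}$; density matrices are operators $\rho\ge0$ with $\tau(\rho)=1$, and $\mathcal L_1,\mathcal L_2$ act on density matrices (Schrödinger picture). The number operator is $\mathcal N=\sum_jZ^*(\psi_j)Z(\psi_j)$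 (any orthonormal basis). For self-adjoint $K=\sum_j\kappa_j|\psi_j\rangle\langle\psi_j|$, $\widehat K=\sum_j\kappa_jZ^*(\psi_j)Z(\psi_j)$. $\mathscr Q=\{Q\in\mathcal B(\mathcal H_1):0\le Q\le1\}$; for $Q=\sum_j\mu_j|\psi_j\rangle\langle\psi_j|\in\mathscr Q$ (spectral decomposition) $\rho_Q=\prod_{j=1}^N\big((1-\mu_j)2Z(\psi_j)Z^*(\psi_j)+\mu_j2Z^*(\psi_j)Z(\psi_j)\big)$ is the density matrix of the gauge invariant Gaussian (GIG) state with symbol $Q$; $\mathfrak S_{GIG}=\{\rho_Q:Q\in\mathscr Q\}$. The symbol map $\gamma_\Phi$ of a map $\Phi$ sending $\mathfrak S_{GIG}$ into itself is defined by $\Phi(\rho_Q)=\rho_{\gamma_\Phi(Q)}$. A GIG quantum operation is a completely positive trace preserving map that maps $\mathfrak S_{GIG}$ into itself and commutes with all $X\mapsto e^{-it\mathcal N}Xe^{it\mathcal N}$. Evans-Hugenholtz-Kadison (EHK) operation. A pair $(S,R)$ of operators on $\mathcal H_1$ is compatible if $S$ is a contraction and $0\le R\le1-SS^*$. For such a pair there is a unique $T_{S,R}\in\mathscr Q$ with $\ker(1-SS^* )\subseteq\ker T_{S,R}$ and $R=(1-SS^* )^{1/2}T_{S,R}(1-SS^* )^{1/2}$. On $\mathscr K\otimes\mathscr K$ consider the CAR field over $\mathcal H_1\oplus\mathcal H_1$, $Z(\psi\oplus\eta)=Z(\psi)\otimes W+1\otimes Z(\eta)$ with $W=e^{i\pi\mathcal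 N}$; let $\mathscr A$, $\mathscr B$ be the $*$-algebras generated by $\{Z(\psi\oplus0)\}$, $\{Z(0\oplus\psi)\}$, each identified with $\mathscr A_{\mathcal H_1}$ via $Z(\psi\oplus0)\leftrightarrow Z(\psi)$, $Z(0\oplus\psi)\leftrightarrow Z(\psi)$. Let $U_S=\begin{pmatrix}-(1-SS^* )^{1/2}&S\\S^*&(1-S^*S)^{1/2}\end{pmatrix}$, a self-adjoint unitary on $\mathcal H_1\oplus\mathcal H_1$, and $\alpha_{U_S}$ the (involutive) $*$-automorphism with $\alpha_{U_S}(Z(\xi))=Z(U_S\xi)$ for $\xi\in\mathcal H_1\oplus\mathcal H_1$. Let $\rho_{T_{S,R}}\in\mathscr A$ be the GIG density matrix with symbol $T_{S,R}$, and $\mathbb E_{\mathscr A}$ the orthogonal projection of $\mathscr A_{\mathcal H_1\oplus\mathcal H_1}$ onto $\mathscr A$ for the inner product given by the normalized trace. Then $\Phi_{S,R}(\rho)=\mathbb E_{\mathscr A}(\alpha_{U_S}(\rho_{T_{S,R}}\rho))$ for $\rho\in\mathscr B\cong\mathscr A_{\mathcal H_1}$, extended linearly, regarded as a map on $\mathscr A_{\mathcal H_1}$. Under the hypotheses of the claim $\{\Phi_{e^{-tH},(1-e^{-2tH})T}\}_{t\ge0}$ is a continuous semigroup. *)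

theory Defs
  imports "HOL-Analysis.Analysis"
begin

text \<open>Operators on \<open>\<complex>\<^sup>n\<close> are matrices \<open>complex ^ 'n ^ 'n\<close>; the norm of the library on
  \<open>complex ^ 'n\<close> is the Hilbert space norm. The one-particle space \<open>\<H>\<^sub>1\<close> is \<open>complex ^ 'n\<close>, with
  \<open>N = CARD('n)\<close>, and the Hilbert space carrying the CAR field is \<open>complex ^ 'k\<close>.\<close>

section \<open>Matrices over the complex numbers\<close>

text \<open>Conjugate linear in the first variable.\<close>

definition cinner :: "complex ^ 'n \<Rightarrow> complex ^ 'n \<Rightarrow> complex" where
  "cinner x y = (\<Sum>i\<in>UNIV. cnj (x $ i) * y $ i)"

definition cadj :: "complex ^ 'n ^ 'm \<Rightarrow> complex ^ 'm ^ 'n" where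
  "cadj A = (\<chi> i j. cnj (A $ j $ i))"

definition cscale :: "complex \<Rightarrow> complex ^ 'n ^ 'm \<Rightarrow> complex ^ 'n ^ 'm"  (infixr "*\<^sub>M" 75) where
  "c *\<^sub>M A = (\<chi> i j. c * A $ i $ j)"

text \<open>\<open>|x\<rangle>\<langle>y|\<close>\<close>

definition ketbra :: "complex ^ 'n \<Rightarrow> complex ^ 'n \<Rightarrow> complex ^ 'n ^ 'n" where
  "ketbra x y = (\<chi> i j. x $ i * cnj (y $ j))"

definition selfadj :: "complex ^ 'n ^ 'n \<Rightarrow> bool" where
  "selfadj A \<longleftrightarrow> cadj A = A"

definition pos_op :: "complex ^ 'n ^ 'n \<Rightarrow> bool" where
  "pos_op A \<longleftrightarrow> selfadj A \<and> (\<forall>x. 0 \<le> Re (cinner x (A *v x)))"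

definition op_ker :: "complex ^ 'n ^ 'n \<Rightarrow> (complex ^ 'n) set" where
  "op_ker A = {x. A *v x = 0}"

definition op_sqrt :: "complex ^ 'n ^ 'n \<Rightarrow> complex ^ 'n ^ 'n" where
  "op_sqrt A = (THE B. pos_op B \<and> B ** B = A)"

primrec mpow :: "complex ^ 'n ^ 'n \<Rightarrow> nat \<Rightarrow> complex ^ 'n ^ 'n" where
  "mpow A 0 = mat 1"
| "mpow A (Suc m) = A ** mpow A m"

definition mexp :: "complex ^ 'n ^ 'n \<Rightarrow> complex ^ 'n ^ 'n" where
  "mexp A = (\<Sum>m. (1 / fact m) *\<^sub>R mpow A m)"

primrec mprod :: "(nat \<Rightarrow> complex ^ 'n ^ 'n) \<Rightarrow> nat \<Rightarrow> complex ^ 'n ^ 'n" where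
  "mprod f 0 = mat 1"
| "mprod f (Suc m) = mprod f m ** f m"

text \<open>\<open>A = \<Sum>\<^sub>j \<mu>\<^sub>j |\<psi>\<^sub>j\<rangle>\<langle>\<psi>\<^sub>j|\<close> with \<open>\<psi>\<^sub>0, \<dots>, \<psi>\<^sub>N\<^sub>-\<^sub>1\<close> an orthonormal basis.\<close>

definition spectral_decomp ::
    "complex ^ 'n ^ 'n \<Rightarrow> (nat \<Rightarrow> complex ^ 'n) \<Rightarrow> (nat \<Rightarrow> real) \<Rightarrow> bool" where
  "spectral_decomp A \<psi> \<mu> \<longleftrightarrow>
     (\<forall>i<CARD('n). \<forall>j<CARD('n). cinner (\<psi> i) (\<psi> j) = (if i = j then 1 else 0)) \<and>
     A = (\<Sum>j<CARD('n). \<mu> j *\<^sub>R ketbra (\<psi> j) (\<psi> j))"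

definition kron :: "complex ^ 'k ^ 'k \<Rightarrow> complex ^ 'l ^ 'l \<Rightarrow> complex ^ ('k \<times> 'l) ^ ('k \<times> 'l)" where
  "kron A B = (\<chi> p q. A $ fst p $ fst q * B $ snd p $ snd q)"

definition dsum :: "complex ^ 'n \<Rightarrow> complex ^ 'm \<Rightarrow> complex ^ ('n + 'm)" where
  "dsum x y = (\<chi> i. case i of Inl a \<Rightarrow> x $ a | Inr b \<Rightarrow> y $ b)"

definition block_mat :: "complex ^ 'n ^ 'n \<Rightarrow> complex ^ 'm ^ 'n \<Rightarrow> complex ^ 'n ^ 'm \<Rightarrow>
    complex ^ 'm ^ 'm \<Rightarrow> complex ^ ('n + 'm) ^ ('n + 'm)" where
  "block_mat A B C D = (\<chi> i j. case i of
       Inl a \<Rightarrow> (case j of Inl b \<Rightarrow> A $ a $ b | Inr b \<Rightarrow> B $ a $ b)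
     | Inr a \<Rightarrow> (case j of Inl b \<Rightarrow> C $ a $ b | Inr b \<Rightarrow> D $ a $ b))"

section \<open>Star algebras of matrices\<close>

text \<open>No closure under the unit is required: the algebras used below contain it by the
  canonical anticommutation relations.\<close>

inductive_set star_alg :: "(complex ^ 'k ^ 'k) set \<Rightarrow> (complex ^ 'k ^ 'k) set"
  for G :: "(complex ^ 'k ^ 'k) set" where
  gen: "A \<in> G \<Longrightarrow> A \<in> star_alg G"
| add: "A \<in> star_alg G \<Longrightarrow> B \<in> star_alg G \<Longrightarrow> A + B \<in> star_alg G"
| scale: "A \<in> star_alg G \<Longrightarrow> c *\<^sub>M A \<in> star_alg G"
| mult: "A \<in> star_alg G \<Longrightarrow> B \<in> star_alg G \<Longrightarrow> A ** B \<in> star_alg G"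
| star: "A \<in> star_alg G \<Longrightarrow> cadj A \<in> star_alg G"

definition star_hom :: "(complex ^ 'k ^ 'k \<Rightarrow> complex ^ 'l ^ 'l) \<Rightarrow> bool" where
  "star_hom \<theta> \<longleftrightarrow> \<theta> (mat 1) = mat 1 \<and>
     (\<forall>A B. \<theta> (A + B) = \<theta> A + \<theta> B) \<and> (\<forall>c A. \<theta> (c *\<^sub>M A) = c *\<^sub>M \<theta> A) \<and>
     (\<forall>A B. \<theta> (A ** B) = \<theta> A ** \<theta> B) \<and> (\<forall>A. \<theta> (cadj A) = cadj (\<theta> A))"

text \<open>For \<open>\<K>\<close> of dimension \<open>2\<^sup>N\<close> this is \<open>\<tau> = 2\<^sup>-\<^sup>N Tr\<close>.\<close>

definition ntrace :: "complex ^ 'k ^ 'k \<Rightarrow> complex" where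
  "ntrace A = trace A / of_nat CARD('k)"

text \<open>Orthogonal projection onto a subspace of matrices, for \<open>\<langle>A, B\<rangle> = \<tau>(A\<^sup>* B)\<close>.\<close>

definition cond_exp :: "(complex ^ 'k ^ 'k) set \<Rightarrow> complex ^ 'k ^ 'k \<Rightarrow> complex ^ 'k ^ 'k" where
  "cond_exp \<A> X = (THE Y. Y \<in> \<A> \<and> (\<forall>A\<in>\<A>. ntrace (cadj A ** (X - Y)) = 0))"

section \<open>CAR fields and gauge invariant Gaussian states\<close>

definition CAR_field :: "(complex ^ 'n \<Rightarrow> complex ^ 'k ^ 'k) \<Rightarrow> bool" where
  "CAR_field Z \<longleftrightarrow>
     (\<forall>\<psi> \<phi>. Z (\<psi> + \<phi>) = Z \<psi> + Z \<phi>) \<and> (\<forall>c \<psi>. Z (c *s \<psi>) = cnj c *\<^sub>M Z \<psi>) \<and>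
     (\<forall>\<psi> \<phi>. Z \<psi> ** cadj (Z \<phi>) + cadj (Z \<phi>) ** Z \<psi> = cinner \<psi> \<phi> *\<^sub>M mat 1) \<and>
     (\<forall>\<psi> \<phi>. Z \<psi> ** Z \<phi> + Z \<phi> ** Z \<psi> = 0)"

definition CAR_irreducible :: "(complex ^ 'n \<Rightarrow> complex ^ 'k ^ 'k) \<Rightarrow> bool" where
  "CAR_irreducible Z \<longleftrightarrow> (\<forall>V. vec.subspace V \<and>
     (\<forall>\<psi>. \<forall>x\<in>V. Z \<psi> *v x \<in> V \<and> cadj (Z \<psi>) *v x \<in> V) \<longrightarrow> V = {0} \<or> V = UNIV)"

definition number_op :: "(complex ^ 'n \<Rightarrow> complex ^ 'k ^ 'k) \<Rightarrow> complex ^ 'k ^ 'k" where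
  "number_op Z = (\<Sum>i\<in>UNIV. cadj (Z (axis i 1)) ** Z (axis i 1))"

text \<open>The value below does not depend on the spectral decomposition; the same holds for the
  density matrix \<open>\<rho>\<^sub>Q\<close>, whose factors commute.\<close>

definition second_quant ::
    "(complex ^ 'n \<Rightarrow> complex ^ 'k ^ 'k) \<Rightarrow> complex ^ 'n ^ 'n \<Rightarrow> complex ^ 'k ^ 'k" where
  "second_quant Z K = (THE X. \<exists>\<psi> \<kappa>. spectral_decomp K \<psi> \<kappa> \<and>
     X = (\<Sum>j<CARD('n). \<kappa> j *\<^sub>R (cadj (Z (\<psi> j)) ** Z (\<psi> j))))"

definition symbols :: "(complex ^ 'n ^ 'n) set" where
  "symbols = {Q. pos_op Q \<and> pos_op (mat 1 - Q)}"

definition gig_density ::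
    "(complex ^ 'n \<Rightarrow> complex ^ 'k ^ 'k) \<Rightarrow> complex ^ 'n ^ 'n \<Rightarrow> complex ^ 'k ^ 'k" where
  "gig_density Z Q = (THE \<rho>. \<exists>\<psi> \<mu>. spectral_decomp Q \<psi> \<mu> \<and>
     \<rho> = mprod (\<lambda>j. ((1 - \<mu> j) * 2) *\<^sub>R (Z (\<psi> j) ** cadj (Z (\<psi> j)))
                    + (\<mu> j * 2) *\<^sub>R (cadj (Z (\<psi> j)) ** Z (\<psi> j))) CARD('n))"

definition gig_states :: "(complex ^ 'n \<Rightarrow> complex ^ 'k ^ 'k) \<Rightarrow> (complex ^ 'k ^ 'k) set" where
  "gig_states Z = gig_density Z ` symbols"

definition is_symbol_map :: "(complex ^ 'n \<Rightarrow> complex ^ 'k ^ 'k) \<Rightarrow>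
    (complex ^ 'k ^ 'k \<Rightarrow> complex ^ 'k ^ 'k) \<Rightarrow> (complex ^ 'n ^ 'n \<Rightarrow> complex ^ 'n ^ 'n) \<Rightarrow> bool" where
  "is_symbol_map Z \<Phi> \<gamma> \<longleftrightarrow> \<Phi> ` gig_states Z \<subseteq> gig_states Z \<and>
     (\<forall>Q\<in>symbols. \<gamma> Q \<in> symbols \<and> \<Phi> (gig_density Z Q) = gig_density Z (\<gamma> Q))"

section \<open>Evans-Hugenholtz-Kadison operations\<close>

text \<open>\<open>Z(\<psi> \<oplus> \<eta>) = Z(\<psi>) \<otimes> W + 1 \<otimes> Z(\<eta>)\<close> with \<open>W = e\<^bsup>i\<pi>\<N>\<^esup>\<close>\<close>

definition CAR_double :: "(complex ^ 'n \<Rightarrow> complex ^ 'k ^ 'k) \<Rightarrow>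
    complex ^ ('n + 'n) \<Rightarrow> complex ^ ('k \<times> 'k) ^ ('k \<times> 'k)" where
  "CAR_double Z \<xi> =
     kron (Z (\<chi> i. \<xi> $ Inl i)) (mexp ((\<i> * complex_of_real pi) *\<^sub>M number_op Z))
     + kron (mat 1) (Z (\<chi> i. \<xi> $ Inr i))"

text \<open>The isomorphism of the algebra of all operators (generated by the irreducible field \<open>Z\<close>)
  onto the algebra generated by the field \<open>Z'\<close>, sending \<open>Z(\<psi>)\<close> to \<open>Z'(\<psi>)\<close>.\<close>

definition CAR_iso :: "(complex ^ 'n \<Rightarrow> complex ^ 'k ^ 'k) \<Rightarrow> (complex ^ 'n \<Rightarrow> complex ^ 'l ^ 'l) \<Rightarrow>
    complex ^ 'k ^ 'k \<Rightarrow> complex ^ 'l ^ 'l" where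
  "CAR_iso Z Z' = (THE \<theta>. star_hom \<theta> \<and> bij_betw \<theta> UNIV (star_alg (range Z')) \<and>
     (\<forall>\<psi>. \<theta> (Z \<psi>) = Z' \<psi>))"

definition CAR_aut :: "(complex ^ 'm \<Rightarrow> complex ^ 'l ^ 'l) \<Rightarrow> complex ^ 'm ^ 'm \<Rightarrow>
    complex ^ 'l ^ 'l \<Rightarrow> complex ^ 'l ^ 'l" where
  "CAR_aut Z U = (THE \<alpha>. star_hom \<alpha> \<and> bij \<alpha> \<and> (\<forall>\<xi>. \<alpha> (Z \<xi>) = Z (U *v \<xi>)))"

definition ehk_unitary :: "complex ^ 'n ^ 'n \<Rightarrow> complex ^ ('n + 'n) ^ ('n + 'n)" where
  "ehk_unitary S = block_mat (- op_sqrt (mat 1 - S ** cadj S)) S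
                             (cadj S) (op_sqrt (mat 1 - cadj S ** S))"

definition ehk_T :: "complex ^ 'n ^ 'n \<Rightarrow> complex ^ 'n ^ 'n \<Rightarrow> complex ^ 'n ^ 'n" where
  "ehk_T S R = (THE T. T \<in> symbols \<and> op_ker (mat 1 - S ** cadj S) \<subseteq> op_ker T \<and>
     R = op_sqrt (mat 1 - S ** cadj S) ** T ** op_sqrt (mat 1 - S ** cadj S))"

text \<open>\<open>\<Phi>\<^bsub>S,R\<^esub>\<close>, meaningful for compatible pairs: \<open>S\<close> a contraction and \<open>0 \<le> R \<le> 1 - S S\<^sup>*\<close>.
  Both the argument (in \<open>\<B>\<close>) and the value (in \<open>\<A>\<close>) are transported to the algebra over \<open>\<H>\<^sub>1\<close>.\<close>

definition ehk :: "(complex ^ 'n \<Rightarrow> complex ^ 'k ^ 'k) \<Rightarrow> complex ^ 'n ^ 'n \<Rightarrow> complex ^ 'n ^ 'n \<Rightarrow>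
    complex ^ 'k ^ 'k \<Rightarrow> complex ^ 'k ^ 'k" where
  "ehk Z S R X =
     (let ZA = (\<lambda>\<psi>. CAR_double Z (dsum \<psi> 0));
          ZB = (\<lambda>\<psi>. CAR_double Z (dsum 0 \<psi>));
          \<iota>A = CAR_iso Z ZA;
          \<iota>B = CAR_iso Z ZB
      in inv \<iota>A (cond_exp (star_alg (range ZA))
           (CAR_aut (CAR_double Z) (ehk_unitary S) (\<iota>A (gig_density Z (ehk_T S R)) ** \<iota>B X))))"

section \<open>Semigroups and generators\<close>

definition mehler :: "(complex ^ 'n \<Rightarrow> complex ^ 'k ^ 'k) \<Rightarrow> complex ^ 'n ^ 'n \<Rightarrow> complex ^ 'n ^ 'n \<Rightarrow>
    real \<Rightarrow> complex ^ 'k ^ 'k \<Rightarrow> complex ^ 'k ^ 'k" where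
  "mehler Z H T t = ehk Z (mexp ((- t) *\<^sub>R H)) ((mat 1 - mexp ((- 2 * t) *\<^sub>R H)) ** T)"

definition semigroup_generator :: "(real \<Rightarrow> 'a::real_normed_vector \<Rightarrow> 'a) \<Rightarrow> 'a \<Rightarrow> 'a" where
  "semigroup_generator \<Phi> X = vector_derivative (\<lambda>t. \<Phi> t X) (at 0 within {0..})"

definition coherent_generator ::
    "(complex ^ 'n \<Rightarrow> complex ^ 'k ^ 'k) \<Rightarrow> complex ^ 'n ^ 'n \<Rightarrow> complex ^ 'k ^ 'k \<Rightarrow> complex ^ 'k ^ 'k" where
  "coherent_generator Z K X = (- \<i>) *\<^sub>M (second_quant Z K ** X - X ** second_quant Z K)"

text \<open>\<open>e\<^sup>L\<close> for a linear map \<open>L\<close> on a finite dimensional space\<close>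

definition op_exp :: "('a::real_normed_vector \<Rightarrow> 'a) \<Rightarrow> 'a \<Rightarrow> 'a" where
  "op_exp L X = (\<Sum>m. (1 / fact m) *\<^sub>R (L ^^ m) X)"

end

theory Submission
  imports Defs
begin

text \<open>A density matrix \<open>\<rho>\<close> is Gaussian with symbol \<open>Q\<close> iff it is even, normalized and satisfies the
  relations \<open>\<rho> c = \<rho> c' + c' \<rho>\<close> for the ladder operators \<open>c\<close>, where \<open>c' = Z\<^sup>*(Q \<phi>)\<close> for
  \<open>c = Z\<^sup>*(\<phi>)\<close> and \<open>c' = Z((1 - Q) \<phi>)\<close> for \<open>c = Z(\<phi>)\<close>. These relations give the moments of \<open>\<rho>\<close> as
  polynomials in the entries of \<open>Q\<close>, and words in the ladder operators span all operators, so
  \<open>\<rho>\<^sub>Q = F(Q)\<close> for a map \<open>F\<close> that is differentiable on all matrices. The relations are stable under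
  Kronecker products, implemented unitaries and restriction of the field, whence
  \<open>\<Phi>\<^bsub>S,R\<^esub>(F(Q)) = F(S Q S\<^sup>* + R)\<close> and \<open>e\<^bsup>t\<L>\<^sub>2\<^esup>(F(Q)) = F(e\<^bsup>-itK\<^esup> Q e\<^bsup>itK\<^esup>)\<close> for all self-adjoint \<open>Q\<close>.
  Differentiating, \<open>\<L>\<^sub>1 + \<L>\<^sub>2\<close> maps \<open>F(Q)\<close> to the derivative of \<open>F\<close> at \<open>Q\<close> in the direction
  \<open>-(H + iK) Q - Q (H - iK) + HT + TH\<close>. The flow of this affine vector field is the claimed symbol
  map, so \<open>F\<close> along the flow and the semigroup solve the same linear equation on the span of the
  Gaussian operators.\<close>

section \<open>Matrix algebra\<close>

text \<open>\<open>gig_density\<close> goes through a spectral decomposition, which need not vary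
  smoothly with the symbol where eigenvalues cross, so it is not differentiated directly. Moments do
  vary smoothly; hence the detour through linear relations and \<open>F\<close>. Derivatives are
  computed at self-adjoint matrices rather than at symbols: from a boundary point of
  \<open>symbols\<close> a straight segment in the direction of the vector field may leave the set,
  but it stays self-adjoint. That the flow preserves \<open>symbols\<close> is a separate order
  argument, in which the bound by 1 is reduced to positivity. A second obstacle:
  \<open>semigroup_generator\<close> is a bare \<open>vector_derivative\<close>, meaningful only
  where the derivative exists. Existence and linearity are proved on the span of the Gaussian
  operators, an invariant subspace, and the series \<open>op_exp\<close> is evaluated there.
  Finally, the EHK operation is assembled from \<open>THE\<close> descriptions; each is resolved by
  an explicit object and a uniqueness argument.\<close>

lemma cadj_cadj [simp]: "cadj (cadj A) = A"
  by (simp add: cadj_def vec_eq_iff)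

lemma cadj_add: "cadj (A + B) = cadj A + cadj B"
  by (simp add: cadj_def vec_eq_iff)

lemma cadj_diff: "cadj (A - B) = cadj A - cadj B"
  by (simp add: cadj_def vec_eq_iff)

lemma cadj_minus: "cadj (- A) = - cadj A"
  by (simp add: cadj_def vec_eq_iff)

lemma cadj_0 [simp]: "cadj 0 = 0"
  by (simp add: cadj_def vec_eq_iff)

lemma cadj_mat1 [simp]: "cadj (mat 1) = mat 1"
  by (simp add: cadj_def vec_eq_iff mat_def)

lemma cadj_cscale: "cadj (c *\<^sub>M A) = cnj c *\<^sub>M cadj A"
  by (simp add: cadj_def cscale_def vec_eq_iff)

lemma cadj_scaleR: "cadj (r *\<^sub>R A) = r *\<^sub>R cadj A"
  by (simp add: cadj_def vec_eq_iff)

lemma cadj_mult: "cadj (A ** B) = cadj B ** cadj A"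
  by (simp add: cadj_def vec_eq_iff matrix_matrix_mult_def mult.commute)

lemma cadj_sum: "cadj (\<Sum>i\<in>I. f i) = (\<Sum>i\<in>I. cadj (f i))"
  by (induction I rule: infinite_finite_induct) (auto simp: cadj_add)

lemmas cadj_simps = cadj_add cadj_diff cadj_minus cadj_cscale cadj_scaleR cadj_mult cadj_sum

lemma cscale_scaleR: "r *\<^sub>R A = complex_of_real r *\<^sub>M A"
  by (simp add: cscale_def vec_eq_iff scaleR_conv_of_real [where 'a = complex])

lemma cscale_cscale [simp]: "a *\<^sub>M b *\<^sub>M A = (a * b) *\<^sub>M A"
  by (simp add: cscale_def vec_eq_iff mult.assoc)

lemma cscale_1 [simp]: "1 *\<^sub>M A = A"
  by (simp add: cscale_def vec_eq_iff)

lemma cscale_0 [simp]: "0 *\<^sub>M A = 0" "c *\<^sub>M 0 = 0"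
  by (simp_all add: cscale_def vec_eq_iff)

lemma cscale_add: "c *\<^sub>M (A + B) = c *\<^sub>M A + c *\<^sub>M B"
  by (simp add: cscale_def vec_eq_iff algebra_simps)

lemma cscale_diff: "c *\<^sub>M (A - B) = c *\<^sub>M A - c *\<^sub>M B"
  by (simp add: cscale_def vec_eq_iff algebra_simps)

lemma cscale_minus: "c *\<^sub>M (- A) = - (c *\<^sub>M A)" "(- c) *\<^sub>M A = - (c *\<^sub>M A)"
  by (simp_all add: cscale_def vec_eq_iff)

lemma cscale_add_left: "(a + b) *\<^sub>M A = a *\<^sub>M A + b *\<^sub>M A"
  by (simp add: cscale_def vec_eq_iff algebra_simps)

lemma cscale_diff_left: "(a - b) *\<^sub>M A = a *\<^sub>M A - b *\<^sub>M A"
  by (simp add: cscale_def vec_eq_iff algebra_simps)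

lemma cscale_sum: "c *\<^sub>M (\<Sum>i\<in>I. f i) = (\<Sum>i\<in>I. c *\<^sub>M f i)"
  by (induction I rule: infinite_finite_induct) (auto simp: cscale_add)

lemma cscale_sum_left: "(\<Sum>i\<in>I. f i) *\<^sub>M A = (\<Sum>i\<in>I. f i *\<^sub>M A)"
  by (induction I rule: infinite_finite_induct) (auto simp: cscale_add_left)

lemma scaleR_cscale: "r *\<^sub>R (c *\<^sub>M A) = (of_real r * c) *\<^sub>M A"
  by (simp add: cscale_scaleR)

lemma cscale_scaleR_commute: "c *\<^sub>M (r *\<^sub>R A) = r *\<^sub>R (c *\<^sub>M A)"
  by (simp add: cscale_scaleR mult.commute)

lemma cscale_mult_left: "(c *\<^sub>M A) ** B = c *\<^sub>M (A ** B)"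
  by (simp add: cscale_def vec_eq_iff matrix_matrix_mult_def sum_distrib_left mult.assoc)

lemma cscale_mult_right: "A ** (c *\<^sub>M B) = c *\<^sub>M (A ** B)"
  by (simp add: cscale_def vec_eq_iff matrix_matrix_mult_def sum_distrib_left mult.left_commute)

lemma scaleR_mult_left: "(r *\<^sub>R A) ** B = r *\<^sub>R (A ** (B :: complex ^ _ ^ _))"
  by (simp add: cscale_scaleR cscale_mult_left)

lemma scaleR_mult_right: "A ** (r *\<^sub>R B) = r *\<^sub>R (A ** (B :: complex ^ _ ^ _))"
  by (simp add: cscale_scaleR cscale_mult_right)

lemma mult_minus_left: "(- A) ** B = - (A ** (B :: complex ^ _ ^ _))"
  by (simp add: vec_eq_iff matrix_matrix_mult_def sum_negf)

lemma mult_minus_right: "A ** (- B) = - (A ** (B :: complex ^ _ ^ _))"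
  by (simp add: vec_eq_iff matrix_matrix_mult_def sum_negf)

lemma mult_diff_left: "(A - B) ** C = A ** C - B ** (C :: complex ^ _ ^ _)"
  by (simp add: vec_eq_iff matrix_matrix_mult_def sum_subtractf algebra_simps)

lemma mult_diff_right: "A ** (B - C) = A ** B - A ** (C :: complex ^ _ ^ _)"
  by (simp add: vec_eq_iff matrix_matrix_mult_def sum_subtractf algebra_simps)

lemma mult_0_left [simp]: "0 ** A = (0 :: complex ^ _ ^ _)"
  by (simp add: vec_eq_iff matrix_matrix_mult_def)

lemma mult_0_right [simp]: "A ** 0 = (0 :: complex ^ _ ^ _)"
  by (simp add: vec_eq_iff matrix_matrix_mult_def)

lemma matrix_add_rdistrib: "(A + B) ** C = A ** C + B ** (C :: complex ^ _ ^ _)"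
  by (simp add: vec_eq_iff matrix_matrix_mult_def sum.distrib algebra_simps)

lemma mult_sum_left: "(\<Sum>i\<in>I. f i) ** A = (\<Sum>i\<in>I. f i ** (A :: complex ^ _ ^ _))"
  by (induction I rule: infinite_finite_induct) (auto simp: matrix_add_rdistrib)

lemma mult_sum_right: "A ** (\<Sum>i\<in>I. f i) = (\<Sum>i\<in>I. A ** (f i :: complex ^ _ ^ _))"
  by (induction I rule: infinite_finite_induct) (auto simp: matrix_add_ldistrib)

lemmas mat_simps = matrix_add_ldistrib matrix_add_rdistrib mult_diff_left mult_diff_right
  mult_minus_left mult_minus_right scaleR_mult_left scaleR_mult_right
  cscale_mult_left cscale_mult_right mult_sum_left mult_sum_right

lemma bilinear_matrix_mult: "bilinear (\<lambda>(A :: complex ^ 'n ^ 'm) (B :: complex ^ 'l ^ 'n). A ** B)"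
  unfolding bilinear_def by (auto intro!: linearI simp: mat_simps)

lemma bounded_bilinear_matrix_mult:
  "bounded_bilinear (\<lambda>(A :: complex ^ 'n ^ 'm) (B :: complex ^ 'l ^ 'n). A ** B)"
  using bilinear_matrix_mult bilinear_conv_bounded_bilinear by blast

lemma mv_scaleR: "(r *\<^sub>R A) *v x = r *\<^sub>R (A *v (x :: complex ^ _))"
  by (simp add: vec_eq_iff matrix_vector_mult_def scaleR_sum_right)

lemma mv_cscale: "(c *\<^sub>M A) *v x = c *s (A *v x)"
  by (simp add: vec_eq_iff matrix_vector_mult_def cscale_def sum_distrib_left mult.assoc)

lemma mv_smult: "A *v (c *s x) = c *s (A *v (x :: complex ^ _))"
  by (simp add: vec_eq_iff matrix_vector_mult_def sum_distrib_left mult.left_commute)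

lemma mv_scaleR_right: "A *v (r *\<^sub>R x) = r *\<^sub>R (A *v (x :: complex ^ _))"
  by (simp add: vec_eq_iff matrix_vector_mult_def scaleR_sum_right)

lemma mv_minus: "(- A) *v x = - (A *v (x :: complex ^ _))"
  by (simp add: vec_eq_iff matrix_vector_mult_def sum_negf)

lemma mv_minus_right: "A *v (- x) = - (A *v (x :: complex ^ _))"
  by (simp add: vec_eq_iff matrix_vector_mult_def sum_negf)

lemma mv_sum: "(\<Sum>i\<in>I. f i) *v x = (\<Sum>i\<in>I. f i *v (x :: complex ^ _))"
  by (induction I rule: infinite_finite_induct) (auto simp: matrix_vector_mult_add_rdistrib)

lemma mv_sum_right: "A *v (\<Sum>i\<in>I. f i) = (\<Sum>i\<in>I. A *v (f i :: complex ^ _))"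
  by (induction I rule: infinite_finite_induct) (auto simp: matrix_vector_right_distrib)

lemma smult_scaleR: "r *\<^sub>R x = complex_of_real r *s x"
  by (simp add: vec_eq_iff scaleR_conv_of_real [where 'a = complex])

lemma bounded_bilinear_matrix_vector_mult:
  "bounded_bilinear (\<lambda>(A :: complex ^ 'n ^ 'm) x. A *v x)"
proof -
  have "bilinear (\<lambda>(A :: complex ^ 'n ^ 'm) x. A *v x)"
    unfolding bilinear_def
    by (auto intro!: linearI simp: mv_scaleR matrix_vector_mult_add_rdistrib)
  then show ?thesis using bilinear_conv_bounded_bilinear by blast
qed

lemma linear_cadj: "linear (cadj :: complex ^ 'n ^ 'm \<Rightarrow> _)"
  by (auto intro!: linearI simp: cadj_simps)

lemma bounded_linear_cadj: "bounded_linear (cadj :: complex ^ 'n ^ 'm \<Rightarrow> _)"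
  using linear_cadj linear_conv_bounded_linear by blast

section \<open>The inner product and rank-one operators\<close>

lemma cinner_add_left: "cinner (x + y) z = cinner x z + cinner y z"
  by (simp add: cinner_def algebra_simps sum.distrib)

lemma cinner_add_right: "cinner x (y + z) = cinner x y + cinner x z"
  by (simp add: cinner_def algebra_simps sum.distrib)

lemma cinner_diff_left: "cinner (x - y) z = cinner x z - cinner y z"
  by (simp add: cinner_def algebra_simps sum_subtractf)

lemma cinner_diff_right: "cinner x (y - z) = cinner x y - cinner x z"
  by (simp add: cinner_def algebra_simps sum_subtractf)

lemma cinner_smult_left: "cinner (c *s x) y = cnj c * cinner x y"
  by (simp add: cinner_def sum_distrib_left mult.assoc)

lemma cinner_smult_right: "cinner x (c *s y) = c * cinner x y"
  by (simp add: cinner_def sum_distrib_left mult.left_commute)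

lemma cinner_scaleR_right: "cinner x (r *\<^sub>R y) = of_real r * cinner x y"
  by (simp add: smult_scaleR cinner_smult_right)

lemma cinner_0 [simp]: "cinner 0 x = 0" "cinner x 0 = 0"
  by (simp_all add: cinner_def)

lemma cinner_sum_right: "cinner z (\<Sum>i\<in>I. f i) = (\<Sum>i\<in>I. cinner z (f i))"
  by (induction I rule: infinite_finite_induct) (auto simp: cinner_add_right)

lemma cinner_commute: "cnj (cinner x y) = cinner y x"
  by (simp add: cinner_def mult.commute)

lemma cinner_mv: "cinner x (A *v y) = cinner (cadj A *v x) y"
  unfolding cinner_def matrix_vector_mult_def cadj_def
  by (simp add: sum_distrib_left sum_distrib_right, subst sum.swap) (simp add: mult_ac)

lemma cinner_mv_left: "cinner (A *v x) y = cinner x (cadj A *v y)"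
  by (simp add: cinner_mv)

lemma Re_cinner: "Re (cinner x y) = x \<bullet> y"
  by (simp add: cinner_def inner_vec_def inner_complex_def)

lemma cinner_self: "cinner x x = of_real ((norm x)\<^sup>2)"
proof (rule complex_eqI)
  show "Re (cinner x x) = Re (of_real ((norm x)\<^sup>2))"
    by (simp add: Re_cinner dot_square_norm)
  have "Im (cinner x x) = 0"
    using arg_cong[OF cinner_commute[of x x], of Im] by simp
  then show "Im (cinner x x) = Im (of_real ((norm x)\<^sup>2))" by simp
qed

lemma cinner_self_eq_0: "cinner x x = 0 \<longleftrightarrow> x = 0"
  by (simp add: cinner_self)

lemma cinner_axis: "cinner (axis i 1) x = x $ i"
proof -
  have "cnj (axis i 1 $ j) * x $ j = (if j = i then x $ j else 0)" for j
    by (auto simp: axis_def)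
  then show ?thesis by (simp add: cinner_def)
qed

lemma ketbra_mv: "ketbra x y *v z = cinner y z *s x"
  by (simp add: ketbra_def matrix_vector_mult_def cinner_def vec_eq_iff sum_distrib_left sum_distrib_right mult_ac)

lemma cadj_ketbra: "cadj (ketbra x y) = ketbra y x"
  by (simp add: ketbra_def cadj_def vec_eq_iff mult.commute)

lemma mult_ketbra: "A ** ketbra x y = ketbra (A *v x) y"
  by (simp add: ketbra_def matrix_vector_mult_def matrix_matrix_mult_def vec_eq_iff sum_distrib_left mult_ac)

lemma ketbra_mult: "ketbra x y ** A = ketbra x (cadj A *v y)"
  by (metis cadj_ketbra cadj_mult mult_ketbra cadj_cadj)

lemma mat_eqI: "(\<And>x. A *v x = B *v x) \<Longrightarrow> A = (B :: complex ^ 'n ^ 'm)"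
  by (simp add: matrix_eq)

lemma axis_expansion: "(\<Sum>i\<in>UNIV. x $ i *s axis i 1) = (x :: complex ^ 'n)"
  by (simp add: basis_expansion)

section \<open>The normalized trace and matrix units\<close>

lemma ntrace_add: "ntrace (A + B) = ntrace A + ntrace B"
  by (simp add: ntrace_def trace_def sum.distrib add_divide_distrib)

lemma ntrace_diff: "ntrace (A - B) = ntrace A - ntrace B"
  by (simp add: ntrace_def trace_def sum_subtractf diff_divide_distrib)

lemma ntrace_cscale: "ntrace (c *\<^sub>M A) = c * ntrace A"
  by (simp add: ntrace_def trace_def cscale_def sum_distrib_left)

lemma ntrace_scaleR: "ntrace (r *\<^sub>R A) = r *\<^sub>R ntrace A"
  by (simp add: cscale_scaleR ntrace_cscale scaleR_conv_of_real)

lemma ntrace_minus: "ntrace (- A) = - ntrace A"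
  using ntrace_cscale[of "-1" A] by (simp add: cscale_minus)

lemma ntrace_0 [simp]: "ntrace 0 = 0"
  by (simp add: ntrace_def trace_def)

lemma ntrace_mat1 [simp]: "ntrace (mat 1) = 1"
  by (simp add: ntrace_def trace_def mat_def)

lemma ntrace_sum: "ntrace (\<Sum>i\<in>I. f i) = (\<Sum>i\<in>I. ntrace (f i))"
  by (induction I rule: infinite_finite_induct) (auto simp: ntrace_add)

lemma ntrace_commute: "ntrace (A ** B) = ntrace (B ** A)"
  for A :: "complex ^ 'k ^ 'k"
  unfolding ntrace_def trace_mul_sym[of A B] ..

lemmas ntrace_simps = ntrace_add ntrace_diff ntrace_cscale ntrace_scaleR ntrace_minus ntrace_sum

text \<open>\<open>trace (cadj A ** A)\<close> is the sum of the squared moduli of the entries, so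
  the trace form is definite; this turns equality of all traces into equality of operators.\<close>

lemma ntrace_adj_self: "ntrace (cadj A ** A) = 0 \<Longrightarrow> A = 0"
proof -
  assume "ntrace (cadj A ** A) = 0"
  then have "trace (cadj A ** A) = 0" by (simp add: ntrace_def)
  moreover have "trace (cadj A ** A) = of_real (\<Sum>i\<in>UNIV. \<Sum>j\<in>UNIV. (cmod (A $ j $ i))\<^sup>2)"
    by (simp add: trace_def cadj_def matrix_matrix_mult_def complex_mult_cnj cmod_power2 mult.commute)
  ultimately have "(\<Sum>i\<in>UNIV. \<Sum>j\<in>UNIV. (cmod (A $ j $ i))\<^sup>2) = 0"
    by (metis of_real_eq_0_iff)
  then have "\<forall>i j. A $ j $ i = 0"
    by (simp add: sum_nonneg_eq_0_iff sum_nonneg)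
  then show "A = 0" by (simp add: vec_eq_iff)
qed

definition munit :: "'k \<Rightarrow> 'k \<Rightarrow> complex ^ 'k ^ 'k" where
  "munit i j = (\<chi> a b. if a = i \<and> b = j then 1 else 0)"

lemma munit_expansion: "X = (\<Sum>i\<in>UNIV. \<Sum>j\<in>UNIV. X $ i $ j *\<^sub>M munit i j)"
proof -
  have "(\<Sum>i\<in>UNIV. \<Sum>j\<in>UNIV. X $ i $ j *\<^sub>M munit i j) $ a $ b = X $ a $ b" for a b
  proof -
    have "(\<Sum>i\<in>UNIV. \<Sum>j\<in>UNIV. X $ i $ j *\<^sub>M munit i j) $ a $ b
        = (\<Sum>i\<in>UNIV. if i = a then \<Sum>j\<in>UNIV. (if j = b then X $ i $ j else 0) else 0)"
      unfolding sum_component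
      by (intro sum.cong refl) (auto simp: cscale_def munit_def mult_delta_right intro!: sum.cong sum.neutral)
    also have "\<dots> = X $ a $ b" by simp
    finally show ?thesis .
  qed
  note entry = this
  show ?thesis
    by (rule vec_eq_iff[THEN iffD2, rule_format], rule vec_eq_iff[THEN iffD2, rule_format])
      (rule entry[symmetric])
qed

text \<open>Entries are traces against matrix units, so an operator can be rebuilt from its trace
  functionals.\<close>

lemma ntrace_munit: "ntrace (X ** munit j i) = X $ i $ j / of_nat CARD('k)"
  for X :: "complex ^ 'k ^ 'k"
proof -
  have "trace (X ** munit j i) = (\<Sum>a\<in>UNIV. if a = i then (\<Sum>b\<in>UNIV. if b = j then X $ a $ b else 0) else 0)"
    unfolding trace_def munit_def matrix_matrix_mult_def
    by (intro sum.cong refl) (auto simp: mult_delta_right intro!: sum.cong sum.neutral)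
  then show ?thesis by (simp add: ntrace_def)
qed

section \<open>The matrix exponential\<close>

text \<open>Square matrices with the operator norm form a Banach algebra, and \<^const>\<open>mexp\<close> is its
  exponential. A copy of the type is needed because multiplication on \<^typ>\<open>complex ^ 'n ^ 'n\<close> is
  componentwise.\<close>

typedef 'n matalg = "UNIV :: (complex ^ 'n ^ 'n) set" morphisms mat_of matalg_of
  by simp

lemmas mat_of_inverses [simp] = mat_of_inverse matalg_of_inverse[OF UNIV_I]

definition opnorm :: "complex ^ 'n ^ 'n \<Rightarrow> real" where
  "opnorm A = onorm (\<lambda>x. A *v x)"

lemma opnorm: "norm (A *v x) \<le> opnorm A * norm x"
  unfolding opnorm_def by (rule onorm) simp

lemma opnorm_le: "(\<And>x. norm (A *v x) \<le> c * norm x) \<Longrightarrow> opnorm A \<le> c"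
  unfolding opnorm_def by (rule onorm_le)

lemma opnorm_nonneg: "0 \<le> opnorm A"
  unfolding opnorm_def by (rule onorm_pos_le) simp

text \<open>Together with the next lemma: equivalence of the operator norm and the library norm. It
  makes \<open>mat_of\<close> and \<open>matalg_of\<close> bounded, so limits and derivatives
  transfer between the two types.\<close>

lemma opnorm_le_norm: "\<exists>c>0. \<forall>A :: complex ^ 'n ^ 'n. opnorm A \<le> c * norm A"
proof -
  obtain c where c: "c > 0" "\<And>(A :: complex ^ 'n ^ 'n) x. norm (A *v x) \<le> norm A * norm x * c"
    using bounded_bilinear.pos_bounded[OF bounded_bilinear_matrix_vector_mult] by metis
  show ?thesis
    by (rule exI[of _ c]) (auto simp: c(1) mult_ac intro!: opnorm_le order.trans[OF c(2)])
qed

lemma norm_le_opnorm: "norm A \<le> real CARD('n) * real CARD('n) * opnorm A" for A :: "complex ^ 'n ^ 'n"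
proof -
  have entry: "norm (A $ i $ j) \<le> opnorm A" for i j
  proof -
    have "A $ i $ j = (A *v axis j 1) $ i"
      by (simp add: matrix_vector_mult_def axis_def mult_delta_right)
    also have "norm \<dots> \<le> norm (A *v axis j 1)"
      by (rule Finite_Cartesian_Product.norm_nth_le)
    also have "\<dots> \<le> opnorm A"
      using opnorm[of A "axis j 1"] by simp
    finally show ?thesis .
  qed
  have "norm A \<le> (\<Sum>i\<in>UNIV. norm (A $ i))"
    by (simp add: norm_vec_def L2_set_le_sum)
  also have "\<dots> \<le> (\<Sum>i\<in>UNIV. \<Sum>j\<in>UNIV. norm (A $ i $ j))"
    by (intro sum_mono) (simp add: norm_vec_def L2_set_le_sum)
  also have "\<dots> \<le> (\<Sum>i\<in>(UNIV::'n set). \<Sum>j\<in>(UNIV::'n set). opnorm A)"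
    by (intro sum_mono entry)
  finally show ?thesis by simp
qed

instantiation matalg :: (finite) real_normed_algebra_1
begin

definition "0 = matalg_of 0"
definition "1 = matalg_of (mat 1)"
definition "a + b = matalg_of (mat_of a + mat_of b)"
definition "a - b = matalg_of (mat_of a - mat_of b)"
definition "- a = matalg_of (- mat_of a)"
definition "a * b = matalg_of (mat_of a ** mat_of b)"
definition "r *\<^sub>R a = matalg_of (r *\<^sub>R mat_of a)"
definition "norm a = opnorm (mat_of a)"
definition "dist a b = norm (a - b)" for a b :: "'a matalg"
definition "sgn a = inverse (norm a) *\<^sub>R a" for a :: "'a matalg"
definition "(uniformity :: ('a matalg \<times> 'a matalg) filter) = (INF e\<in>{0 <..}. principal {(x, y). dist x y < e})"
definition "open (S :: 'a matalg set) = (\<forall>x\<in>S. \<forall>\<^sub>F (x', y) in uniformity. x' = x \<longrightarrow> y \<in> S)"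

instance
proof
  fix a b c :: "'a matalg" and r s :: real
  note defs = zero_matalg_def one_matalg_def plus_matalg_def minus_matalg_def uminus_matalg_def
    times_matalg_def scaleR_matalg_def norm_matalg_def
  show "a + b + c = a + (b + c)" "a + b = b + a" "0 + a = a" "- a + a = 0" "a - b = a + - b"
    by (simp_all add: defs add_ac)
  show "r *\<^sub>R (a + b) = r *\<^sub>R a + r *\<^sub>R b" "(r + s) *\<^sub>R a = r *\<^sub>R a + s *\<^sub>R a"
    "r *\<^sub>R s *\<^sub>R a = (r * s) *\<^sub>R a" "1 *\<^sub>R a = a"
    by (simp_all add: defs scaleR_add_left scaleR_add_right)
  show "a * b * c = a * (b * c)" "(a + b) * c = a * c + b * c" "a * (b + c) = a * b + a * c"
    "r *\<^sub>R a * b = r *\<^sub>R (a * b)" "a * r *\<^sub>R b = r *\<^sub>R (a * b)" "1 * a = a" "a * 1 = a"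
    by (simp_all add: defs matrix_mul_assoc mat_simps)
  have "mat 1 \<noteq> (0 :: complex ^ 'a ^ 'a)"
    by (metis matrix_vector_mul_lid matrix_vector_mult_0 axis_eq_0_iff zero_neq_one)
  then show "(0 :: 'a matalg) \<noteq> 1"
    by (simp add: defs matalg_of_inject)
  show "dist a b = norm (a - b)" "sgn a = inverse (norm a) *\<^sub>R a"
    by (simp_all add: dist_matalg_def sgn_matalg_def)
  show "(uniformity :: ('a matalg \<times> 'a matalg) filter) = (INF e\<in>{0 <..}. principal {(x, y). dist x y < e})"
    by (simp add: uniformity_matalg_def)
  show "open S = (\<forall>x\<in>S. \<forall>\<^sub>F (x', y) in uniformity. x' = x \<longrightarrow> y \<in> S)" for S :: "'a matalg set"
    by (simp add: open_matalg_def)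
  have "opnorm A = 0 \<longleftrightarrow> A = 0" for A :: "complex ^ 'a ^ 'a"
    unfolding opnorm_def by (subst onorm_eq_0) (auto simp: matrix_eq)
  moreover have "mat_of a = 0 \<longleftrightarrow> a = matalg_of 0"
    by (metis mat_of_inverses)
  ultimately show "norm a = 0 \<longleftrightarrow> a = 0"
    by (simp add: defs)
  show "norm (a + b) \<le> norm a + norm b"
    unfolding defs mat_of_inverses opnorm_def matrix_vector_mult_add_rdistrib
    by (rule onorm_triangle) simp_all
  show "norm (r *\<^sub>R a) = \<bar>r\<bar> * norm a"
    unfolding defs mat_of_inverses opnorm_def mv_scaleR by (rule onorm_scaleR) simp
  show "norm (a * b) \<le> norm a * norm b"
    unfolding defs mat_of_inverses
  proof (rule opnorm_le)
    fix x
    have "norm ((mat_of a ** mat_of b) *v x) \<le> opnorm (mat_of a) * norm (mat_of b *v x)"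
      by (simp add: matrix_vector_mul_assoc[symmetric] opnorm)
    also have "\<dots> \<le> opnorm (mat_of a) * (opnorm (mat_of b) * norm x)"
      by (intro mult_left_mono opnorm opnorm_nonneg)
    finally show "norm ((mat_of a ** mat_of b) *v x) \<le> opnorm (mat_of a) * opnorm (mat_of b) * norm x"
      by (simp add: mult.assoc)
  qed
  have "(\<lambda>x :: complex ^ 'a. mat 1 *v x) = (\<lambda>x. x)"
    by (rule ext) simp
  then show "norm (1 :: 'a matalg) = 1"
    unfolding defs mat_of_inverses opnorm_def by (simp only: onorm_id)
qed

end

lemma bounded_linear_mat_of: "bounded_linear (mat_of :: 'n::finite matalg \<Rightarrow> _)"
proof
  show "mat_of (a + b) = mat_of a + mat_of b" "mat_of (r *\<^sub>R a) = r *\<^sub>R mat_of a" for a b :: "'n matalg" and r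
    by (simp_all add: plus_matalg_def scaleR_matalg_def)
  show "\<exists>K. \<forall>a :: 'n matalg. norm (mat_of a) \<le> norm a * K"
    by (rule exI[of _ "real CARD('n) * real CARD('n)"])
      (metis norm_le_opnorm mult.commute norm_matalg_def)
qed

lemma bounded_linear_matalg_of: "bounded_linear (matalg_of :: _ \<Rightarrow> 'n::finite matalg)"
proof
  show "matalg_of (a + b) = matalg_of a + matalg_of b" "matalg_of (r *\<^sub>R a) = r *\<^sub>R matalg_of a"
    for a b :: "complex ^ 'n ^ 'n" and r
    by (simp_all add: plus_matalg_def scaleR_matalg_def)
  show "\<exists>K. \<forall>A. norm (matalg_of A :: 'n matalg) \<le> norm A * K"
    using opnorm_le_norm by (auto simp: norm_matalg_def mult.commute)
qed

instance matalg :: (finite) banach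
proof
  fix X :: "nat \<Rightarrow> 'a matalg"
  assume "Cauchy X"
  then have "Cauchy (\<lambda>n. mat_of (X n))"
    by (rule bounded_linear.Cauchy[OF bounded_linear_mat_of])
  then obtain L where "(\<lambda>n. mat_of (X n)) \<longlonglongrightarrow> L"
    using Cauchy_convergent_iff convergent_def by blast
  then have "(\<lambda>n. matalg_of (mat_of (X n)) :: 'a matalg) \<longlonglongrightarrow> matalg_of L"
    by (rule bounded_linear.tendsto[OF bounded_linear_matalg_of])
  then show "convergent X"
    unfolding convergent_def by auto
qed

lemma mat_of_power: "mat_of (a ^ m) = mpow (mat_of a) m"
  by (induction m) (simp_all add: one_matalg_def times_matalg_def)

lemma mexp_sums: "(\<lambda>m. (1 / fact m) *\<^sub>R mpow A m) sums mat_of (exp (matalg_of A))"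
proof -
  have "(\<lambda>m. matalg_of A ^ m /\<^sub>R fact m) sums exp (matalg_of A)"
    unfolding exp_def by (rule summable_sums[OF summable_exp_generic])
  from bounded_linear.sums[OF bounded_linear_mat_of this] show ?thesis
    by (simp add: linear_simps[OF bounded_linear_mat_of] mat_of_power divide_inverse)
qed

lemma mexp_conv_exp: "mexp A = mat_of (exp (matalg_of A))"
  unfolding mexp_def using mexp_sums[of A] by (simp add: sums_iff)

lemma mexp_series: "(\<lambda>m. (1 / fact m) *\<^sub>R mpow A m) sums mexp A"
  using mexp_sums by (simp add: mexp_conv_exp)

lemma mexp_0 [simp]: "mexp 0 = mat 1"
  by (simp add: mexp_conv_exp zero_matalg_def[symmetric] one_matalg_def)

lemma mexp_add: "A ** B = B ** A \<Longrightarrow> mexp (A + B) = mexp A ** mexp B"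
proof -
  assume "A ** B = B ** A"
  then have "matalg_of A * matalg_of B = matalg_of B * matalg_of A"
    by (simp add: times_matalg_def)
  from exp_add_commuting[OF this] show ?thesis
    by (simp add: mexp_conv_exp linear_simps[OF bounded_linear_matalg_of] times_matalg_def)
qed

lemma mexp_minus_right: "mexp A ** mexp (- A) = mat 1"
  using mexp_add[of A "- A"] by (simp add: mult_minus_left mult_minus_right)

lemma mexp_minus_left: "mexp (- A) ** mexp A = mat 1"
  using mexp_minus_right[of "- A"] by simp

text \<open>Intertwining passes through every power and hence termwise through the series.
  \<open>C = A\<close> gives commutation; \<open>C\<close> equal to \<open>A\<close> shifted by a
  scalar gives the ladder rule below.\<close>

lemma mexp_intertwine: "mexp A ** B = B ** mexp C" if "A ** B = B ** C"
proof -
  have pow: "mpow A m ** B = B ** mpow C m" for m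
  proof (induction m)
    case (Suc m)
    have "mpow A (Suc m) ** B = A ** (mpow A m ** B)" by (simp add: matrix_mul_assoc)
    also have "\<dots> = (A ** B) ** mpow C m" by (simp add: Suc matrix_mul_assoc)
    finally show ?case by (simp add: that matrix_mul_assoc)
  qed simp
  have "(\<lambda>m. (1 / fact m) *\<^sub>R (mpow A m ** B)) sums (mexp A ** B)"
    using bounded_linear.sums[OF bounded_bilinear.bounded_linear_left[OF bounded_bilinear_matrix_mult] mexp_series[of A]]
    by (simp add: scaleR_mult_left)
  moreover have "(\<lambda>m. (1 / fact m) *\<^sub>R (B ** mpow C m)) sums (B ** mexp C)"
    using bounded_linear.sums[OF bounded_bilinear.bounded_linear_right[OF bounded_bilinear_matrix_mult] mexp_series[of C]]
    by (simp add: scaleR_mult_right)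
  ultimately show ?thesis by (simp add: pow sums_iff)
qed

lemma mexp_eigen: "mexp A *v x = exp a *s x" if "A *v x = a *s x"
proof -
  have pow: "mpow A m *v x = a ^ m *s x" for m
    by (induction m) (simp_all add: matrix_vector_mul_assoc[symmetric] mv_smult that mult.commute)
  have "(\<lambda>m. (1 / fact m) *\<^sub>R (mpow A m *v x)) sums (mexp A *v x)"
    using bounded_linear.sums[OF bounded_bilinear.bounded_linear_left[OF bounded_bilinear_matrix_vector_mult] mexp_series[of A]]
    by (simp add: mv_scaleR)
  moreover have "(\<lambda>m. (1 / fact m) *\<^sub>R (a ^ m *s x)) sums (exp a *s x)"
  proof -
    have "bounded_linear (\<lambda>c. c *s x)"
      by (intro linear_conv_bounded_linear[THEN iffD1] linearI)
        (simp_all add: vec_eq_iff algebra_simps)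
    moreover have "(\<lambda>m. a ^ m /\<^sub>R fact m) sums exp a"
      unfolding exp_def by (rule summable_sums[OF summable_exp_generic])
    ultimately have "(\<lambda>m. (a ^ m /\<^sub>R fact m) *s x) sums (exp a *s x)"
      by (rule bounded_linear.sums)
    then show ?thesis by (simp add: smult_scaleR scaleR_conv_of_real divide_inverse)
  qed
  ultimately show ?thesis by (simp add: pow sums_iff)
qed

lemma cadj_mexp: "cadj (mexp A) = mexp (cadj A)"
proof -
  have comm: "A ** mpow A m = mpow A m ** A" for A :: "complex ^ 'n ^ 'n" and m
    by (induction m) (simp_all add: matrix_mul_assoc)
  have pow: "cadj (mpow A m) = mpow (cadj A) m" for m
    by (induction m) (simp_all add: cadj_mult comm)
  show ?thesis
    using bounded_linear.sums[OF bounded_linear_cadj mexp_series[of A]] mexp_series[of "cadj A"]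
    by (simp add: cadj_scaleR pow sums_iff)
qed

lemma mexp_add_scalar: "mexp (A + c *\<^sub>M mat 1) = exp c *\<^sub>M mexp A" for A :: "complex ^ 'n ^ 'n"
proof -
  have "mexp (c *\<^sub>M mat 1 :: complex ^ 'n ^ 'n) = exp c *\<^sub>M mat 1"
    by (rule mat_eqI) (simp add: mv_cscale mexp_eigen)
  then show ?thesis
    by (subst mexp_add) (simp_all add: cscale_mult_left cscale_mult_right)
qed

text \<open>For \<open>A\<close> a second quantized generator and \<open>B\<close> a ladder operator, this is the action of
  the group on a mode.\<close>

lemma mexp_ladder: "mexp A ** B = exp c *\<^sub>M (B ** mexp A)" if "A ** B - B ** A = c *\<^sub>M B"
proof -
  have "A ** B = B ** (A + c *\<^sub>M mat 1)"
    using that by (simp add: mat_simps algebra_simps)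
  from mexp_intertwine[OF this] show ?thesis
    by (simp add: mexp_add_scalar cscale_mult_right)
qed

lemma mexp_has_vector_derivative:
  "((\<lambda>t. mexp (t *\<^sub>R A)) has_vector_derivative (A ** mexp (t *\<^sub>R A))) (at t within S)"
proof -
  have "((\<lambda>t. mat_of (exp (t *\<^sub>R matalg_of A))) has_vector_derivative mat_of (matalg_of A * exp (t *\<^sub>R matalg_of A))) (at t within S)"
    by (intro bounded_linear.has_vector_derivative[OF bounded_linear_mat_of]
        has_vector_derivative_at_within[OF exp_scaleR_has_vector_derivative_left])
  then show ?thesis
    by (simp add: mexp_conv_exp times_matalg_def scaleR_matalg_def)
qed

lemma mexp_commute: "A ** mexp (t *\<^sub>R A) = mexp (t *\<^sub>R A) ** A"
  by (rule mexp_intertwine[symmetric]) (simp add: mat_simps)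

section \<open>The spectral theorem and square roots\<close>

definition orthonormal :: "(nat \<Rightarrow> complex ^ 'n) \<Rightarrow> nat \<Rightarrow> bool" where
  "orthonormal \<psi> m \<longleftrightarrow> (\<forall>i<m. \<forall>j<m. cinner (\<psi> i) (\<psi> j) = (if i = j then 1 else 0))"

lemma ex_enumeration: "\<exists>h :: nat \<Rightarrow> 'n::finite. bij_betw h {..<CARD('n)} UNIV"
  using ex_bij_betw_nat_finite[of "UNIV :: 'n set"] by (auto simp: lessThan_atLeast0)

text \<open>The vectors are the columns of a square matrix \<open>P\<close> with
  \<open>cadj P ** P = mat 1\<close>; for square matrices the other order follows, and
  \<open>P ** cadj P\<close> is the sum of the projections.\<close>

lemma orthonormal_completeness:
  fixes \<psi> :: "nat \<Rightarrow> complex ^ 'n"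
  assumes "orthonormal \<psi> CARD('n)"
  shows "(\<Sum>j<CARD('n). ketbra (\<psi> j) (\<psi> j)) = mat 1"
proof -
  obtain h :: "nat \<Rightarrow> 'n" where h: "bij_betw h {..<CARD('n)} UNIV"
    using ex_enumeration by blast
  define P :: "complex ^ 'n ^ 'n" where "P = (\<chi> a i. \<psi> (inv_into {..<CARD('n)} h i) $ a)"
  have inv: "inv_into {..<CARD('n)} h i < CARD('n)" for i
    using bij_betw_apply[OF bij_betw_inv_into[OF h], of i] by simp
  have inj: "inv_into {..<CARD('n)} h i = inv_into {..<CARD('n)} h j \<longleftrightarrow> i = j" for i j
    using bij_betw_inv_into[OF h] by (auto simp: bij_betw_def inj_on_def)
  have "(cadj P ** P) $ i $ j = cinner (\<psi> (inv_into {..<CARD('n)} h i)) (\<psi> (inv_into {..<CARD('n)} h j))" for i j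
    by (simp add: P_def matrix_matrix_mult_def cadj_def cinner_def)
  then have "cadj P ** P = mat 1"
    using assms inv inj by (simp add: orthonormal_def vec_eq_iff mat_def)
  then have "P ** cadj P = mat 1"
    by (simp add: matrix_left_right_inverse)
  moreover have "(P ** cadj P) $ a $ b = (\<Sum>j<CARD('n). ketbra (\<psi> j) (\<psi> j)) $ a $ b" for a b
  proof -
    have "(P ** cadj P) $ a $ b = (\<Sum>i\<in>UNIV. ketbra (\<psi> (inv_into {..<CARD('n)} h i)) (\<psi> (inv_into {..<CARD('n)} h i)) $ a $ b)"
      by (simp add: P_def matrix_matrix_mult_def cadj_def ketbra_def)
    also have "\<dots> = (\<Sum>j<CARD('n). ketbra (\<psi> j) (\<psi> j) $ a $ b)"
      by (rule sum.reindex_bij_betw[OF bij_betw_inv_into[OF h]])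
    finally show ?thesis by simp
  qed
  ultimately show ?thesis by (simp add: vec_eq_iff)
qed

text \<open>The square matrix whose nonzero rows can only be the m given bras has a vanishing row,
  so it is not invertible and has a kernel vector.\<close>

lemma orthonormal_extend:
  fixes \<psi> :: "nat \<Rightarrow> complex ^ 'n"
  assumes "m < CARD('n)"
  shows "\<exists>x. x \<noteq> 0 \<and> (\<forall>i<m. cinner (\<psi> i) x = 0)"
proof (rule ccontr)
  assume neg: "\<not> ?thesis"
  obtain h :: "nat \<Rightarrow> 'n" where h: "bij_betw h {..<CARD('n)} UNIV"
    using ex_enumeration by blast
  define k where "k = inv_into {..<CARD('n)} h"
  define A :: "complex ^ 'n ^ 'n" where "A = (\<chi> i b. if k i < m then cnj (\<psi> (k i) $ b) else 0)"
  have kh: "k (h i) = i" if "i < CARD('n)" for i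
    unfolding k_def using h that by (simp add: bij_betw_def)
  have "x = 0" if "A *v x = 0" for x
  proof -
    have "cinner (\<psi> i) x = 0" if "i < m" for i
    proof -
      have "(A *v x) $ h i = cinner (\<psi> i) x"
        using that assms by (simp add: A_def kh matrix_vector_mult_def cinner_def)
      then show ?thesis using \<open>A *v x = 0\<close> by simp
    qed
    then show ?thesis using neg by blast
  qed
  then obtain B where "B ** A = mat 1"
    using matrix_left_invertible_ker[of A] by blast
  then have "A ** B = mat 1" by (simp add: matrix_left_right_inverse)
  then have "(A ** B) $ h m $ h m = 1" by (simp add: mat_def)
  moreover have "(A ** B) $ h m $ h m = 0"
    using assms by (simp add: A_def kh matrix_matrix_mult_def)
  ultimately show False by simp
qed

lemma selfadj_inner: "selfadj A \<Longrightarrow> x \<bullet> (A *v y) = (A *v x) \<bullet> y"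
  by (simp add: Re_cinner[symmetric] cinner_mv selfadj_def)

text \<open>A maximizer of the quadratic form on the unit sphere of an invariant subspace is an
  eigenvector.\<close>

lemma selfadj_eigenvector:
  fixes A :: "complex ^ 'n ^ 'n"
  assumes A: "selfadj A" and V: "subspace V" "\<And>x. x \<in> V \<Longrightarrow> A *v x \<in> V" and "v \<in> V" "v \<noteq> 0"
  shows "\<exists>x \<mu>. x \<in> V \<and> norm x = 1 \<and> A *v x = \<mu> *\<^sub>R x"
proof -
  define f where "f x = x \<bullet> (A *v x)" for x
  have "continuous_on UNIV f"
    unfolding f_def by (intro continuous_intros linear_continuous_on) simp
  moreover have "compact (V \<inter> sphere 0 1)"
    using closed_subspace[OF V(1)] by (intro closed_Int_compact) auto
  moreover have "v /\<^sub>R norm v \<in> V \<inter> sphere 0 1"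
    using assms by (simp add: subspace_scale)
  ultimately obtain x where x: "x \<in> V \<inter> sphere 0 1" and max: "\<And>y. y \<in> V \<inter> sphere 0 1 \<Longrightarrow> f y \<le> f x"
    using continuous_attains_sup[of "V \<inter> sphere 0 1" f] continuous_on_subset by blast
  then have x: "x \<in> V" "norm x = 1" by auto
  have f_scale: "f (c *\<^sub>R y) = c\<^sup>2 * f y" for c y
    by (simp add: f_def mv_scaleR_right power2_eq_square)
  have le: "f y \<le> f x * (y \<bullet> y)" if "y \<in> V" for y
  proof (cases "y = 0")
    case False
    have "f (y /\<^sub>R norm y) \<le> f x"
      using False that V(1) by (intro max) (simp add: subspace_scale)
    then have "f y / (norm y)\<^sup>2 \<le> f x"
      by (simp add: f_scale power2_eq_square divide_inverse mult.commute)
    then show ?thesis using False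
      by (simp add: pos_divide_le_eq dot_square_norm)
  qed (simp add: f_def)
  define w where "w = A *v x - f x *\<^sub>R x"
  have w: "w \<in> V"
    unfolding w_def using x V by (simp add: subspace_diff subspace_scale)
  \<comment> \<open>First-order condition at the maximizer: perturb \<open>x\<close> by
    \<open>t\<close> times the residual \<open>w\<close> and compare both sides of
    \<open>le\<close>; the term linear in \<open>t\<close> is what remains on the left.\<close>
  have ineq: "2 * t * (w \<bullet> w) \<le> t\<^sup>2 * (f x * (w \<bullet> w) - f w)" for t
  proof -
    have i1: "f (x + t *\<^sub>R w) \<le> f x * ((x + t *\<^sub>R w) \<bullet> (x + t *\<^sub>R w))"
      using x w V by (intro le) (simp add: subspace_add subspace_scale)
    have i2: "f (x + t *\<^sub>R w) = f x + 2 * t * (w \<bullet> (A *v x)) + t\<^sup>2 * f w"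
    proof -
      have "x \<bullet> (A *v w) = w \<bullet> (A *v x)" using selfadj_inner[OF A] by (metis inner_commute)
      then show ?thesis
        by (simp add: f_def algebra_simps inner_add_left inner_add_right mv_scaleR_right power2_eq_square)
    qed
    have i3: "(x + t *\<^sub>R w) \<bullet> (x + t *\<^sub>R w) = 1 + 2 * t * (w \<bullet> x) + t\<^sup>2 * (w \<bullet> w)"
    proof -
      have "x \<bullet> x = 1" using x(2) by (simp add: dot_square_norm)
      then show ?thesis
        by (simp add: inner_add_left inner_add_right inner_commute power2_eq_square algebra_simps)
    qed
    have i4: "w \<bullet> (A *v x) = w \<bullet> w + f x * (w \<bullet> x)" 
    proof -
      have "A *v x = w + f x *\<^sub>R x" by (simp add: w_def)
      then show ?thesis by (simp add: inner_add_right)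
    qed
    have "f x + 2 * t * (w \<bullet> w + f x * (w \<bullet> x)) + t\<^sup>2 * f w \<le> f x * (1 + 2 * t * (w \<bullet> x) + t\<^sup>2 * (w \<bullet> w))"
      using i1 unfolding i2 i3 i4 .
    then show ?thesis by (simp add: algebra_simps)
  qed
  have "w \<bullet> w = 0"
  proof (rule ccontr)
    assume "w \<bullet> w \<noteq> 0"
    then have pos: "w \<bullet> w > 0" by (simp add: inner_gt_zero_iff)
    \<comment> \<open>\<open>c\<close> is a positive bound for the quadratic coefficient, and
      \<open>t\<close> makes \<open>t * c\<close> equal to \<open>w \<bullet> w\<close>, which
      cannot dominate twice that value.\<close>
    define c where "c = \<bar>f x * (w \<bullet> w) - f w\<bar> + 1"
    define t where "t = (w \<bullet> w) / c"
    have c: "c > 0" "f x * (w \<bullet> w) - f w \<le> c" by (auto simp: c_def)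
    have t: "t > 0" using pos c by (simp add: t_def)
    have "2 * t * (w \<bullet> w) \<le> t\<^sup>2 * c"
      using ineq[of t] mult_left_mono[OF c(2), of "t\<^sup>2"] by simp
    then have "2 * (w \<bullet> w) \<le> t * c" using t by (simp add: power2_eq_square)
    then show False using pos c by (simp add: t_def)
  qed
  then show ?thesis using x by (auto simp: w_def)
qed

text \<open>The vectors orthogonal to the eigenvectors found so far form an invariant subspace, as
  \<open>A\<close> is self-adjoint, and a nonzero one by \<open>orthonormal_extend\<close>; it
  supplies the next eigenvector.\<close>

lemma ex_orthonormal_eigenvectors:
  fixes A :: "complex ^ 'n ^ 'n"
  assumes A: "selfadj A" and "m \<le> CARD('n)"
  shows "\<exists>\<psi> \<mu>. orthonormal \<psi> m \<and> (\<forall>j<m. A *v \<psi> j = \<mu> j *\<^sub>R \<psi> j)"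
  using assms(2)
proof (induction m)
  case 0
  show ?case by (auto simp: orthonormal_def)
next
  case (Suc m)
  then obtain \<psi> \<mu> where \<psi>: "orthonormal \<psi> m" "\<And>j. j < m \<Longrightarrow> A *v \<psi> j = \<mu> j *\<^sub>R \<psi> j"
    by auto
  define V where "V = {x. \<forall>i<m. cinner (\<psi> i) x = 0}"
  have "subspace V"
    by (auto simp: V_def subspace_def cinner_add_right smult_scaleR cinner_smult_right)
  moreover have "A *v x \<in> V" if "x \<in> V" for x
    using that A \<psi>(2) by (auto simp: V_def cinner_mv selfadj_def smult_scaleR cinner_smult_left)
  moreover obtain v where "v \<in> V" "v \<noteq> 0"
    using orthonormal_extend[of m \<psi>] Suc.prems by (auto simp: V_def)
  ultimately obtain x c where x: "x \<in> V" "norm x = 1" "A *v x = c *\<^sub>R x"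
    using selfadj_eigenvector[OF A] by blast
  have "cinner x (\<psi> i) = 0" if "i < m" for i
    using x(1) that cinner_commute[of "\<psi> i" x] by (simp add: V_def)
  then have "orthonormal (\<psi>(m := x)) (Suc m)"
    using \<psi>(1) x by (auto simp: orthonormal_def less_Suc_eq V_def cinner_self)
  moreover have "\<forall>j<Suc m. A *v (\<psi>(m := x)) j = (\<mu>(m := c)) j *\<^sub>R (\<psi>(m := x)) j"
    using \<psi>(2) x by (auto simp: less_Suc_eq)
  ultimately show ?case by blast
qed

definition diag_op :: "(nat \<Rightarrow> complex ^ 'n) \<Rightarrow> (nat \<Rightarrow> real) \<Rightarrow> complex ^ 'n ^ 'n" where
  "diag_op \<psi> f = (\<Sum>j<CARD('n). f j *\<^sub>R ketbra (\<psi> j) (\<psi> j))"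

lemma spectral_decomp_iff:
  "spectral_decomp A \<psi> \<mu> \<longleftrightarrow> orthonormal \<psi> CARD('n) \<and> A = diag_op \<psi> \<mu>"
  for A :: "complex ^ 'n ^ 'n"
  by (simp add: spectral_decomp_def orthonormal_def diag_op_def)

lemma diag_op_eigen:
  fixes \<psi> :: "nat \<Rightarrow> complex ^ 'n"
  assumes "orthonormal \<psi> CARD('n)" "k < CARD('n)"
  shows "diag_op \<psi> f *v \<psi> k = f k *\<^sub>R \<psi> k"
proof -
  have "diag_op \<psi> f *v \<psi> k = (\<Sum>j<CARD('n). if j = k then f k *\<^sub>R \<psi> k else 0)"
    unfolding diag_op_def mv_sum using assms
    by (intro sum.cong) (auto simp: mv_scaleR ketbra_mv orthonormal_def smult_scaleR)
  then show ?thesis using assms by simp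
qed

lemma eq_if_eq_on_basis:
  fixes A B :: "complex ^ 'n ^ 'm"
  assumes "orthonormal \<psi> CARD('n)" "\<And>j. j < CARD('n) \<Longrightarrow> A *v \<psi> j = B *v \<psi> j"
  shows "A = B"
proof (rule mat_eqI)
  fix x
  have x: "x = (\<Sum>j<CARD('n). cinner (\<psi> j) x *s \<psi> j)"
    using arg_cong[OF orthonormal_completeness[OF assms(1)], of "\<lambda>M. M *v x"]
    by (simp add: mv_sum ketbra_mv)
  show "A *v x = B *v x"
    by (subst (1 2) x) (simp add: mv_sum_right mv_smult assms(2))
qed

lemma vec_eq_if_eq_on_basis:
  fixes x y :: "complex ^ 'n"
  assumes "orthonormal \<psi> CARD('n)" "\<And>j. j < CARD('n) \<Longrightarrow> cinner (\<psi> j) x = cinner (\<psi> j) y"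
  shows "x = y"
proof -
  have x: "x = (\<Sum>j<CARD('n). cinner (\<psi> j) x *s \<psi> j)" for x
    using arg_cong[OF orthonormal_completeness[OF assms(1)], of "\<lambda>M. M *v x"]
    by (simp add: mv_sum ketbra_mv)
  show ?thesis
    by (subst x[of x], subst x[of y]) (simp add: assms(2))
qed

theorem ex_spectral_decomp:
  assumes "selfadj A"
  shows "\<exists>\<psi> \<mu>. spectral_decomp A \<psi> \<mu>"
proof -
  obtain \<psi> \<mu> where \<psi>: "orthonormal \<psi> CARD('a)" "\<And>j. j < CARD('a) \<Longrightarrow> A *v \<psi> j = \<mu> j *\<^sub>R \<psi> j"
    using ex_orthonormal_eigenvectors[OF assms, of "CARD('a)"] by auto
  then have "A = diag_op \<psi> \<mu>"
    by (intro eq_if_eq_on_basis[OF \<psi>(1)]) (simp add: diag_op_eigen)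
  then show ?thesis using \<psi> by (auto simp: spectral_decomp_iff)
qed

lemma diag_op_selfadj: "selfadj (diag_op \<psi> f)"
  by (simp add: selfadj_def diag_op_def cadj_sum cadj_scaleR cadj_ketbra)

lemma diag_op_pos: "(\<And>j. j < CARD('n) \<Longrightarrow> 0 \<le> f j) \<Longrightarrow> pos_op (diag_op \<psi> f)"
  for \<psi> :: "nat \<Rightarrow> complex ^ 'n"
proof -
  assume f: "\<And>j. j < CARD('n) \<Longrightarrow> 0 \<le> f j"
  have "Re (cinner x (diag_op \<psi> f *v x)) = (\<Sum>j<CARD('n). f j * (cmod (cinner (\<psi> j) x))\<^sup>2)" for x
  proof -
    have "cinner (\<psi> j) x * cinner x (\<psi> j) = of_real ((cmod (cinner (\<psi> j) x))\<^sup>2)" for j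
      by (metis cinner_commute complex_norm_square)
    then show ?thesis
      by (simp add: diag_op_def mv_sum mv_scaleR ketbra_mv cinner_sum_right cinner_scaleR_right
          cinner_smult_right flip: of_real_mult del: of_real_power)
  qed
  then show ?thesis
    using f by (auto simp: pos_op_def diag_op_selfadj intro!: sum_nonneg)
qed

lemma diag_op_mult:
  fixes \<psi> :: "nat \<Rightarrow> complex ^ 'n"
  assumes "orthonormal \<psi> CARD('n)"
  shows "diag_op \<psi> f ** diag_op \<psi> g = diag_op \<psi> (\<lambda>j. f j * g j)"
  by (rule eq_if_eq_on_basis[OF assms])
    (simp add: diag_op_eigen[OF assms] matrix_vector_mul_assoc[symmetric] mv_scaleR_right mult.commute)

lemma diag_op_1:
  fixes \<psi> :: "nat \<Rightarrow> complex ^ 'n"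
  assumes "orthonormal \<psi> CARD('n)"
  shows "diag_op \<psi> (\<lambda>_. 1) = mat 1"
  using orthonormal_completeness[OF assms] by (simp add: diag_op_def)

lemma diag_op_diff: "diag_op \<psi> f - diag_op \<psi> g = diag_op \<psi> (\<lambda>j. f j - g j)"
  by (simp add: diag_op_def sum_subtractf scaleR_diff_left)

lemma diag_op_scaleR: "c *\<^sub>R diag_op \<psi> f = diag_op \<psi> (\<lambda>j. c * f j)"
  by (simp add: diag_op_def scaleR_sum_right)

lemma mexp_diag_op:
  fixes \<psi> :: "nat \<Rightarrow> complex ^ 'n"
  assumes "orthonormal \<psi> CARD('n)"
  shows "mexp (diag_op \<psi> f) = diag_op \<psi> (\<lambda>j. exp (f j))"
proof (rule eq_if_eq_on_basis[OF assms])
  fix j assume j: "j < CARD('n)"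
  have "diag_op \<psi> f *v \<psi> j = complex_of_real (f j) *s \<psi> j"
    using diag_op_eigen[OF assms j] by (simp add: smult_scaleR)
  from mexp_eigen[OF this] show "mexp (diag_op \<psi> f) *v \<psi> j = diag_op \<psi> (\<lambda>j. exp (f j)) *v \<psi> j"
    using diag_op_eigen[OF assms j] by (simp add: smult_scaleR exp_of_real)
qed

text \<open>Commuting with a diagonal operator forces the matrix elements of \<open>M\<close>
  between different eigenvalues to vanish. The condition on \<open>f\<close> says that
  \<open>f j\<close> is a function of the eigenvalue \<open>a j\<close>.\<close>

lemma diag_op_commute:
  fixes \<psi> :: "nat \<Rightarrow> complex ^ 'n"
  assumes \<psi>: "orthonormal \<psi> CARD('n)" and comm: "M ** diag_op \<psi> a = diag_op \<psi> a ** M"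
    and f: "\<And>i j. i < CARD('n) \<Longrightarrow> j < CARD('n) \<Longrightarrow> a i = a j \<Longrightarrow> f i = f j"
  shows "M ** diag_op \<psi> f = diag_op \<psi> f ** M"
proof (rule eq_if_eq_on_basis[OF \<psi>], rule vec_eq_if_eq_on_basis[OF \<psi>])
  fix j l assume j: "j < CARD('n)" and l: "l < CARD('n)"
  have 1: "cinner (\<psi> l) ((M ** diag_op \<psi> g) *v \<psi> j) = g j * cinner (\<psi> l) (M *v \<psi> j)" for g
    by (simp add: matrix_vector_mul_assoc[symmetric] diag_op_eigen[OF \<psi> j] smult_scaleR mv_smult cinner_smult_right)
  have 2: "cinner (\<psi> l) ((diag_op \<psi> g ** M) *v \<psi> j) = g l * cinner (\<psi> l) (M *v \<psi> j)" for g
    using diag_op_selfadj[of \<psi> g]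
    by (simp add: matrix_vector_mul_assoc[symmetric] cinner_mv[of _ "diag_op \<psi> g"] selfadj_def
        diag_op_eigen[OF \<psi> l] smult_scaleR cinner_smult_left)
  have "a j * cinner (\<psi> l) (M *v \<psi> j) = a l * cinner (\<psi> l) (M *v \<psi> j)"
    by (metis 1 2 comm)
  then have "a j = a l \<or> cinner (\<psi> l) (M *v \<psi> j) = 0"
    by (metis mult_cancel_right of_real_eq_iff)
  then show "cinner (\<psi> l) ((M ** diag_op \<psi> f) *v \<psi> j) = cinner (\<psi> l) ((diag_op \<psi> f ** M) *v \<psi> j)"
    using 1[of f] 2[of f] f[OF j l] by auto
qed

lemma spectral_pos:
  fixes A :: "complex ^ 'n ^ 'n"
  assumes "pos_op A" "spectral_decomp A \<psi> \<mu>" "j < CARD('n)"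
  shows "0 \<le> \<mu> j"
proof -
  have \<psi>: "orthonormal \<psi> CARD('n)" "A = diag_op \<psi> \<mu>"
    using assms(2) by (simp_all add: spectral_decomp_iff)
  then have "cinner (\<psi> j) (A *v \<psi> j) = \<mu> j"
    using diag_op_eigen[OF \<psi>(1) assms(3)] assms(3) by (simp add: smult_scaleR cinner_smult_right orthonormal_def)
  then show ?thesis using assms(1) by (metis pos_op_def Re_complex_of_real)
qed

text \<open>For an eigenvector of \<open>B\<close>, its defect \<open>y\<close> of being one of
  \<open>C\<close> satisfies \<open>C *v y = - \<mu> j *\<^sub>R y\<close>. Positivity of
  \<open>C\<close> forces \<open>y = 0\<close> or \<open>\<mu> j = 0\<close>; in the latter case the
  square of \<open>C\<close>, hence \<open>C\<close> itself, kills the eigenvector.\<close>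

lemma pos_sqrt_unique:
  assumes B: "pos_op B" and C: "pos_op C" and eq: "B ** B = C ** (C :: complex ^ 'n ^ 'n)"
  shows "B = C"
proof -
  obtain \<psi> \<mu> where sd: "spectral_decomp B \<psi> \<mu>"
    using B ex_spectral_decomp pos_op_def by blast
  then have \<psi>: "orthonormal \<psi> CARD('n)" "B = diag_op \<psi> \<mu>"
    by (simp_all add: spectral_decomp_iff)
  have "C *v \<psi> j = \<mu> j *\<^sub>R \<psi> j" if j: "j < CARD('n)" for j
  proof -
    define y where "y = C *v \<psi> j - \<mu> j *\<^sub>R \<psi> j"
    have \<mu>: "0 \<le> \<mu> j" by (rule spectral_pos[OF B sd j])
    have "B *v (B *v \<psi> j) = (\<mu> j * \<mu> j) *\<^sub>R \<psi> j"
      using diag_op_eigen[OF \<psi>(1) j] \<psi>(2) by (simp add: mv_scaleR_right)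
    then have CC: "C *v (C *v \<psi> j) = (\<mu> j * \<mu> j) *\<^sub>R \<psi> j"
      using eq by (simp add: matrix_vector_mul_assoc)
    then have *: "C *v y = - \<mu> j *\<^sub>R y"
      by (simp add: y_def matrix_vector_mult_diff_distrib mv_scaleR_right algebra_simps)
    have "y \<bullet> (C *v y) \<ge> 0"
      using C by (simp add: pos_op_def Re_cinner)
    then have "\<mu> j * (y \<bullet> y) \<le> 0" by (simp add: *)
    moreover have "0 \<le> \<mu> j * (y \<bullet> y)" using \<mu> by simp
    ultimately have "\<mu> j = 0 \<or> y = 0" by (auto simp: antisym)
    then have "y = 0"
    proof
      assume "\<mu> j = 0"
      then have "y = C *v \<psi> j" "C *v (C *v \<psi> j) = 0" by (simp_all add: y_def CC)
      then have "y \<bullet> y = 0"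
        using C selfadj_inner[of C "\<psi> j" "C *v \<psi> j"] by (simp add: pos_op_def)
      then show ?thesis by simp
    qed
    then show ?thesis by (simp add: y_def)
  qed
  then show ?thesis
    by (intro eq_if_eq_on_basis[OF \<psi>(1)]) (simp add: \<psi>(2) diag_op_eigen[OF \<psi>(1)])
qed

lemma op_sqrt_unique: "pos_op B \<Longrightarrow> B ** B = A \<Longrightarrow> op_sqrt A = B"
  unfolding op_sqrt_def using pos_sqrt_unique by (intro the_equality) auto

lemma op_sqrt_diag_op:
  fixes \<psi> :: "nat \<Rightarrow> complex ^ 'n"
  assumes "orthonormal \<psi> CARD('n)" "\<And>j. j < CARD('n) \<Longrightarrow> 0 \<le> f j"
  shows "op_sqrt (diag_op \<psi> f) = diag_op \<psi> (\<lambda>j. sqrt (f j))"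
proof (rule op_sqrt_unique)
  show "pos_op (diag_op \<psi> (\<lambda>j. sqrt (f j)))"
    using assms by (intro diag_op_pos) simp
  show "diag_op \<psi> (\<lambda>j. sqrt (f j)) ** diag_op \<psi> (\<lambda>j. sqrt (f j)) = diag_op \<psi> f"
    unfolding diag_op_mult[OF assms(1)] using assms(2) by (simp add: diag_op_def)
qed

section \<open>Ladder operators and second quantization\<close>

locale car =
  fixes Z :: "complex ^ 'n \<Rightarrow> complex ^ 'k ^ 'k"
  assumes CAR: "CAR_field Z"
begin

lemma Z_add: "Z (\<psi> + \<phi>) = Z \<psi> + Z \<phi>"
  and Z_smult: "Z (c *s \<psi>) = cnj c *\<^sub>M Z \<psi>"
  and anti_star: "Z \<psi> ** cadj (Z \<phi>) + cadj (Z \<phi>) ** Z \<psi> = cinner \<psi> \<phi> *\<^sub>M mat 1"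
  and anti_Z: "Z \<psi> ** Z \<phi> + Z \<phi> ** Z \<psi> = 0"
  using CAR by (simp_all add: CAR_field_def)

lemma Z_0 [simp]: "Z 0 = 0"
  using Z_smult[of 0 0] by simp

lemma Z_scaleR: "Z (r *\<^sub>R \<psi>) = r *\<^sub>R Z \<psi>"
  by (simp add: smult_scaleR Z_smult cscale_scaleR)

lemma Z_minus: "Z (- \<psi>) = - Z \<psi>"
  using Z_scaleR[of "-1" \<psi>] by simp

lemma Z_diff: "Z (\<psi> - \<phi>) = Z \<psi> - Z \<phi>"
  using Z_add[of \<psi> "- \<phi>"] by (simp add: Z_minus)

lemma Z_sum: "Z (\<Sum>i\<in>I. f i) = (\<Sum>i\<in>I. Z (f i))"
  by (induction I rule: infinite_finite_induct) (auto simp: Z_add)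

lemma anti_Zstar: "cadj (Z \<psi>) ** cadj (Z \<phi>) + cadj (Z \<phi>) ** cadj (Z \<psi>) = 0"
  using arg_cong[OF anti_Z[of \<phi> \<psi>], of cadj] by (simp add: cadj_simps)

lemma Z_square: "Z \<psi> ** Z \<psi> = 0"
  using anti_Z[of \<psi> \<psi>] by (simp add: vec_eq_iff)

lemma Zstar_square: "cadj (Z \<psi>) ** cadj (Z \<psi>) = 0"
  using anti_Zstar[of \<psi> \<psi>] by (simp add: vec_eq_iff)

lemma Z_axis_expansion: "Z \<psi> = (\<Sum>i\<in>UNIV. cnj (\<psi> $ i) *\<^sub>M Z (axis i 1))"
  by (subst axis_expansion[of \<psi>, symmetric]) (simp add: Z_sum Z_smult)

lemma Zstar_axis_expansion: "cadj (Z \<psi>) = (\<Sum>i\<in>UNIV. \<psi> $ i *\<^sub>M cadj (Z (axis i 1)))"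
  by (subst Z_axis_expansion) (simp add: cadj_simps)

end

text \<open>Words in the ladder operators: a letter \<open>(True, \<phi>)\<close> stands for \<open>Z\<^sup>*(\<phi>)\<close> and
  \<open>(False, \<phi>)\<close> for \<open>Z(\<phi>)\<close>.\<close>

definition ladder :: "(complex ^ 'n \<Rightarrow> complex ^ 'k ^ 'k) \<Rightarrow> bool \<times> (complex ^ 'n) \<Rightarrow> complex ^ 'k ^ 'k" where
  "ladder Z x = (if fst x then cadj (Z (snd x)) else Z (snd x))"

text \<open>The scalar of the canonical anticommutation relations for two letters; the vector of the
  annihilator comes first, since \<open>Z\<close> is conjugate linear.\<close>

definition acomm :: "bool \<times> (complex ^ 'n) \<Rightarrow> bool \<times> (complex ^ 'n) \<Rightarrow> complex" where
  "acomm x y = (if fst x = fst y then 0 else if fst x then cinner (snd y) (snd x) else cinner (snd x) (snd y))"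

definition word_op :: "(complex ^ 'n \<Rightarrow> complex ^ 'k ^ 'k) \<Rightarrow> (bool \<times> (complex ^ 'n)) list \<Rightarrow> complex ^ 'k ^ 'k" where
  "word_op Z w = foldr (\<lambda>x A. ladder Z x ** A) w (mat 1)"

lemma word_op_simps [simp]: "word_op Z [] = mat 1" "word_op Z (x # w) = ladder Z x ** word_op Z w"
  by (simp_all add: word_op_def)

lemma word_op_append: "word_op Z (v @ w) = word_op Z v ** word_op Z w"
  by (induction v) (simp_all add: matrix_mul_assoc)

lemma cadj_word_op: "cadj (word_op Z w) = word_op Z (rev (map (map_prod Not id) w))"
  by (induction w) (auto simp: word_op_append cadj_mult ladder_def)

text \<open>\<open>span\<close> is taken over the reals, so complex coefficients are built into the
  generators.\<close>

definition word_span :: "(complex ^ 'n \<Rightarrow> complex ^ 'k ^ 'k) \<Rightarrow> (complex ^ 'k ^ 'k) set" where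
  "word_span Z = span (range (\<lambda>(c, w). c *\<^sub>M word_op Z w))"

lemma word_in_span: "c *\<^sub>M word_op Z w \<in> word_span Z"
  unfolding word_span_def by (rule span_base) auto

lemma word_span_induct [consumes 1, case_names base subspace]:
  assumes "X \<in> word_span Z" "\<And>c w. P (c *\<^sub>M word_op Z w)" "subspace {X. P X}"
  shows "P X"
  by (rule span_induct[OF assms(1)[unfolded word_span_def] assms(3)]) (use assms(2) in auto)

lemma subspace_word_span: "subspace (word_span Z)"
  by (simp add: word_span_def)

lemma word_span_mult:
  assumes "A \<in> word_span Z" "B \<in> word_span Z"
  shows "A ** B \<in> word_span Z"
  using assms(1)
proof (induction rule: word_span_induct)
  case (base c v)
  show ?case
    using assms(2)
  proof (induction rule: word_span_induct)
    case (base d w)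
    show ?case
      using word_in_span[of "c * d" Z "v @ w"]
      by (simp add: word_op_append cscale_mult_left cscale_mult_right mult.commute)
  next
    case subspace
    show ?case
      using subspace_word_span[of Z]
      by (auto simp: subspace_def mat_simps cscale_add cscale_scaleR_commute)
  qed
next
  case subspace
  show ?case
    using subspace_word_span[of Z] by (auto simp: subspace_def mat_simps)
qed

lemma word_span_cscale:
  assumes "A \<in> word_span Z"
  shows "c *\<^sub>M A \<in> word_span Z"
  using word_span_mult[OF word_in_span[of c Z "[]"] assms] by (simp add: cscale_mult_left)

lemma word_span_cadj:
  assumes "A \<in> word_span Z"
  shows "cadj A \<in> word_span Z"
  using assms
proof (induction rule: word_span_induct)
  case (base c v)
  show ?case by (simp add: cadj_cscale cadj_word_op word_in_span)
next
  case subspace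
  show ?case
    using subspace_word_span[of Z] by (auto simp: subspace_def cadj_simps)
qed

lemma star_alg_subset_word_span: "star_alg (range Z) \<subseteq> word_span Z"
proof
  fix A assume "A \<in> star_alg (range Z)"
  then show "A \<in> word_span Z"
  proof induction
    case (gen A)
    then obtain \<psi> where "A = Z \<psi>" by auto
    then show ?case
      using word_in_span[of 1 Z "[(False, \<psi>)]"] by (simp add: ladder_def)
  next
    case (add A B)
    then show ?case using subspace_word_span[of Z] by (simp add: subspace_add)
  qed (auto intro: word_span_cscale word_span_mult word_span_cadj)
qed

context car
begin

lemma ladder_anti: "ladder Z x ** ladder Z y + ladder Z y ** ladder Z x = acomm x y *\<^sub>M mat 1"
proof (cases "fst x = fst y")
  case True
  then show ?thesis by (auto simp: ladder_def acomm_def anti_Z anti_Zstar)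
next
  case False
  then show ?thesis
    using anti_star[of "snd y" "snd x"] anti_star[of "snd x" "snd y"]
    by (auto simp: ladder_def acomm_def add.commute)
qed

text \<open>A graded Leibniz rule: passing a letter through the word flips the sign at each step and
  leaves one contraction per letter. It drives both normal ordering at the vacuum and Wick's
  recursion.\<close>

lemma ladder_word_anti:
  "ladder Z x ** word_op Z w = (-1) ^ length w *\<^sub>M (word_op Z w ** ladder Z x)
     + (\<Sum>i<length w. ((-1) ^ i * acomm x (w ! i)) *\<^sub>M word_op Z (take i w @ drop (Suc i) w))"
proof (induction w)
  case (Cons y w)
  have "ladder Z x ** ladder Z y = acomm x y *\<^sub>M mat 1 - ladder Z y ** ladder Z x"
    using ladder_anti[of x y] by (simp add: eq_diff_eq)
  then have "ladder Z x ** word_op Z (y # w) = acomm x y *\<^sub>M word_op Z w - ladder Z y ** (ladder Z x ** word_op Z w)"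
    by (simp add: matrix_mul_assoc mat_simps)
  also have "\<dots> = acomm x y *\<^sub>M word_op Z w
      - ladder Z y ** ((-1) ^ length w *\<^sub>M (word_op Z w ** ladder Z x)
        + (\<Sum>i<length w. ((-1) ^ i * acomm x (w ! i)) *\<^sub>M word_op Z (take i w @ drop (Suc i) w)))"
    by (subst Cons.IH) simp
  also have "\<dots> = (-1) ^ length (y # w) *\<^sub>M (word_op Z (y # w) ** ladder Z x)
     + (acomm x y *\<^sub>M word_op Z w
      + (\<Sum>i<length w. ((-1) ^ Suc i * acomm x (w ! i)) *\<^sub>M (ladder Z y ** word_op Z (take i w @ drop (Suc i) w))))"
    by (simp add: mat_simps matrix_mul_assoc cscale_minus sum_negf)
  finally show ?case
    by (simp add: sum.lessThan_Suc_shift del: sum.lessThan_Suc)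
qed simp

lemma Z_in_star_alg: "Z \<psi> \<in> star_alg (range Z)" "cadj (Z \<psi>) \<in> star_alg (range Z)"
  by (auto intro: star_alg.star star_alg.gen)

lemma mat1_in_star_alg: "mat 1 \<in> star_alg (range Z)"
proof -
  let ?e = "axis undefined 1 :: complex ^ 'n"
  have "Z ?e ** cadj (Z ?e) + cadj (Z ?e) ** Z ?e \<in> star_alg (range Z)"
    by (intro star_alg.add star_alg.mult star_alg.star star_alg.gen) auto
  then show ?thesis by (simp add: anti_star cinner_axis)
qed

text \<open>Second quantization in the standard basis: linear in \<open>M\<close> by construction
  and available for operators that are not self-adjoint, such as \<open>\<i>\<close> times a
  projection.\<close>

definition dGamma :: "complex ^ 'n ^ 'n \<Rightarrow> complex ^ 'k ^ 'k" where
  "dGamma M = (\<Sum>a\<in>UNIV. \<Sum>b\<in>UNIV. M $ a $ b *\<^sub>M (cadj (Z (axis a 1)) ** Z (axis b 1)))"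

lemma dGamma_add: "dGamma (A + B) = dGamma A + dGamma B"
  by (simp add: dGamma_def cscale_add_left sum.distrib)

lemma dGamma_cscale: "dGamma (c *\<^sub>M A) = c *\<^sub>M dGamma A"
  by (simp add: dGamma_def cscale_sum) (simp add: cscale_def)

lemma dGamma_scaleR: "dGamma (r *\<^sub>R A) = r *\<^sub>R dGamma A"
  by (simp add: cscale_scaleR dGamma_cscale)

lemma dGamma_0: "dGamma 0 = 0"
  by (simp add: dGamma_def)

lemma dGamma_sum: "dGamma (\<Sum>i\<in>I. f i) = (\<Sum>i\<in>I. dGamma (f i))"
  by (induction I rule: infinite_finite_induct) (auto simp: dGamma_add dGamma_0)

lemma dGamma_ketbra: "dGamma (ketbra \<psi> \<phi>) = cadj (Z \<psi>) ** Z \<phi>"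
proof -
  have "cadj (Z \<psi>) ** Z \<phi>
      = (\<Sum>a\<in>UNIV. \<psi> $ a *\<^sub>M cadj (Z (axis a 1))) ** (\<Sum>b\<in>UNIV. cnj (\<phi> $ b) *\<^sub>M Z (axis b 1))"
    by (metis Z_axis_expansion Zstar_axis_expansion)
  also have "\<dots> = dGamma (ketbra \<psi> \<phi>)"
    unfolding mult_sum_left unfolding mult_sum_right
    by (simp add: dGamma_def ketbra_def cscale_mult_left cscale_mult_right mult.commute)
  finally show ?thesis by simp
qed

lemma cadj_dGamma: "cadj (dGamma M) = dGamma (cadj M)"
proof -
  have "cadj (dGamma M) = (\<Sum>a\<in>UNIV. \<Sum>b\<in>UNIV. cnj (M $ a $ b) *\<^sub>M (cadj (Z (axis b 1)) ** Z (axis a 1)))"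
    by (simp add: dGamma_def cadj_simps)
  also have "\<dots> = dGamma (cadj M)"
    unfolding dGamma_def by (subst sum.swap) (simp add: cadj_def)
  finally show ?thesis .
qed

lemma munit_ketbra: "munit a b = ketbra (axis a 1) (axis b 1)"
  by (auto simp: munit_def ketbra_def axis_def vec_eq_iff)

text \<open>For rank-one \<open>M\<close> a single use of the anticommutation relations suffices,
  because the two creators only exchange a sign; both sides are linear in \<open>M\<close>.\<close>

lemma dGamma_commutator: "dGamma M ** cadj (Z \<xi>) - cadj (Z \<xi>) ** dGamma M = cadj (Z (M *v \<xi>))"
proof -
  have 1: "dGamma (ketbra \<psi> \<phi>) ** cadj (Z \<xi>) - cadj (Z \<xi>) ** dGamma (ketbra \<psi> \<phi>) = cinner \<phi> \<xi> *\<^sub>M cadj (Z \<psi>)" for \<psi> \<phi>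
  proof -
    have "cadj (Z \<xi>) ** cadj (Z \<psi>) = - (cadj (Z \<psi>) ** cadj (Z \<xi>))"
      using anti_Zstar[of \<xi> \<psi>] by (simp add: eq_neg_iff_add_eq_0)
    then have "cadj (Z \<xi>) ** dGamma (ketbra \<psi> \<phi>) = - (cadj (Z \<psi>) ** (cadj (Z \<xi>) ** Z \<phi>))"
      by (simp add: dGamma_ketbra matrix_mul_assoc mult_minus_left)
    then have "dGamma (ketbra \<psi> \<phi>) ** cadj (Z \<xi>) - cadj (Z \<xi>) ** dGamma (ketbra \<psi> \<phi>)
        = cadj (Z \<psi>) ** (Z \<phi> ** cadj (Z \<xi>) + cadj (Z \<xi>) ** Z \<phi>)"
      by (simp add: dGamma_ketbra matrix_add_ldistrib matrix_mul_assoc)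
    then show ?thesis by (simp add: anti_star cscale_mult_right)
  qed
  have "dGamma M = (\<Sum>a\<in>UNIV. \<Sum>b\<in>UNIV. M $ a $ b *\<^sub>M dGamma (ketbra (axis a 1) (axis b 1)))"
    by (simp add: dGamma_ketbra) (simp add: dGamma_def)
  then have "dGamma M ** cadj (Z \<xi>) - cadj (Z \<xi>) ** dGamma M
      = (\<Sum>a\<in>UNIV. \<Sum>b\<in>UNIV. M $ a $ b *\<^sub>M (dGamma (ketbra (axis a 1) (axis b 1)) ** cadj (Z \<xi>)
          - cadj (Z \<xi>) ** dGamma (ketbra (axis a 1) (axis b 1))))"
    by (simp add: mat_simps sum_subtractf cscale_diff)
  also have "\<dots> = (\<Sum>a\<in>UNIV. (M *v \<xi>) $ a *\<^sub>M cadj (Z (axis a 1)))"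
    by (simp add: 1 cinner_axis matrix_vector_mult_def cscale_sum_left)
  finally show ?thesis by (subst (asm) Zstar_axis_expansion[symmetric])
qed

lemma number_op_dGamma: "number_op Z = dGamma (mat 1)"
proof -
  have "dGamma (mat 1) = (\<Sum>a\<in>UNIV. \<Sum>b\<in>UNIV. if b = a then cadj (Z (axis a 1)) ** Z (axis b 1) else 0)"
    unfolding dGamma_def by (intro sum.cong refl) (auto simp: mat_def)
  then show ?thesis by (simp add: number_op_def)
qed

lemma second_quant_dGamma:
  assumes "selfadj K"
  shows "second_quant Z K = dGamma K"
proof -
  have *: "(\<Sum>j<CARD('n). \<kappa> j *\<^sub>R (cadj (Z (\<psi> j)) ** Z (\<psi> j))) = dGamma K" if "spectral_decomp K \<psi> \<kappa>" for \<psi> \<kappa>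
    using that by (simp add: spectral_decomp_def dGamma_sum dGamma_scaleR dGamma_ketbra)
  obtain \<psi> \<kappa> where sd: "spectral_decomp K \<psi> \<kappa>"
    using ex_spectral_decomp[OF assms] by blast
  show ?thesis
    unfolding second_quant_def
  proof (rule the_equality)
    show "\<exists>\<psi> \<kappa>. spectral_decomp K \<psi> \<kappa> \<and> dGamma K = (\<Sum>j<CARD('n). \<kappa> j *\<^sub>R (cadj (Z (\<psi> j)) ** Z (\<psi> j)))"
      using sd *[OF sd] by (intro exI[of _ \<psi>] exI[of _ \<kappa>]) simp
  qed (auto simp: *)
qed

lemma mexp_dGamma_ladder:
  assumes "M *v \<xi> = c *s \<xi>"
  shows "mexp (dGamma M) ** cadj (Z \<xi>) = exp c *\<^sub>M (cadj (Z \<xi>) ** mexp (dGamma M))"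
  using assms by (intro mexp_ladder) (simp add: dGamma_commutator Z_smult cadj_cscale)

end

lemma mprod_commute:
  assumes "\<And>j. j < m \<Longrightarrow> B ** f j = f j ** B"
  shows "B ** mprod f m = mprod f m ** B"
  using assms
proof (induction m)
  case (Suc m)
  then have IH: "B ** mprod f m = mprod f m ** B" by auto
  have "B ** mprod f (Suc m) = (mprod f m ** B) ** f m"
    by (simp add: matrix_mul_assoc IH)
  also have "\<dots> = mprod f (Suc m) ** B"
    using Suc.prems[of m] by (simp add: matrix_mul_assoc[symmetric])
  finally show ?case .
qed simp

text \<open>Two weights instead of a quotient, so that eigenvalues 0 and 1 of a symbol cause no
  division. The weights 1 and 0 give the annihilation statements for the vacuum projection.\<close>

lemma mprod_intertwine:
  assumes "k < m" "a *\<^sub>M (B ** f k) = b *\<^sub>M (f k ** B)"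
    and "\<And>j. j < m \<Longrightarrow> j \<noteq> k \<Longrightarrow> B ** f j = f j ** B"
  shows "a *\<^sub>M (B ** mprod f m) = b *\<^sub>M (mprod f m ** B)"
  using assms(1,3)
proof (induction m)
  case (Suc m)
  show ?case
  proof (cases "k = m")
    case True
    have comm: "B ** mprod f m = mprod f m ** B"
      using Suc.prems True by (intro mprod_commute) auto
    have "a *\<^sub>M (B ** mprod f (Suc m)) = mprod f m ** (a *\<^sub>M (B ** f m))"
      by (simp add: matrix_mul_assoc comm cscale_mult_right)
    also have "\<dots> = b *\<^sub>M (mprod f (Suc m) ** B)"
      using assms(2) True by (simp add: matrix_mul_assoc cscale_mult_right)
    finally show ?thesis .
  next
    case False
    then have IH: "a *\<^sub>M (B ** mprod f m) = b *\<^sub>M (mprod f m ** B)"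
      using Suc by auto
    have "a *\<^sub>M (B ** mprod f (Suc m)) = (a *\<^sub>M (B ** mprod f m)) ** f m"
      by (simp add: matrix_mul_assoc cscale_mult_left)
    also have "\<dots> = b *\<^sub>M (mprod f m ** (B ** f m))"
      by (simp add: IH cscale_mult_left matrix_mul_assoc)
    also have "\<dots> = b *\<^sub>M (mprod f (Suc m) ** B)"
      using Suc.prems(2)[of m] False by (simp add: matrix_mul_assoc)
    finally show ?thesis .
  qed
qed simp

context car
begin

text \<open>Moving past the two letters of an orthogonal mode changes the sign twice.\<close>

lemma pair_commute:
  assumes "cinner \<psi> \<phi> = 0"
  shows "Z \<psi> ** (Z \<phi> ** cadj (Z \<phi>)) = (Z \<phi> ** cadj (Z \<phi>)) ** Z \<psi>" (is ?A)
    and "Z \<psi> ** (cadj (Z \<phi>) ** Z \<phi>) = (cadj (Z \<phi>) ** Z \<phi>) ** Z \<psi>" (is ?B)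
proof -
  have 1: "Z \<psi> ** Z \<phi> = - (Z \<phi> ** Z \<psi>)"
    using anti_Z[of \<psi> \<phi>] by (simp add: eq_neg_iff_add_eq_0)
  have 2: "Z \<psi> ** cadj (Z \<phi>) = - (cadj (Z \<phi>) ** Z \<psi>)"
    using anti_star[of \<psi> \<phi>] assms by (simp add: eq_neg_iff_add_eq_0)
  have "Z \<psi> ** (Z \<phi> ** cadj (Z \<phi>)) = - (Z \<phi> ** (Z \<psi> ** cadj (Z \<phi>)))"
    by (simp add: matrix_mul_assoc 1 mult_minus_left)
  then show ?A by (simp add: 2 mult_minus_right matrix_mul_assoc)
  have "Z \<psi> ** (cadj (Z \<phi>) ** Z \<phi>) = - (cadj (Z \<phi>) ** (Z \<psi> ** Z \<phi>))"
    by (simp add: matrix_mul_assoc 2 mult_minus_left)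
  then show ?B by (simp add: 1 mult_minus_right matrix_mul_assoc)
qed

lemma pair_commute_star:
  assumes "cinner \<psi> \<phi> = 0"
  shows "cadj (Z \<psi>) ** (Z \<phi> ** cadj (Z \<phi>)) = (Z \<phi> ** cadj (Z \<phi>)) ** cadj (Z \<psi>)"
    and "cadj (Z \<psi>) ** (cadj (Z \<phi>) ** Z \<phi>) = (cadj (Z \<phi>) ** Z \<phi>) ** cadj (Z \<psi>)"
  using pair_commute[OF assms, THEN arg_cong[where f = cadj]]
  by (simp_all add: cadj_mult matrix_mul_assoc)

end

section \<open>The vacuum and the generated algebra\<close>

context car
begin

text \<open>Built mode by mode: if the next annihilator does not kill \<open>x\<close>, replace
  \<open>x\<close> by its image. The image is killed by that annihilator, whose square is 0, and
  still by the earlier ones, by anticommutation.\<close>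

lemma ex_vacuum: "\<exists>\<Omega>. norm \<Omega> = 1 \<and> (\<forall>\<phi>. Z \<phi> *v \<Omega> = 0)"
proof -
  obtain h :: "nat \<Rightarrow> 'n" where h: "bij_betw h {..<CARD('n)} UNIV"
    using ex_enumeration by blast
  have "\<exists>x. x \<noteq> 0 \<and> (\<forall>i<m. Z (axis (h i) 1) *v x = 0)" for m
  proof (induction m)
    case 0
    show ?case by (auto intro!: exI[of _ "axis undefined 1"] simp: axis_eq_0_iff)
  next
    case (Suc m)
    then obtain x where x: "x \<noteq> 0" "\<And>i. i < m \<Longrightarrow> Z (axis (h i) 1) *v x = 0" by blast
    let ?a = "Z (axis (h m) 1)"
    show ?case
    proof (cases "?a *v x = 0")
      case True
      then show ?thesis using x by (auto simp: less_Suc_eq)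
    next
      case False
      have "Z (axis (h i) 1) *v (?a *v x) = 0" if "i < m" for i
      proof -
        have "Z (axis (h i) 1) ** ?a = - (?a ** Z (axis (h i) 1))"
          using anti_Z by (simp add: eq_neg_iff_add_eq_0)
        then show ?thesis
          using x(2)[OF that] by (metis matrix_vector_mul_assoc mv_minus matrix_vector_mult_0_right neg_equal_zero add.inverse_neutral)
      qed
      moreover have "?a *v (?a *v x) = 0"
        by (simp add: matrix_vector_mul_assoc Z_square)
      ultimately show ?thesis using False by (auto simp: less_Suc_eq)
    qed
  qed
  from this[of "CARD('n)"] obtain x where x: "x \<noteq> 0" "\<And>i. i < CARD('n) \<Longrightarrow> Z (axis (h i) 1) *v x = 0"
    by blast
  have "Z (axis i 1) *v x = 0" for i
    using h x(2) by (metis UNIV_I bij_betw_imp_surj_on imageE lessThan_iff)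
  then have "Z \<phi> *v (x /\<^sub>R norm x) = 0" for \<phi>
    by (subst Z_axis_expansion) (simp add: mv_sum mv_cscale mv_scaleR_right)
  then show ?thesis using x(1) by (intro exI[of _ "x /\<^sub>R norm x"]) simp
qed

text \<open>\<open>P\<close> is the product over the standard modes of the projections onto the
  unoccupied state. That it has rank one is derived later, from irreducibility.\<close>

lemma ex_vacuum_projection:
  assumes \<Omega>: "\<And>\<phi>. Z \<phi> *v \<Omega> = 0"
  shows "\<exists>P \<in> star_alg (range Z). P *v \<Omega> = \<Omega> \<and> cadj P *v \<Omega> = \<Omega>
    \<and> (\<forall>\<phi>. Z \<phi> ** P = 0 \<and> P ** cadj (Z \<phi>) = 0)"
proof -
  obtain h :: "nat \<Rightarrow> 'n" where h: "bij_betw h {..<CARD('n)} UNIV"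
    using ex_enumeration by blast
  define f where "f j = Z (axis (h j) 1) ** cadj (Z (axis (h j) 1))" for j
  have f\<Omega>: "f j *v \<Omega> = \<Omega>" for j
  proof -
    have "f j = mat 1 - cadj (Z (axis (h j) 1)) ** Z (axis (h j) 1)"
      using anti_star[of "axis (h j) 1" "axis (h j) 1"] by (simp add: f_def eq_diff_eq cinner_axis)
    then show ?thesis
      by (simp add: matrix_vector_mult_diff_rdistrib \<Omega> flip: matrix_vector_mul_assoc)
  qed
  have inj: "cinner (axis (h j) 1) (axis (h k) 1 :: complex ^ 'n) = 0"
    if "j < CARD('n)" "k < CARD('n)" "k \<noteq> j" for j k
  proof -
    have "h k \<noteq> h j" using h that by (auto simp: bij_betw_def inj_on_def)
    then show ?thesis by (simp only: cinner_axis) (simp add: axis_def)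
  qed
  have left: "Z (axis (h j) 1) ** mprod f CARD('n) = 0" if j: "j < CARD('n)" for j
  proof -
    have "1 *\<^sub>M (Z (axis (h j) 1) ** mprod f CARD('n)) = 0 *\<^sub>M (mprod f CARD('n) ** Z (axis (h j) 1))"
    proof (rule mprod_intertwine[OF j])
      show "1 *\<^sub>M (Z (axis (h j) 1) ** f j) = 0 *\<^sub>M (f j ** Z (axis (h j) 1))"
        by (simp add: f_def matrix_mul_assoc Z_square)
      show "Z (axis (h j) 1) ** f k = f k ** Z (axis (h j) 1)" if "k < CARD('n)" "k \<noteq> j" for k
        unfolding f_def by (rule pair_commute[OF inj[OF j that]])
    qed
    then show ?thesis by simp
  qed
  have right: "mprod f CARD('n) ** cadj (Z (axis (h j) 1)) = 0" if j: "j < CARD('n)" for j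
  proof -
    have "0 *\<^sub>M (cadj (Z (axis (h j) 1)) ** mprod f CARD('n)) = 1 *\<^sub>M (mprod f CARD('n) ** cadj (Z (axis (h j) 1)))"
    proof (rule mprod_intertwine[OF j])
      show "0 *\<^sub>M (cadj (Z (axis (h j) 1)) ** f j) = 1 *\<^sub>M (f j ** cadj (Z (axis (h j) 1)))"
        by (simp add: f_def Zstar_square flip: matrix_mul_assoc)
      show "cadj (Z (axis (h j) 1)) ** f k = f k ** cadj (Z (axis (h j) 1))" if "k < CARD('n)" "k \<noteq> j" for k
        unfolding f_def by (rule pair_commute_star[OF inj[OF j that]])
    qed
    then show ?thesis by simp
  qed
  have h_surj: "\<exists>j<CARD('n). i = h j" for i
    using h by (metis UNIV_I bij_betw_imp_surj_on imageE lessThan_iff)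
  have "Z (axis i 1) ** mprod f CARD('n) = 0" "mprod f CARD('n) ** cadj (Z (axis i 1)) = 0" for i
    using h_surj[of i] left right by auto
  then have "Z \<phi> ** mprod f CARD('n) = 0" "mprod f CARD('n) ** cadj (Z \<phi>) = 0" for \<phi>
    by (subst Z_axis_expansion, simp add: mat_simps, subst Zstar_axis_expansion, simp add: mat_simps)
  moreover have "mprod f m *v \<Omega> = \<Omega>" "cadj (mprod f m) *v \<Omega> = \<Omega>" for m
  proof (induction m)
    case (Suc m)
    have "cadj (f m) = f m" by (simp add: f_def cadj_mult)
    then show "mprod f (Suc m) *v \<Omega> = \<Omega>" "cadj (mprod f (Suc m)) *v \<Omega> = \<Omega>"
      using Suc by (simp_all add: cadj_mult f\<Omega> flip: matrix_vector_mul_assoc)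
  qed simp_all
  moreover have "mprod f m \<in> star_alg (range Z)" for m
    by (induction m) (simp_all add: f_def mat1_in_star_alg star_alg.mult Z_in_star_alg)
  ultimately show ?thesis by blast
qed

text \<open>Normal ordering: moving annihilators to the right leaves only multiples of \<open>P\<close>.\<close>

lemma word_between_vacuum:
  assumes "\<And>\<phi>. Z \<phi> ** P = 0" "\<And>\<phi>. P ** cadj (Z \<phi>) = 0"
  shows "\<exists>c. P ** word_op Z w ** P = c *\<^sub>M (P ** P)"
proof (induction w rule: length_induct)
  case (1 w)
  show ?case
  proof (cases w)
    case Nil
    then show ?thesis by (intro exI[of _ 1]) simp
  next
    case (Cons x v)
    show ?thesis
    proof (cases "fst x")
      case True
      then have "P ** ladder Z x = 0" using assms by (simp add: ladder_def)
      then show ?thesis using Cons by (intro exI[of _ 0]) (simp add: matrix_mul_assoc)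
    next
      case False
      then have x: "ladder Z x ** P = 0" using assms by (simp add: ladder_def)
      have "\<forall>i. \<exists>c. i < length v \<longrightarrow> P ** word_op Z (take i v @ drop (Suc i) v) ** P = c *\<^sub>M (P ** P)"
        using 1 Cons by auto
      then obtain c where c: "\<And>i. i < length v \<Longrightarrow> P ** word_op Z (take i v @ drop (Suc i) v) ** P = c i *\<^sub>M (P ** P)"
        by metis
      have "P ** word_op Z w ** P = P ** (ladder Z x ** word_op Z v) ** P"
        using Cons by simp
      also have "\<dots> = (-1) ^ length v *\<^sub>M (P ** (word_op Z v ** (ladder Z x ** P)))
          + (\<Sum>i<length v. ((-1) ^ i * acomm x (v ! i)) *\<^sub>M (P ** word_op Z (take i v @ drop (Suc i) v) ** P))"
        by (subst ladder_word_anti) (simp add: mat_simps matrix_mul_assoc)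
      also have "\<dots> = (\<Sum>i<length v. ((-1) ^ i * acomm x (v ! i) * c i)) *\<^sub>M (P ** P)"
        by (simp add: x c cscale_sum_left)
      finally show ?thesis by blast
    qed
  qed
qed

end

locale car_irr = car Z for Z :: "complex ^ 'n \<Rightarrow> complex ^ 'k ^ 'k" +
  assumes irr: "CAR_irreducible Z"
begin

text \<open>The orbit of a nonzero vector under the algebra is an invariant subspace containing that
  vector, so irreducibility makes it everything.\<close>

lemma cyclic:
  assumes "\<Omega> \<noteq> 0"
  shows "\<exists>X \<in> star_alg (range Z). x = X *v \<Omega>"
proof -
  define V where "V = (\<lambda>X. X *v \<Omega>) ` star_alg (range Z)"
  have "vec.subspace V"
    unfolding vec.subspace_def
  proof (intro conjI ballI allI)
    show "0 \<in> V"
      unfolding V_def using star_alg.scale[OF mat1_in_star_alg, of 0] by (intro image_eqI[of _ _ 0]) auto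
    show "x + y \<in> V" if "x \<in> V" "y \<in> V" for x y
    proof -
      obtain X Y where "X \<in> star_alg (range Z)" "x = X *v \<Omega>" "Y \<in> star_alg (range Z)" "y = Y *v \<Omega>"
        using \<open>x \<in> V\<close> \<open>y \<in> V\<close> by (auto simp: V_def)
      then show ?thesis
        unfolding V_def by (intro image_eqI[of _ _ "X + Y"]) (auto simp: matrix_vector_mult_add_rdistrib intro: star_alg.add)
    qed
    show "c *s x \<in> V" if "x \<in> V" for c x
    proof -
      obtain X where "X \<in> star_alg (range Z)" "x = X *v \<Omega>"
        using \<open>x \<in> V\<close> by (auto simp: V_def)
      then show ?thesis
        unfolding V_def by (intro image_eqI[of _ _ "c *\<^sub>M X"]) (auto simp: mv_cscale intro: star_alg.scale)
    qed
  qed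
  moreover have "Z \<psi> *v x \<in> V \<and> cadj (Z \<psi>) *v x \<in> V" if "x \<in> V" for \<psi> x
    using that unfolding V_def
    by (auto simp: matrix_vector_mul_assoc intro!: imageI star_alg.mult[OF Z_in_star_alg(1)] star_alg.mult[OF Z_in_star_alg(2)])
  ultimately have "V = {0} \<or> V = UNIV"
    using irr unfolding CAR_irreducible_def by blast
  moreover have "\<Omega> \<in> V"
    unfolding V_def using mat1_in_star_alg by (intro image_eqI[of _ _ "mat 1"]) auto
  ultimately have "V = UNIV" using assms by auto
  then have "x \<in> V" by simp
  then show ?thesis by (auto simp: V_def)
qed

text \<open>Compressing an element of the algebra by \<open>P\<close> gives a multiple of
  \<open>P ** P\<close>, and \<open>\<Omega>\<close> is cyclic; together these identify
  \<open>P\<close> with the projection onto \<open>\<Omega>\<close>. Its translates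
  \<open>X ** P ** cadj Y\<close> are then all the rank-one operators.\<close>

theorem star_alg_UNIV: "star_alg (range Z) = UNIV"
proof -
  obtain \<Omega> where \<Omega>: "norm \<Omega> = 1" "\<And>\<phi>. Z \<phi> *v \<Omega> = 0" using ex_vacuum by blast
  have \<Omega>0: "\<Omega> \<noteq> 0" using \<Omega>(1) by auto
  obtain P where P: "P \<in> star_alg (range Z)" "P *v \<Omega> = \<Omega>" "cadj P *v \<Omega> = \<Omega>"
    "\<And>\<phi>. Z \<phi> ** P = 0" "\<And>\<phi>. P ** cadj (Z \<phi>) = 0"
    using ex_vacuum_projection[OF \<Omega>(2)] by blast
  have PXP: "\<exists>c. P ** X ** P = c *\<^sub>M (P ** P)" if "X \<in> word_span Z" for X
    using that
  proof (induction rule: word_span_induct)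
    case (base c w)
    obtain d where "P ** word_op Z w ** P = d *\<^sub>M (P ** P)"
      using word_between_vacuum[OF P(4,5)] by blast
    then show ?case by (intro exI[of _ "c * d"]) (simp add: mat_simps)
  next
    case subspace
    show ?case
      by (auto simp: subspace_def mat_simps scaleR_cscale simp flip: cscale_add_left)
        (metis cscale_0(1))
  qed
  have "P = ketbra \<Omega> \<Omega>"
  proof (rule mat_eqI)
    fix x
    obtain X where X: "X \<in> star_alg (range Z)" "x = X *v \<Omega>" using cyclic[OF \<Omega>0] by blast
    obtain c where c: "P ** X ** P = c *\<^sub>M (P ** P)"
      using PXP X(1) star_alg_subset_word_span by blast
    have "P *v x = (P ** X ** P) *v \<Omega>"
      using X P(2) by (simp flip: matrix_vector_mul_assoc)
    then have Px: "P *v x = c *s \<Omega>"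
      using c P(2) by (simp add: mv_cscale flip: matrix_vector_mul_assoc)
    then have "c = cinner \<Omega> (P *v x)"
      using \<Omega>(1) by (simp add: cinner_smult_right cinner_self)
    also have "\<dots> = cinner \<Omega> x"
      by (simp add: cinner_mv P(3))
    finally show "P *v x = ketbra \<Omega> \<Omega> *v x"
      by (simp add: ketbra_mv Px)
  qed
  have kb: "ketbra x y \<in> star_alg (range Z)" for x y
  proof -
    obtain X Y where X: "X \<in> star_alg (range Z)" "x = X *v \<Omega>" and Y: "Y \<in> star_alg (range Z)" "y = Y *v \<Omega>"
      using cyclic[OF \<Omega>0] by metis
    have "ketbra x y = X ** P ** cadj Y"
      using X Y \<open>P = ketbra \<Omega> \<Omega>\<close> by (simp add: mult_ketbra ketbra_mult)
    then show ?thesis using X Y P(1) by (simp add: star_alg.mult star_alg.star)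
  qed
  have zero: "0 \<in> star_alg (range Z)"
    using star_alg.scale[OF mat1_in_star_alg, of 0] by simp
  have sum: "(\<Sum>i\<in>I. f i) \<in> star_alg (range Z)" if "\<And>i. f i \<in> star_alg (range Z)" for I :: "'b set" and f
    by (induction I rule: infinite_finite_induct) (auto simp: zero that intro: star_alg.add)
  have "X \<in> star_alg (range Z)" for X
    by (subst munit_expansion[of X]) (intro sum star_alg.scale, simp add: munit_ketbra kb)
  then show ?thesis by auto
qed

lemma word_span_UNIV: "word_span Z = UNIV"
  using star_alg_subset_word_span[of Z] star_alg_UNIV by auto

end

text \<open>Evenness is tested against any operator with these properties rather than a fixed one,
  so that \<open>gauss\<close> applies directly to the doubled field, where \<open>kron W W\<close>
  serves.\<close>

definition parity_op :: "(complex ^ 'n \<Rightarrow> complex ^ 'k ^ 'k) \<Rightarrow> complex ^ 'k ^ 'k \<Rightarrow> bool" where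
  "parity_op Z V \<longleftrightarrow> V ** V = mat 1 \<and> cadj V = V \<and> (\<forall>\<phi>. V ** Z \<phi> = - (Z \<phi> ** V))"

lemma parity_ladder:
  assumes "parity_op Z V"
  shows "V ** ladder Z x = - (ladder Z x ** V)"
proof -
  have 1: "V ** Z \<phi> = - (Z \<phi> ** V)" for \<phi> using assms by (simp add: parity_op_def)
  have "cadj (Z \<phi>) ** V = - (V ** cadj (Z \<phi>))" for \<phi>
    using arg_cong[OF 1[of \<phi>], of cadj] assms by (simp add: parity_op_def cadj_simps)
  then show ?thesis using 1 by (auto simp: ladder_def)
qed

lemma parity_word:
  assumes "parity_op Z V"
  shows "V ** word_op Z w = (-1) ^ length w *\<^sub>M (word_op Z w ** V)"
proof (induction w)
  case (Cons x w)
  have "V ** word_op Z (x # w) = - (ladder Z x ** (V ** word_op Z w))"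
    by (simp add: matrix_mul_assoc parity_ladder[OF assms] mult_minus_left)
  then show ?case
    by (simp add: Cons.IH mat_simps matrix_mul_assoc cscale_minus)
qed simp

context car_irr
begin

definition W :: "complex ^ 'k ^ 'k" where
  "W = mexp ((\<i> * complex_of_real pi) *\<^sub>M number_op Z)"

text \<open>Anticommutation comes from \<open>exp (\<i> * pi) = -1\<close>. The square of
  \<open>W\<close> then commutes with all words, hence with all operators, and fixes the cyclic
  vacuum, so it is 1; unitarity makes \<open>W\<close> self-adjoint.\<close>

lemma parity_W: "parity_op Z W"
proof -
  have W: "W = mexp (dGamma ((\<i> * complex_of_real pi) *\<^sub>M mat 1))"
    by (simp add: W_def number_op_dGamma dGamma_cscale)
  have star: "W ** cadj (Z \<xi>) = - (cadj (Z \<xi>) ** W)" for \<xi>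
    using mexp_dGamma_ladder[of "(\<i> * complex_of_real pi) *\<^sub>M mat 1" \<xi> "\<i> * complex_of_real pi"]
    by (simp add: W mv_cscale cscale_minus exp_Euler)
  have "cadj W = mexp (- ((\<i> * complex_of_real pi) *\<^sub>M number_op Z))"
    by (simp add: W_def cadj_mexp cadj_cscale number_op_dGamma cadj_dGamma cscale_minus)
  then have inv: "W ** cadj W = mat 1" "cadj W ** W = mat 1"
    by (simp_all add: W_def mexp_minus_right mexp_minus_left)
  have "Z \<xi> ** cadj W = - (cadj W ** Z \<xi>)" for \<xi>
    using arg_cong[OF star[of \<xi>], of cadj] by (simp add: cadj_simps)
  then have "W ** (Z \<xi> ** cadj W) ** W = - (W ** (cadj W ** Z \<xi>) ** W)" for \<xi>
    by (simp add: mult_minus_left mult_minus_right)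
  then have WZ: "W ** Z \<xi> = - (Z \<xi> ** W)" for \<xi>
    using inv by (simp add: matrix_mul_assoc) (simp add: inv flip: matrix_mul_assoc)
  have lad: "W ** ladder Z x = - (ladder Z x ** W)" for x
    using WZ star by (simp add: ladder_def)
  have WW: "(W ** W) ** word_op Z w = word_op Z w ** (W ** W)" for w
  proof (induction w)
    case (Cons x w)
    have "(W ** W) ** ladder Z x = W ** (W ** ladder Z x)" by (simp add: matrix_mul_assoc)
    also have "\<dots> = - (W ** ladder Z x ** W)" by (simp add: lad mult_minus_right matrix_mul_assoc)
    also have "\<dots> = ladder Z x ** (W ** W)" by (simp add: lad mult_minus_left matrix_mul_assoc)
    finally have "(W ** W) ** word_op Z (x # w) = ladder Z x ** ((W ** W) ** word_op Z w)"
      by (simp add: matrix_mul_assoc)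
    then show ?case by (simp only: Cons word_op_simps matrix_mul_assoc)
  qed simp
  have comm: "(W ** W) ** X = X ** (W ** W)" for X
  proof -
    have "X \<in> word_span Z" by (simp add: word_span_UNIV)
    then show ?thesis
    proof (induction rule: word_span_induct)
      case (base c w)
      then show ?case by (simp add: WW mat_simps)
    next
      case subspace
      show ?case by (auto simp: subspace_def mat_simps)
    qed
  qed
  obtain \<Omega> where \<Omega>: "norm \<Omega> = 1" "\<And>\<phi>. Z \<phi> *v \<Omega> = 0" using ex_vacuum by blast
  then have \<Omega>0: "\<Omega> \<noteq> 0" by auto
  have "((\<i> * complex_of_real pi) *\<^sub>M number_op Z) *v \<Omega> = 0 *s \<Omega>"
    by (simp add: number_op_def mv_cscale mv_sum \<Omega> flip: matrix_vector_mul_assoc)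
  from mexp_eigen[OF this] have W\<Omega>: "W *v \<Omega> = \<Omega>" by (simp add: W_def)
  have "W ** W = mat 1"
  proof (rule mat_eqI)
    fix x :: "complex ^ 'k"
    obtain X where X: "x = X *v \<Omega>" using cyclic[OF \<Omega>0, of x] by blast
    have "(W ** W) *v x = (X ** (W ** W)) *v \<Omega>"
      unfolding comm[of X, symmetric] by (simp add: X matrix_vector_mul_assoc)
    then show "(W ** W) *v x = mat 1 *v x"
      by (simp add: X W\<Omega> flip: matrix_vector_mul_assoc)
  qed
  moreover then have "cadj W = W"
    using inv by (metis matrix_mul_assoc matrix_mul_lid matrix_mul_rid)
  ultimately show ?thesis by (simp add: parity_op_def WZ)
qed

end

section \<open>Gaussian density matrices and Wick's theorem\<close>

text \<open>The one-mode relations \<open>(1 - \<mu>) \<rho> Z\<^sup>*(\<psi>) = \<mu> Z\<^sup>*(\<psi>) \<rho>\<close> and \<open>\<mu> \<rho> Z(\<psi>) = (1 - \<mu>) Z(\<psi>) \<rho>\<close> of a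
  Gaussian density matrix are linear in the symbol; in this form they make sense for every
  symbol and determine all moments recursively (Wick's theorem).\<close>

definition twist :: "complex ^ 'n ^ 'n \<Rightarrow> bool \<times> (complex ^ 'n) \<Rightarrow> bool \<times> (complex ^ 'n)" where
  "twist Q x = (fst x, if fst x then Q *v snd x else snd x - Q *v snd x)"

definition gauss :: "(complex ^ 'n \<Rightarrow> complex ^ 'k ^ 'k) \<Rightarrow> complex ^ 'n ^ 'n \<Rightarrow> complex ^ 'k ^ 'k \<Rightarrow> bool" where
  "gauss Z Q \<rho> \<longleftrightarrow>
     (\<forall>x. \<rho> ** ladder Z x = \<rho> ** ladder Z (twist Q x) + ladder Z (twist Q x) ** \<rho>) \<and>
     ntrace \<rho> = 1 \<and> (\<exists>V. parity_op Z V \<and> V ** \<rho> = \<rho> ** V)"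

text \<open>The Pfaffian of the two-point function \<open>acomm (twist Q x) y\<close>, expanded
  along its first row. It is defined for every matrix \<open>Q\<close>, as a polynomial in the
  entries and their conjugates.\<close>

function wick :: "complex ^ 'n ^ 'n \<Rightarrow> (bool \<times> (complex ^ 'n)) list \<Rightarrow> complex" where
  "wick Q [] = 1"
| "wick Q (x # w) = (\<Sum>i<length w. (-1) ^ i * acomm (twist Q x) (w ! i) * wick Q (take i w @ drop (Suc i) w))"
  by pat_completeness auto
termination
  by (relation "Wellfounded.measure (\<lambda>(Q, w). length w)") auto

lemma wick_odd: "odd (length w) \<Longrightarrow> wick Q w = 0"
proof (induction w rule: length_induct)
  case (1 w)
  then obtain x v where w: "w = x # v" by (cases w) auto
  have "wick Q (take i v @ drop (Suc i) v) = 0" if "i < length v" for i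
    using 1 w that by (auto simp: min_def)
  then show ?case by (simp add: w)
qed

text \<open>Insert the relation for the first letter; cyclicity of the trace turns the result into
  an anticommutator with a word of odd length, which \<open>ladder_word_anti\<close> reduces to
  contractions. Odd words have trace 0 by conjugation with the parity operator.\<close>

lemma (in car) gauss_wick:
  assumes "gauss Z Q \<rho>"
  shows "ntrace (\<rho> ** word_op Z w) = wick Q w"
proof (induction w rule: length_induct)
  case (1 w)
  obtain V where V: "parity_op Z V" "V ** \<rho> = \<rho> ** V"
    using assms by (auto simp: gauss_def)
  show ?case
  proof (cases "even (length w)")
    case False
    have "ntrace (\<rho> ** word_op Z w) = ntrace (\<rho> ** word_op Z w ** V ** V)"
      using V by (simp add: parity_op_def flip: matrix_mul_assoc)
    also have "\<dots> = ntrace (V ** (\<rho> ** word_op Z w ** V))"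
      by (rule ntrace_commute)
    also have "\<dots> = ntrace (\<rho> ** (V ** word_op Z w) ** V)"
      by (simp add: matrix_mul_assoc V(2))
    also have "\<dots> = - ntrace (\<rho> ** word_op Z w ** (V ** V))"
      using False by (simp add: parity_word[OF V(1)] cscale_minus mat_simps matrix_mul_assoc ntrace_minus)
    also have "\<dots> = - ntrace (\<rho> ** word_op Z w)"
      using V by (simp add: parity_op_def)
    finally show ?thesis using False by (simp add: wick_odd)
  next
    case True
    show ?thesis
    proof (cases w)
      case Nil
      then show ?thesis using assms by (simp add: gauss_def)
    next
      case (Cons x v)
      let ?y = "ladder Z (twist Q x)"
      have odd: "odd (length v)" using True Cons by simp
      have "\<rho> ** word_op Z w = \<rho> ** (?y ** word_op Z v) + ?y ** (\<rho> ** word_op Z v)"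
      proof -
        have "\<rho> ** ladder Z x = \<rho> ** ?y + ?y ** \<rho>"
          using assms unfolding gauss_def by blast
        from arg_cong[OF this, of "\<lambda>A. A ** word_op Z v"] show ?thesis
          using Cons by (simp add: matrix_mul_assoc matrix_add_rdistrib)
      qed
      moreover have "ntrace (?y ** (\<rho> ** word_op Z v)) = ntrace (\<rho> ** (word_op Z v ** ?y))"
        by (metis ntrace_commute matrix_mul_assoc)
      ultimately have "ntrace (\<rho> ** word_op Z w) = ntrace (\<rho> ** (?y ** word_op Z v + word_op Z v ** ?y))"
        by (simp add: ntrace_add matrix_add_ldistrib)
      also have "?y ** word_op Z v + word_op Z v ** ?y
          = (\<Sum>i<length v. ((-1) ^ i * acomm (twist Q x) (v ! i)) *\<^sub>M word_op Z (take i v @ drop (Suc i) v))"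
        using odd by (subst ladder_word_anti) (simp add: cscale_minus)
      also have "ntrace (\<rho> ** \<dots>) = wick Q w"
        using 1 Cons by (auto simp: mat_simps ntrace_simps intro!: sum.cong)
      finally show ?thesis .
    qed
  qed
qed

text \<open>Words span all operators and the trace form is definite, so the moments determine the
  operator.\<close>

lemma (in car_irr) ntrace_words_eqI:
  assumes "\<And>w. ntrace (A ** word_op Z w) = ntrace (B ** word_op Z w)"
  shows "A = B"
proof -
  have "ntrace (A ** X) = ntrace (B ** X)" for X
  proof -
    have "X \<in> word_span Z" by (simp add: word_span_UNIV)
    then show ?thesis
    proof (induction rule: word_span_induct)
      case (base c w)
      then show ?case by (simp add: assms mat_simps ntrace_simps)
    next
      case subspace
      show ?case by (auto simp: subspace_def mat_simps ntrace_simps)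
    qed
  qed
  then have "ntrace (cadj (A - B) ** (A - B)) = 0"
    by (simp add: ntrace_commute[of "cadj (A - B)"] mult_diff_left ntrace_diff)
  then show ?thesis using ntrace_adj_self by fastforce
qed

lemma (in car_irr) gauss_unique: "gauss Z Q \<rho> \<Longrightarrow> gauss Z Q \<rho>' \<Longrightarrow> \<rho> = \<rho>'"
  by (rule ntrace_words_eqI) (simp add: gauss_wick)

lemma antilinear_eq_on_basis:
  fixes f g :: "complex ^ 'n \<Rightarrow> complex ^ 'k ^ 'k"
  assumes "orthonormal \<psi> CARD('n)" "\<And>j. j < CARD('n) \<Longrightarrow> f (\<psi> j) = g (\<psi> j)"
    and "\<And>x y. f (x + y) = f x + f y" "\<And>c x. f (c *s x) = cnj c *\<^sub>M f x"
    and "\<And>x y. g (x + y) = g x + g y" "\<And>c x. g (c *s x) = cnj c *\<^sub>M g x"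
  shows "f x = g x"
proof -
  have x: "x = (\<Sum>j<CARD('n). cinner (\<psi> j) x *s \<psi> j)"
    using arg_cong[OF orthonormal_completeness[OF assms(1)], of "\<lambda>M. M *v x"]
    by (simp add: mv_sum ketbra_mv)
  have "f 0 = 0" "g 0 = 0" using assms(4)[of 0 0] assms(6)[of 0 0] by simp_all
  then have "f (\<Sum>j\<in>I. c j *s \<psi> j) = (\<Sum>j\<in>I. cnj (c j) *\<^sub>M f (\<psi> j))"
    "g (\<Sum>j\<in>I. c j *s \<psi> j) = (\<Sum>j\<in>I. cnj (c j) *\<^sub>M g (\<psi> j))" for I c
    by (induction I rule: infinite_finite_induct) (simp_all add: assms(3-6))
  then show ?thesis by (subst (1 2) x) (simp add: assms(2))
qed

context car_irr
begin

definition mode :: "(nat \<Rightarrow> complex ^ 'n) \<Rightarrow> (nat \<Rightarrow> real) \<Rightarrow> nat \<Rightarrow> complex ^ 'k ^ 'k" where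
  "mode \<psi> \<mu> j = ((1 - \<mu> j) * 2) *\<^sub>R (Z (\<psi> j) ** cadj (Z (\<psi> j))) + (\<mu> j * 2) *\<^sub>R (cadj (Z (\<psi> j)) ** Z (\<psi> j))"

lemma cadj_mode: "cadj (mode \<psi> \<mu> j) = mode \<psi> \<mu> j"
  by (simp add: mode_def cadj_simps)

lemma mode_commute:
  assumes "cinner \<phi> (\<psi> j) = 0"
  shows "Z \<phi> ** mode \<psi> \<mu> j = mode \<psi> \<mu> j ** Z \<phi>"
  using pair_commute[OF assms] by (simp add: mode_def mat_simps)

lemma mode_commute_star:
  assumes "cinner \<phi> (\<psi> j) = 0"
  shows "cadj (Z \<phi>) ** mode \<psi> \<mu> j = mode \<psi> \<mu> j ** cadj (Z \<phi>)"
  using arg_cong[OF mode_commute[of \<phi> \<psi> j \<mu>, OF assms], of cadj] by (simp add: cadj_mult cadj_mode)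

lemma mode_commute_mode:
  assumes "cinner (\<psi> i) (\<psi> j) = 0"
  shows "mode \<psi> \<mu> i ** mode \<psi> \<mu> j = mode \<psi> \<mu> j ** mode \<psi> \<mu> i"
proof -
  note 1 = mode_commute[of "\<psi> i" \<psi> j \<mu>, OF assms] and 2 = mode_commute_star[of "\<psi> i" \<psi> j \<mu>, OF assms]
  have "(Z (\<psi> i) ** cadj (Z (\<psi> i))) ** mode \<psi> \<mu> j = mode \<psi> \<mu> j ** (Z (\<psi> i) ** cadj (Z (\<psi> i)))"
    by (metis 1 2 matrix_mul_assoc)
  moreover have "(cadj (Z (\<psi> i)) ** Z (\<psi> i)) ** mode \<psi> \<mu> j = mode \<psi> \<mu> j ** (cadj (Z (\<psi> i)) ** Z (\<psi> i))"
    by (metis 1 2 matrix_mul_assoc)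
  ultimately show ?thesis
    by (subst (1 4) mode_def) (simp add: mat_simps)
qed

text \<open>Each factor commutes with the ladder operators of the other modes, so the relations hold
  on the eigenbasis by a one-mode computation; conjugate linearity extends them to all
  vectors.\<close>

lemma gauss_mprod:
  assumes sd: "spectral_decomp Q \<psi> \<mu>"
  shows "gauss Z Q (mprod (mode \<psi> \<mu>) CARD('n))" (is "gauss Z Q ?\<rho>")
proof -
  let ?f = "mode \<psi> \<mu>"
  have \<psi>: "orthonormal \<psi> CARD('n)" and Q: "Q = diag_op \<psi> \<mu>"
    using sd by (simp_all add: spectral_decomp_iff)
  have orth: "cinner (\<psi> i) (\<psi> j) = 0" if "i < CARD('n)" "j < CARD('n)" "i \<noteq> j" for i j
    using \<psi> that by (simp add: orthonormal_def)
  have sa: "cadj (mprod ?f m) = mprod ?f m" if "m \<le> CARD('n)" for m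
    using that
  proof (induction m)
    case (Suc m)
    have "?f m ** mprod ?f m = mprod ?f m ** ?f m"
      using Suc.prems by (intro mprod_commute mode_commute_mode orth) auto
    then show ?case using Suc by (simp add: cadj_mult cadj_mode)
  qed simp
  have rel: "complex_of_real (1 - \<mu> j) *\<^sub>M (Z (\<psi> j) ** ?\<rho>) = complex_of_real (\<mu> j) *\<^sub>M (?\<rho> ** Z (\<psi> j))"
    if j: "j < CARD('n)" for j
  proof (rule mprod_intertwine[OF j])
    have "Z (\<psi> j) ** (cadj (Z (\<psi> j)) ** Z (\<psi> j)) = Z (\<psi> j) ** cadj (Z (\<psi> j)) ** Z (\<psi> j)"
      by (simp add: matrix_mul_assoc)
    then have "Z (\<psi> j) ** ?f j = (2 * \<mu> j) *\<^sub>R (Z (\<psi> j) ** cadj (Z (\<psi> j)) ** Z (\<psi> j))"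
      by (simp add: mode_def mat_simps matrix_mul_assoc Z_square mult.commute)
    moreover have "?f j ** Z (\<psi> j) = (2 * (1 - \<mu> j)) *\<^sub>R (Z (\<psi> j) ** cadj (Z (\<psi> j)) ** Z (\<psi> j))"
      by (simp add: mode_def mat_simps Z_square mult.commute flip: matrix_mul_assoc)
    ultimately show "complex_of_real (1 - \<mu> j) *\<^sub>M (Z (\<psi> j) ** ?f j) = complex_of_real (\<mu> j) *\<^sub>M (?f j ** Z (\<psi> j))"
      by (simp add: cscale_scaleR algebra_simps)
    show "Z (\<psi> j) ** ?f i = ?f i ** Z (\<psi> j)" if "i < CARD('n)" "i \<noteq> j" for i
      using that j by (intro mode_commute orth) auto
  qed
  have Q\<psi>: "Q *v \<psi> j = complex_of_real (\<mu> j) *s \<psi> j" if "j < CARD('n)" for j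
    using diag_op_eigen[OF \<psi> that] by (simp add: Q smult_scaleR)
  have annih: "?\<rho> ** Z \<xi> = ?\<rho> ** Z (\<xi> - Q *v \<xi>) + Z (\<xi> - Q *v \<xi>) ** ?\<rho>" for \<xi>
  proof (rule antilinear_eq_on_basis[OF \<psi>, where f = "\<lambda>\<xi>. ?\<rho> ** Z \<xi>"
        and g = "\<lambda>\<xi>. ?\<rho> ** Z (\<xi> - Q *v \<xi>) + Z (\<xi> - Q *v \<xi>) ** ?\<rho>"])
    show "?\<rho> ** Z (\<psi> j) = ?\<rho> ** Z (\<psi> j - Q *v \<psi> j) + Z (\<psi> j - Q *v \<psi> j) ** ?\<rho>" if "j < CARD('n)" for j
      using rel[OF that]
      by (simp add: Q\<psi>[OF that] Z_diff Z_smult mat_simps cscale_diff_left)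
  qed (simp_all add: Z_add Z_smult Z_diff mat_simps matrix_vector_right_distrib mv_smult cscale_add cscale_diff)
  have annih': "Z \<xi> ** ?\<rho> = Z (Q *v \<xi>) ** ?\<rho> + ?\<rho> ** Z (Q *v \<xi>)" for \<xi>
  proof (rule antilinear_eq_on_basis[OF \<psi>, where f = "\<lambda>\<xi>. Z \<xi> ** ?\<rho>"
        and g = "\<lambda>\<xi>. Z (Q *v \<xi>) ** ?\<rho> + ?\<rho> ** Z (Q *v \<xi>)"])
    show "Z (\<psi> j) ** ?\<rho> = Z (Q *v \<psi> j) ** ?\<rho> + ?\<rho> ** Z (Q *v \<psi> j)" if "j < CARD('n)" for j
    proof -
      have "Z (\<psi> j) ** ?\<rho> - complex_of_real (\<mu> j) *\<^sub>M (Z (\<psi> j) ** ?\<rho>) = complex_of_real (\<mu> j) *\<^sub>M (?\<rho> ** Z (\<psi> j))"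
        using rel[OF that] by (simp add: cscale_diff_left)
      then show ?thesis
        by (simp add: Q\<psi>[OF that] Z_smult cscale_mult_left cscale_mult_right diff_eq_eq add.commute)
    qed
  qed (simp_all add: Z_add Z_smult Z_diff mat_simps matrix_vector_right_distrib mv_smult cscale_add cscale_diff)
  \<comment> \<open>The adjoint of the relation just proved; the product is self-adjoint because its
    modes commute.\<close>
  have creat: "?\<rho> ** cadj (Z \<xi>) = ?\<rho> ** cadj (Z (Q *v \<xi>)) + cadj (Z (Q *v \<xi>)) ** ?\<rho>" for \<xi>
  proof -
    have "cadj (Z \<xi> ** ?\<rho>) = cadj (Z (Q *v \<xi>) ** ?\<rho> + ?\<rho> ** Z (Q *v \<xi>))"
      by (subst annih') (rule refl)
    then show ?thesis by (simp add: cadj_mult cadj_add sa)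
  qed
  \<comment> \<open>Cyclicity and commutation with the earlier modes give the two projections of
    mode \<open>m\<close> equal weight 1/2, which the factors 2 in \<open>mode\<close>
    compensate.\<close>
  have tr: "ntrace (mprod ?f m) = 1" if "m \<le> CARD('n)" for m
    using that
  proof (induction m)
    case (Suc m)
    let ?r = "mprod ?f m" and ?a = "Z (\<psi> m)"
    have comm: "?a ** ?r = ?r ** ?a"
      using Suc.prems by (intro mprod_commute mode_commute orth) auto
    have "ntrace (?r ** (cadj ?a ** ?a)) = ntrace (?a ** (?r ** cadj ?a))"
      by (metis ntrace_commute matrix_mul_assoc)
    also have "\<dots> = ntrace (?r ** (?a ** cadj ?a))"
      by (simp add: matrix_mul_assoc comm)
    finally have 1: "ntrace (?r ** (cadj ?a ** ?a)) = ntrace (?r ** (?a ** cadj ?a))" .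
    have "cinner (\<psi> m) (\<psi> m) = 1"
      using \<psi> Suc.prems by (simp add: orthonormal_def)
    then have "?r ** (?a ** cadj ?a) + ?r ** (cadj ?a ** ?a) = ?r"
      by (simp add: anti_star flip: matrix_add_ldistrib)
    then have "ntrace (?r ** (?a ** cadj ?a)) + ntrace (?r ** (cadj ?a ** ?a)) = ntrace ?r"
      by (metis ntrace_add)
    then have 2: "ntrace (?r ** (?a ** cadj ?a)) = 1 / 2" "ntrace (?r ** (cadj ?a ** ?a)) = 1 / 2"
      using Suc 1 by (simp_all add: mult.commute)
    have "ntrace (mprod ?f (Suc m)) = ((1 - \<mu> m) * 2) *\<^sub>R ntrace (?r ** (?a ** cadj ?a)) + (\<mu> m * 2) *\<^sub>R ntrace (?r ** (cadj ?a ** ?a))"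
      by (simp add: mode_def mat_simps ntrace_simps)
    then show ?case by (simp add: 2 scaleR_conv_of_real diff_divide_distrib)
  qed simp
  have "W ** mode \<psi> \<mu> j = mode \<psi> \<mu> j ** W" for j
  proof -
    have 1: "W ** Z (\<psi> j) = - (Z (\<psi> j) ** W)" "W ** cadj (Z (\<psi> j)) = - (cadj (Z (\<psi> j)) ** W)"
      using parity_ladder[OF parity_W, of "(False, \<psi> j)"] parity_ladder[OF parity_W, of "(True, \<psi> j)"]
      by (simp_all add: ladder_def)
    have "W ** (Z (\<psi> j) ** cadj (Z (\<psi> j))) = (Z (\<psi> j) ** cadj (Z (\<psi> j))) ** W"
      by (simp add: matrix_mul_assoc 1 mult_minus_left) (simp add: 1 mult_minus_right flip: matrix_mul_assoc)
    moreover have "W ** (cadj (Z (\<psi> j)) ** Z (\<psi> j)) = (cadj (Z (\<psi> j)) ** Z (\<psi> j)) ** W"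
      by (simp add: matrix_mul_assoc 1 mult_minus_left) (simp add: 1 mult_minus_right flip: matrix_mul_assoc)
    ultimately show ?thesis by (simp add: mode_def mat_simps)
  qed
  then have "W ** ?\<rho> = ?\<rho> ** W" by (intro mprod_commute) auto
  moreover have "?\<rho> ** ladder Z x = ?\<rho> ** ladder Z (twist Q x) + ladder Z (twist Q x) ** ?\<rho>" for x
  proof (cases "fst x")
    case True
    then have l: "ladder Z x = cadj (Z (snd x))" "ladder Z (twist Q x) = cadj (Z (Q *v snd x))"
      by (simp_all add: ladder_def twist_def)
    show ?thesis unfolding l by (rule creat)
  next
    case False
    then have l: "ladder Z x = Z (snd x)" "ladder Z (twist Q x) = Z (snd x - Q *v snd x)"
      by (simp_all add: ladder_def twist_def)
    show ?thesis unfolding l by (rule annih)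
  qed
  moreover have "ntrace ?\<rho> = 1" by (rule tr) simp
  ultimately show ?thesis
    unfolding gauss_def using parity_W by blast
qed

text \<open>Every spectral decomposition yields an operator with the same relations, and these
  determine it; this resolves the \<open>THE\<close> in \<open>gig_density\<close>.\<close>

lemma gauss_gig_density:
  assumes "selfadj Q"
  shows "gauss Z Q (gig_density Z Q)"
proof -
  obtain \<psi> \<mu> where sd: "spectral_decomp Q \<psi> \<mu>"
    using ex_spectral_decomp[OF assms] by blast
  have "gig_density Z Q = mprod (mode \<psi> \<mu>) CARD('n)"
    unfolding gig_density_def mode_def[symmetric]
  proof (rule the_equality)
    show "\<exists>\<psi>' \<mu>'. spectral_decomp Q \<psi>' \<mu>' \<and> mprod (mode \<psi> \<mu>) CARD('n) = mprod (mode \<psi>' \<mu>') CARD('n)"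
      using sd by blast
    fix \<rho>
    assume "\<exists>\<psi>' \<mu>'. spectral_decomp Q \<psi>' \<mu>' \<and> \<rho> = mprod (mode \<psi>' \<mu>') CARD('n)"
    then have "gauss Z Q \<rho>" using gauss_mprod by auto
    then show "\<rho> = mprod (mode \<psi> \<mu>) CARD('n)"
      using gauss_mprod[OF sd] gauss_unique by blast
  qed
  then show ?thesis using gauss_mprod[OF sd] by simp
qed

end

text \<open>Differentiability is over the reals: \<open>Q\<close> enters some two-point functions
  conjugate linearly.\<close>

lemma wick_differentiable: "(\<lambda>Q. wick Q w) differentiable (at Q)"
proof (induction w rule: length_induct)
  case (1 w)
  show ?case
  proof (cases w)
    case (Cons x v)
    have "linear (\<lambda>Q. cinner \<phi> (Q *v \<psi>))" "linear (\<lambda>Q. cinner (Q *v \<psi>) \<phi>)" for \<phi> \<psi> :: "complex ^ 'a"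
      by (auto intro!: linearI simp: matrix_vector_mult_add_rdistrib cinner_add_left cinner_add_right
          mv_scaleR cinner_smult_left cinner_smult_right smult_scaleR scaleR_conv_of_real [where 'a = complex])
    then have lin: "(\<lambda>Q. cinner \<phi> (Q *v \<psi>)) differentiable (at Q)"
      "(\<lambda>Q. cinner (Q *v \<psi>) \<phi>) differentiable (at Q)" for \<phi> \<psi> :: "complex ^ 'a"
      by (auto intro!: bounded_linear_imp_differentiable simp: linear_conv_bounded_linear)
    have "(\<lambda>Q. acomm (twist Q x) y) differentiable (at Q)" for y
      using lin by (cases "fst x"; cases "fst y") (simp_all add: acomm_def twist_def cinner_diff_left cinner_diff_right)
    moreover have "(\<lambda>Q. wick Q (take i v @ drop (Suc i) v)) differentiable (at Q)" if "i < length v" for i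
      using 1 Cons that by auto
    ultimately show ?thesis
      unfolding Cons wick.simps by (intro differentiable_sum differentiable_mult) auto
  qed simp
qed

text \<open>Each trace functional of a Gaussian operator is a combination of Wick polynomials, and
  entries are such functionals. The second part is an implication because a Gaussian operator is
  constructed for self-adjoint \<open>Q\<close> only, while \<open>F\<close> has to be
  differentiable in the full matrix space.\<close>

lemma (in car_irr) ex_gauss_param:
  "\<exists>F. (\<forall>Q. F differentiable (at Q)) \<and> (\<forall>Q \<rho>. gauss Z Q \<rho> \<longrightarrow> \<rho> = F Q)"
proof -
  have "\<exists>f. (\<forall>Q. f differentiable (at Q)) \<and> (\<forall>Q \<rho>. gauss Z Q \<rho> \<longrightarrow> ntrace (\<rho> ** X) = f Q)" for X
  proof -
    have "X \<in> word_span Z" by (simp add: word_span_UNIV)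
    then show ?thesis
    proof (induction rule: word_span_induct)
      case (base c w)
      show ?case
        by (rule exI[of _ "\<lambda>Q. c * wick Q w"])
          (auto simp: mat_simps ntrace_simps gauss_wick intro!: wick_differentiable differentiable_mult)
    next
      case subspace
      show ?case
        unfolding subspace_def mem_Collect_eq
      proof (intro conjI ballI allI impI)
        show "\<exists>f. (\<forall>Q. f differentiable (at Q)) \<and> (\<forall>Q \<rho>. gauss Z Q \<rho> \<longrightarrow> ntrace (\<rho> ** 0) = f Q)"
          by (rule exI[of _ "\<lambda>_. 0"]) simp
        fix X assume "X \<in> {X. \<exists>f. (\<forall>Q. f differentiable (at Q)) \<and> (\<forall>Q \<rho>. gauss Z Q \<rho> \<longrightarrow> ntrace (\<rho> ** X) = f Q)}"
        then obtain f where f: "\<forall>Q. f differentiable (at Q)" "\<forall>Q \<rho>. gauss Z Q \<rho> \<longrightarrow> ntrace (\<rho> ** X) = f Q"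
          by blast
        {
          fix Y assume "Y \<in> {X. \<exists>f. (\<forall>Q. f differentiable (at Q)) \<and> (\<forall>Q \<rho>. gauss Z Q \<rho> \<longrightarrow> ntrace (\<rho> ** X) = f Q)}"
          then obtain g where g: "\<forall>Q. g differentiable (at Q)" "\<forall>Q \<rho>. gauss Z Q \<rho> \<longrightarrow> ntrace (\<rho> ** Y) = g Q"
            by blast
          show "\<exists>f. (\<forall>Q. f differentiable (at Q)) \<and> (\<forall>Q \<rho>. gauss Z Q \<rho> \<longrightarrow> ntrace (\<rho> ** (X + Y)) = f Q)"
            by (rule exI[of _ "\<lambda>Q. f Q + g Q"])
              (use f g in \<open>auto simp: mat_simps ntrace_simps intro!: differentiable_add\<close>)
        }
        show "\<exists>f. (\<forall>Q. f differentiable (at Q)) \<and> (\<forall>Q \<rho>. gauss Z Q \<rho> \<longrightarrow> ntrace (\<rho> ** (r *\<^sub>R X)) = f Q)" for r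
          by (rule exI[of _ "\<lambda>Q. r *\<^sub>R f Q"])
            (use f in \<open>auto simp: mat_simps ntrace_simps intro!: differentiable_scaleR\<close>)
      qed
    qed
  qed
  then have "\<exists>f. \<forall>X. (\<forall>Q. f X differentiable (at Q)) \<and> (\<forall>Q \<rho>. gauss Z Q \<rho> \<longrightarrow> ntrace (\<rho> ** X) = f X Q)"
    by (intro choice allI)
  then obtain f where f: "\<And>X Q. f X differentiable (at Q)" "\<And>X Q \<rho>. gauss Z Q \<rho> \<Longrightarrow> ntrace (\<rho> ** X) = f X Q"
    by blast
  \<comment> \<open>The factor \<open>CARD('k)\<close> undoes the normalization of
    \<open>ntrace\<close> in \<open>ntrace_munit\<close>.\<close>
  define F where "F Q = (\<Sum>i\<in>UNIV. \<Sum>j\<in>UNIV. (of_nat CARD('k) * f (munit j i) Q) *\<^sub>M munit i j)" for Q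
  have "F differentiable (at Q)" for Q
  proof -
    have bl: "bounded_linear (\<lambda>c. c *\<^sub>M A)" for A :: "complex ^ 'k ^ 'k"
      by (intro linear_conv_bounded_linear[THEN iffD1] linearI)
        (simp_all add: cscale_add_left cscale_scaleR scaleR_conv_of_real)
    have "(\<lambda>Q. (of_nat CARD('k) * f X Q) *\<^sub>M A) differentiable (at Q)" for X A :: "complex ^ 'k ^ 'k"
    proof -
      obtain D where "((\<lambda>Q. of_nat CARD('k) * f X Q) has_derivative D) (at Q)"
        using differentiable_mult[OF differentiable_const f(1)] unfolding differentiable_def by blast
      from bounded_linear.has_derivative[OF bl this] show ?thesis
        unfolding differentiable_def by blast
    qed
    then show ?thesis
      unfolding F_def by (intro differentiable_sum) auto
  qed
  moreover have "\<rho> = F Q" if "gauss Z Q \<rho>" for Q \<rho>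
  proof -
    have "F Q = (\<Sum>i\<in>UNIV. \<Sum>j\<in>UNIV. \<rho> $ i $ j *\<^sub>M munit i j)"
      unfolding F_def by (simp add: f(2)[OF that, symmetric] ntrace_munit)
    then show ?thesis by (simp flip: munit_expansion)
  qed
  ultimately show ?thesis by blast
qed

section \<open>Kronecker products and implemented unitaries\<close>

lemma kron_mult: "kron A B ** kron C D = kron (A ** C) (B ** D)"
proof -
  have "(\<Sum>r\<in>UNIV. A $ a $ fst r * B $ b $ snd r * (C $ fst r $ c * D $ snd r $ d))
      = (\<Sum>k\<in>UNIV. A $ a $ k * C $ k $ c) * (\<Sum>l\<in>UNIV. B $ b $ l * D $ l $ d)" for a b c d
    unfolding UNIV_Times_UNIV[symmetric]
    by (simp add: sum_product sum.cartesian_product case_prod_unfold mult_ac)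
  then show ?thesis
    by (simp add: kron_def matrix_matrix_mult_def vec_eq_iff)
qed

lemma kron_add_left: "kron (A + B) C = kron A C + kron B C"
  by (simp add: kron_def vec_eq_iff algebra_simps)

lemma kron_add_right: "kron A (B + C) = kron A B + kron A C"
  by (simp add: kron_def vec_eq_iff algebra_simps)

lemma kron_minus_left: "kron (- A) C = - kron A C"
  by (simp add: kron_def vec_eq_iff)

lemma kron_minus_right: "kron A (- C) = - kron A C"
  by (simp add: kron_def vec_eq_iff)

lemma kron_cscale_left: "kron (c *\<^sub>M A) B = c *\<^sub>M kron A B"
  by (simp add: kron_def cscale_def vec_eq_iff)

lemma kron_cscale_right: "kron A (c *\<^sub>M B) = c *\<^sub>M kron A B"
  by (simp add: kron_def cscale_def vec_eq_iff)

lemma kron_scaleR_right: "kron A (r *\<^sub>R B) = r *\<^sub>R kron A B"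
  by (simp add: kron_def vec_eq_iff)

lemma kron_0 [simp]: "kron 0 B = 0" "kron A 0 = 0"
  by (simp_all add: kron_def vec_eq_iff)

lemma cadj_kron: "cadj (kron A B) = kron (cadj A) (cadj B)"
  by (simp add: kron_def cadj_def vec_eq_iff)

lemmas kron_rules = kron_mult cadj_kron

lemma kron_mat1 [simp]: "kron (mat 1) (mat 1) = mat 1"
  by (auto simp: kron_def mat_def vec_eq_iff prod_eq_iff)

lemma ntrace_kron: "ntrace (kron A B) = ntrace A * ntrace B"
proof -
  have "trace (kron A B) = trace A * trace B"
    unfolding trace_def UNIV_Times_UNIV[symmetric]
    by (simp add: sum_product sum.cartesian_product case_prod_unfold kron_def)
  then show ?thesis by (simp add: ntrace_def)
qed

lemma sum_UNIV_Times: "(\<Sum>p\<in>UNIV. f p) = (\<Sum>i\<in>UNIV. \<Sum>b\<in>UNIV. f (i, b))"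
  unfolding UNIV_Times_UNIV[symmetric] by (simp add: sum.cartesian_product)

text \<open>The partial trace over the second factor, normalized so as to be dual to
  \<open>A \<mapsto> kron A (mat 1)\<close> for \<open>ntrace\<close>.\<close>

definition ptrace :: "complex ^ ('k::finite \<times> 'l::finite) ^ ('k \<times> 'l) \<Rightarrow> complex ^ 'k ^ 'k" where
  "ptrace Y = (\<chi> i j. (\<Sum>b\<in>UNIV. Y $ (i, b) $ (j, b)) / of_nat CARD('l))"

lemma linear_ptrace: "linear (ptrace :: complex ^ ('k::finite \<times> 'l::finite) ^ ('k \<times> 'l) \<Rightarrow> _)"
  by (rule linearI) (simp_all add: ptrace_def vec_eq_iff sum.distrib add_divide_distrib scaleR_sum_right
      scaleR_conv_of_real [where 'a = complex] sum_distrib_left)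

lemma ntrace_ptrace: "ntrace (A ** ptrace Y) = ntrace (kron A (mat 1) ** Y)"
  for A :: "complex ^ 'k ^ 'k" and Y :: "complex ^ ('k::finite \<times> 'l::finite) ^ ('k \<times> 'l)"
proof -
  have "(\<Sum>p\<in>UNIV. \<Sum>q\<in>UNIV. A $ fst p $ fst q * (if snd p = snd q then 1 else 0) * Y $ q $ p)
     = (\<Sum>i\<in>UNIV. \<Sum>b\<in>UNIV. \<Sum>j\<in>UNIV. \<Sum>c\<in>UNIV. A $ i $ j * (if b = c then 1 else 0) * Y $ (j, c) $ (i, b))"
    by (simp add: sum_UNIV_Times)
  also have "\<dots> = (\<Sum>i\<in>UNIV. \<Sum>b\<in>UNIV. \<Sum>j\<in>UNIV. A $ i $ j * Y $ (j, b) $ (i, b))"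
    by (simp add: mult_delta_right mult_delta_left if_distribR cong: if_cong)
  also have "\<dots> = (\<Sum>i\<in>UNIV. \<Sum>j\<in>UNIV. A $ i $ j * (\<Sum>b\<in>UNIV. Y $ (j, b) $ (i, b)))"
    by (subst sum.swap) (simp add: sum_distrib_left)
  finally have "trace (kron A (mat 1) ** Y) = (\<Sum>i\<in>UNIV. \<Sum>j\<in>UNIV. A $ i $ j * (\<Sum>b\<in>UNIV. Y $ (j, b) $ (i, b)))"
    by (simp add: trace_def kron_def matrix_matrix_mult_def mat_def)
  moreover have "trace (A ** ptrace Y) = (\<Sum>i\<in>UNIV. \<Sum>j\<in>UNIV. A $ i $ j * (\<Sum>b\<in>UNIV. Y $ (j, b) $ (i, b))) / of_nat CARD('l)"
    by (simp add: trace_def ptrace_def matrix_matrix_mult_def flip: sum_divide_distrib)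
  ultimately show ?thesis
    by (simp only: ntrace_def) simp
qed

section \<open>Direct sums and block matrices\<close>

lemma sum_UNIV_Plus: "(\<Sum>i\<in>UNIV. f i) = (\<Sum>a\<in>UNIV. f (Inl a)) + (\<Sum>b\<in>UNIV. f (Inr b))"
  for f :: "'a::finite + 'b::finite \<Rightarrow> 'c::comm_monoid_add"
  by (subst UNIV_Plus_UNIV[symmetric], subst sum.Plus) simp_all

lemma dsum_sel [simp]: "dsum x y $ Inl a = x $ a" "dsum x y $ Inr b = y $ b"
  by (simp_all add: dsum_def)

lemma dsum_expand: "\<xi> = dsum (\<chi> i. \<xi> $ Inl i) (\<chi> i. \<xi> $ Inr i)"
  by (simp add: dsum_def vec_eq_iff split: sum.split)

lemma cinner_dsum: "cinner (dsum x y) (dsum x' y') = cinner x x' + cinner y y'"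
  by (simp add: cinner_def sum_UNIV_Plus)

lemma dsum_add: "dsum x y + dsum x' y' = dsum (x + x') (y + y')"
  by (simp add: dsum_def vec_eq_iff split: sum.split)

lemma dsum_smult: "c *s dsum x y = dsum (c *s x) (c *s y)"
  by (simp add: dsum_def vec_eq_iff split: sum.split)

lemma dsum_diff: "dsum x y - dsum x' y' = dsum (x - x') (y - y')"
  by (simp add: dsum_def vec_eq_iff split: sum.split)

lemma dsum_cases: obtains x y where "\<xi> = dsum x y"
  using dsum_expand by blast

lemma block_mat_dsum: "block_mat A B C D *v dsum x y = dsum (A *v x + B *v y) (C *v x + D *v y)"
proof -
  have "(block_mat A B C D *v dsum x y) $ i = dsum (A *v x + B *v y) (C *v x + D *v y) $ i" for i
    by (cases i) (simp_all add: matrix_vector_mult_def block_mat_def sum_UNIV_Plus)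
  then show ?thesis by (simp add: vec_eq_iff)
qed

lemma mat_eq_dsumI:
  assumes "\<And>x y. A *v dsum x y = B *v dsum x y"
  shows "A = B"
  by (rule mat_eqI) (metis assms dsum_expand)

lemma cadj_block_mat: "cadj (block_mat A B C D) = block_mat (cadj A) (cadj C) (cadj B) (cadj D)"
proof -
  have "cadj (block_mat A B C D) $ i $ j = block_mat (cadj A) (cadj C) (cadj B) (cadj D) $ i $ j" for i j
    by (cases i; cases j) (simp_all add: cadj_def block_mat_def)
  then show ?thesis by (simp add: vec_eq_iff)
qed

section \<open>Star homomorphisms and implementers\<close>

lemma star_homD:
  assumes "star_hom \<theta>"
  shows "\<theta> (mat 1) = mat 1" "\<theta> (A + B) = \<theta> A + \<theta> B" "\<theta> (c *\<^sub>M A) = c *\<^sub>M \<theta> A"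
    "\<theta> (A ** B) = \<theta> A ** \<theta> B" "\<theta> (cadj A) = cadj (\<theta> A)"
  using assms by (simp_all add: star_hom_def)

lemma star_hom_image:
  assumes "star_hom \<theta>"
  shows "\<theta> ` star_alg G = star_alg (\<theta> ` G)"
proof
  show "\<theta> ` star_alg G \<subseteq> star_alg (\<theta> ` G)"
  proof clarify
    fix A assume "A \<in> star_alg G"
    then show "\<theta> A \<in> star_alg (\<theta> ` G)"
      by induction (auto simp: star_homD[OF assms] intro: star_alg.intros)
  qed
  show "star_alg (\<theta> ` G) \<subseteq> \<theta> ` star_alg G"
  proof
    fix B assume "B \<in> star_alg (\<theta> ` G)"
    then show "B \<in> \<theta> ` star_alg G"
    proof induction
      case (gen B)
      then show ?case by (auto intro: star_alg.gen)
    next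
      case (add B B')
      then show ?case by (auto simp flip: star_homD(2)[OF assms] intro: star_alg.add)
    next
      case (scale B c)
      then show ?case by (auto simp flip: star_homD(3)[OF assms] intro: star_alg.scale)
    next
      case (mult B B')
      then show ?case by (auto simp flip: star_homD(4)[OF assms] intro: star_alg.mult)
    next
      case (star B)
      then show ?case by (auto simp flip: star_homD(5)[OF assms] intro: star_alg.star)
    qed
  qed
qed

lemma star_hom_eq_on:
  assumes "star_hom \<theta>" "star_hom \<theta>'" "\<And>A. A \<in> G \<Longrightarrow> \<theta> A = \<theta>' A" "A \<in> star_alg G"
  shows "\<theta> A = \<theta>' A"
  using assms(4) by induction (simp_all add: assms(3) star_homD[OF assms(1)] star_homD[OF assms(2)])

lemma star_hom_conj:
  fixes \<Gamma> :: "complex ^ 'k ^ 'k"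
  assumes "\<Gamma> ** cadj \<Gamma> = mat 1" "cadj \<Gamma> ** \<Gamma> = mat 1"
  shows "star_hom (\<lambda>X. \<Gamma> ** X ** cadj \<Gamma>)" "bij (\<lambda>X. \<Gamma> ** X ** cadj \<Gamma>)"
proof -
  have c: "cadj \<Gamma> ** (\<Gamma> ** X) = X" "\<Gamma> ** (cadj \<Gamma> ** X) = X" for X
    by (simp_all add: matrix_mul_assoc assms)
  show "star_hom (\<lambda>X. \<Gamma> ** X ** cadj \<Gamma>)"
    by (simp add: star_hom_def assms mat_simps cadj_mult c flip: matrix_mul_assoc)
  show "bij (\<lambda>X. \<Gamma> ** X ** cadj \<Gamma>)"
    by (rule o_bij[where g = "\<lambda>X. cadj \<Gamma> ** X ** \<Gamma>"])
      (simp_all add: fun_eq_iff c assms flip: matrix_mul_assoc)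
qed

definition implements :: "(complex ^ 'n \<Rightarrow> complex ^ 'k ^ 'k) \<Rightarrow> complex ^ 'n ^ 'n \<Rightarrow> complex ^ 'k ^ 'k \<Rightarrow> bool" where
  "implements Z U \<Gamma> \<longleftrightarrow> U ** cadj U = mat 1 \<and> cadj U ** U = mat 1 \<and>
     \<Gamma> ** cadj \<Gamma> = mat 1 \<and> cadj \<Gamma> ** \<Gamma> = mat 1 \<and> (\<forall>\<xi>. \<Gamma> ** Z \<xi> ** cadj \<Gamma> = Z (U *v \<xi>))"

text \<open>Conjugation by \<open>\<Gamma>\<close> is a star homomorphism that moves the vector of
  each letter by \<open>U\<close>, and \<open>twist\<close> is covariant under this, so the
  relations are carried over.\<close>

lemma (in car) gauss_conj:
  assumes "implements Z U \<Gamma>" "gauss Z Q \<rho>"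
  shows "gauss Z (U ** Q ** cadj U) (\<Gamma> ** \<rho> ** cadj \<Gamma>)"
proof -
  have \<Gamma>: "\<Gamma> ** cadj \<Gamma> = mat 1" "cadj \<Gamma> ** \<Gamma> = mat 1" and U: "U ** cadj U = mat 1" "cadj U ** U = mat 1"
    and im: "\<Gamma> ** Z \<xi> ** cadj \<Gamma> = Z (U *v \<xi>)" for \<xi>
    using assms(1) by (simp_all add: implements_def)
  note hom = star_homD[OF star_hom_conj(1)[OF \<Gamma>]]
  have lad: "ladder Z (b, U *v \<phi>) = \<Gamma> ** ladder Z (b, \<phi>) ** cadj \<Gamma>" for b \<phi>
    using im hom(5)[of "Z \<phi>"] by (cases b) (simp_all add: ladder_def)
  have tw: "twist (U ** Q ** cadj U) (b, U *v \<phi>) = (b, U *v snd (twist Q (b, \<phi>)))" for b \<phi>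
    by (simp add: twist_def matrix_vector_mul_assoc matrix_vector_mult_diff_distrib U flip: matrix_mul_assoc)
  have rel: "(\<Gamma> ** \<rho> ** cadj \<Gamma>) ** ladder Z x
      = (\<Gamma> ** \<rho> ** cadj \<Gamma>) ** ladder Z (twist (U ** Q ** cadj U) x)
        + ladder Z (twist (U ** Q ** cadj U) x) ** (\<Gamma> ** \<rho> ** cadj \<Gamma>)" for x
  proof -
    obtain b \<phi> where x: "x = (b, U *v \<phi>)"
      by (cases x) (metis U(1) matrix_vector_mul_assoc matrix_vector_mul_lid)
    have t: "(b, snd (twist Q (b, \<phi>))) = twist Q (b, \<phi>)" by (simp add: twist_def)
    have "\<rho> ** ladder Z (b, \<phi>) = \<rho> ** ladder Z (twist Q (b, \<phi>)) + ladder Z (twist Q (b, \<phi>)) ** \<rho>"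
      using assms(2) unfolding gauss_def by blast
    from arg_cong[OF this, of "\<lambda>X. \<Gamma> ** X ** cadj \<Gamma>"] show ?thesis
      unfolding x tw lad t hom(2,4) .
  qed
  obtain V where V: "parity_op Z V" "V ** \<rho> = \<rho> ** V" using assms(2) by (auto simp: gauss_def)
  have "parity_op Z (\<Gamma> ** V ** cadj \<Gamma>)"
    unfolding parity_op_def
  proof (intro conjI allI)
    show "\<Gamma> ** V ** cadj \<Gamma> ** (\<Gamma> ** V ** cadj \<Gamma>) = mat 1"
      using V(1) hom(1) by (simp add: parity_op_def flip: hom(4))
    show "cadj (\<Gamma> ** V ** cadj \<Gamma>) = \<Gamma> ** V ** cadj \<Gamma>"
      using V(1) by (simp add: parity_op_def flip: hom(5))
    fix \<phi>
    have \<phi>: "\<phi> = U *v (cadj U *v \<phi>)" by (simp add: matrix_vector_mul_assoc U)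
    show "\<Gamma> ** V ** cadj \<Gamma> ** Z \<phi> = - (Z \<phi> ** (\<Gamma> ** V ** cadj \<Gamma>))"
      using V(1)
      by (subst (1 2) \<phi>) (simp add: parity_op_def mult_minus_left mult_minus_right flip: im hom(4))
  qed
  moreover have "(\<Gamma> ** V ** cadj \<Gamma>) ** (\<Gamma> ** \<rho> ** cadj \<Gamma>) = (\<Gamma> ** \<rho> ** cadj \<Gamma>) ** (\<Gamma> ** V ** cadj \<Gamma>)"
    by (simp add: V(2) flip: hom(4))
  moreover have "ntrace (\<Gamma> ** \<rho> ** cadj \<Gamma>) = 1"
  proof -
    have "ntrace (\<Gamma> ** \<rho> ** cadj \<Gamma>) = ntrace (cadj \<Gamma> ** (\<Gamma> ** \<rho>))" by (rule ntrace_commute)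
    then show ?thesis using assms(2) by (simp add: matrix_mul_assoc \<Gamma> gauss_def)
  qed
  ultimately show ?thesis unfolding gauss_def using rel by blast
qed

text \<open>A self-adjoint unitary \<open>U = 1 - 2 P\<close> equals \<open>exp (i \<pi> P)\<close>, so it is implemented by the
  exponential of the second quantization of \<open>P\<close>.\<close>

lemma (in car) ex_implements_reflection:
  assumes "cadj U = U" "U ** U = mat 1"
  shows "\<exists>\<Gamma>. implements Z U \<Gamma>"
proof -
  define P where "P = (1/2) *\<^sub>R (mat 1 - U)"
  have saP: "cadj P = P" by (simp add: P_def cadj_simps assms)
  define \<Gamma> where "\<Gamma> = mexp (dGamma ((\<i> * complex_of_real pi) *\<^sub>M P))"
  have "cadj \<Gamma> = mexp (- dGamma ((\<i> * complex_of_real pi) *\<^sub>M P))"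
    by (simp add: \<Gamma>_def cadj_mexp cadj_dGamma cadj_cscale saP cscale_minus dGamma_cscale)
  then have inv: "\<Gamma> ** cadj \<Gamma> = mat 1" "cadj \<Gamma> ** \<Gamma> = mat 1"
    by (simp_all add: \<Gamma>_def mexp_minus_right mexp_minus_left)
  have Pv: "P *v \<xi> = (1/2) *\<^sub>R (\<xi> - U *v \<xi>)" for \<xi>
    by (simp add: P_def mv_scaleR matrix_vector_mult_diff_rdistrib)
  have UU: "U *v (U *v \<xi>) = \<xi>" for \<xi>
    by (simp add: matrix_vector_mul_assoc assms)
  have star: "\<Gamma> ** cadj (Z \<xi>) = cadj (Z (U *v \<xi>)) ** \<Gamma>" for \<xi>
  proof -
    \<comment> \<open>The components of \<open>\<xi>\<close> in the eigenspaces of \<open>U\<close>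
      for 1 and -1: \<open>P\<close> kills \<open>a\<close> and fixes \<open>b\<close>, so
      conjugation preserves the creator of \<open>a\<close> and multiplies that of \<open>b\<close>
      by \<open>exp (\<i> * pi)\<close>.\<close>
    define a b where "a = (1/2) *\<^sub>R (\<xi> + U *v \<xi>)" and "b = (1/2) *\<^sub>R (\<xi> - U *v \<xi>)"
    have "P *v a = 0"
      by (simp add: a_def Pv mv_scaleR_right matrix_vector_right_distrib UU algebra_simps)
    then have "((\<i> * complex_of_real pi) *\<^sub>M P) *v a = 0 *s a" by (simp add: mv_cscale)
    from mexp_dGamma_ladder[OF this] have 1: "\<Gamma> ** cadj (Z a) = cadj (Z a) ** \<Gamma>" by (simp add: \<Gamma>_def)
    have "P *v b = (1/2) *\<^sub>R (b - U *v b)" by (rule Pv)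
    also have "U *v b = - b"
      by (simp add: b_def mv_scaleR_right matrix_vector_mult_diff_distrib UU algebra_simps)
    also have "(1/2) *\<^sub>R (b - - b) = b" by (simp add: scaleR_2[symmetric])
    finally have "((\<i> * complex_of_real pi) *\<^sub>M P) *v b = (\<i> * complex_of_real pi) *s b" by (simp add: mv_cscale)
    from mexp_dGamma_ladder[OF this] have 2: "\<Gamma> ** cadj (Z b) = - (cadj (Z b) ** \<Gamma>)"
      by (simp add: \<Gamma>_def exp_Euler cscale_minus)
    have "\<xi> = a + b" "U *v \<xi> = a - b"
      by (simp_all add: a_def b_def algebra_simps flip: scaleR_add_left)
    then show ?thesis
      by (simp add: Z_add Z_diff cadj_simps mat_simps 1 2)
  qed
  have "\<Gamma> ** Z \<xi> ** cadj \<Gamma> = Z (U *v \<xi>)" for \<xi>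
  proof -
    have "\<Gamma> ** cadj (Z \<xi>) ** cadj \<Gamma> = cadj (Z (U *v \<xi>))"
      by (simp add: star inv flip: matrix_mul_assoc)
    from arg_cong[OF this, of cadj] show ?thesis by (simp add: cadj_mult matrix_mul_assoc)
  qed
  then show ?thesis using inv assms by (auto simp: implements_def)
qed

text \<open>Moments see \<open>Q\<close> only through its matrix elements between the vectors of the
  letters, so restricting a Gaussian state to a subfield compresses its symbol.\<close>

lemma wick_isometry:
  fixes j :: "complex ^ 'n \<Rightarrow> complex ^ 'm"
  assumes "\<And>x y. cinner (j x) (j y) = cinner x y" "\<And>x y. cinner (j x) (Q' *v j y) = cinner x (Q *v y)"
  shows "wick Q' (map (\<lambda>x. (fst x, j (snd x))) w) = wick Q w"
proof (induction w rule: length_induct)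
  case (1 w)
  have "cinner (Q' *v j y) (j x) = cinner (Q *v y) x" for x y
    by (metis assms(2) cinner_commute)
  then have ac: "acomm (twist Q' (fst x, j (snd x))) (fst y, j (snd y)) = acomm (twist Q x) y" for x y
    using assms by (simp add: acomm_def twist_def cinner_diff_left cinner_diff_right)
  show ?case
  proof (cases w)
    case (Cons x v)
    have "wick Q' (map (\<lambda>x. (fst x, j (snd x))) (take i v @ drop (Suc i) v)) = wick Q (take i v @ drop (Suc i) v)"
      if "i < length v" for i
    proof -
      have "length (take i v @ drop (Suc i) v) < length w" using Cons that by auto
      with 1 show ?thesis by blast
    qed
    then show ?thesis
      by (auto simp: Cons ac take_map drop_map intro!: sum.cong)
  qed simp
qed

section \<open>The doubled field and EHK operations\<close>

context car_irr
begin

lemma W_square: "W ** W = mat 1" and cadj_W: "cadj W = W"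
  using parity_W by (simp_all add: parity_op_def)

lemma W_Z: "W ** Z \<phi> = - (Z \<phi> ** W)" and W_Zstar: "W ** cadj (Z \<phi>) = - (cadj (Z \<phi>) ** W)"
  using parity_ladder[OF parity_W, of "(False, \<phi>)"] parity_ladder[OF parity_W, of "(True, \<phi>)"]
  by (simp_all add: ladder_def)

text \<open>\<open>gauss\<close> only provides some parity operator. But \<open>W\<close> implements
  \<open>- mat 1\<close>, which leaves every symbol fixed, so by uniqueness conjugation by
  \<open>W\<close> fixes the density.\<close>

lemma gauss_commute_W:
  assumes "gauss Z Q \<rho>"
  shows "W ** \<rho> = \<rho> ** W"
proof -
  have "W ** Z \<xi> ** W = Z (- \<xi>)" for \<xi>
    by (simp add: W_Z Z_minus mult_minus_left W_square flip: matrix_mul_assoc)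
  then have "implements Z (- mat 1) W"
    by (simp add: implements_def cadj_minus mult_minus_left mult_minus_right W_square cadj_W mv_minus)
  from gauss_conj[OF this assms] have "gauss Z Q (W ** \<rho> ** W)"
    by (simp add: cadj_minus mult_minus_left mult_minus_right cadj_W)
  then have "W ** \<rho> ** W = \<rho>" using assms gauss_unique by blast
  then have "W ** \<rho> ** (W ** W) = \<rho> ** W" by (simp add: matrix_mul_assoc)
  then show ?thesis by (simp add: W_square)
qed

definition Z2 :: "complex ^ ('n + 'n) \<Rightarrow> complex ^ ('k \<times> 'k) ^ ('k \<times> 'k)" where
  "Z2 = CAR_double Z"

lemma Z2_dsum: "Z2 (dsum x y) = kron (Z x) W + kron (mat 1) (Z y)"
proof -
  have "(\<chi> i. x $ i) = x" "(\<chi> i. y $ i) = y" by (simp_all add: vec_eq_iff)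
  then show ?thesis by (simp add: Z2_def CAR_double_def W_def)
qed

text \<open>The mixed anticommutators cancel because \<open>W\<close> in the second slot
  anticommutes with the ladder operators there.\<close>

lemma CAR_Z2: "car Z2"
proof
  show "CAR_field Z2"
    unfolding CAR_field_def
  proof (intro conjI allI)
    fix \<psi> \<phi> :: "complex ^ ('n + 'n)" and c
    obtain x y where \<psi>: "\<psi> = dsum x y" by (rule dsum_cases)
    obtain x' y' where \<phi>: "\<phi> = dsum x' y'" by (rule dsum_cases)
    show "Z2 (\<psi> + \<phi>) = Z2 \<psi> + Z2 \<phi>"
      by (simp add: \<psi> \<phi> dsum_add Z2_dsum Z_add kron_add_left kron_add_right)
    show "Z2 (c *s \<psi>) = cnj c *\<^sub>M Z2 \<psi>"
      by (simp add: \<psi> dsum_smult Z2_dsum Z_smult kron_cscale_left kron_cscale_right cscale_add)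
    have "Z2 \<psi> ** cadj (Z2 \<phi>) + cadj (Z2 \<phi>) ** Z2 \<psi>
        = kron (Z x ** cadj (Z x') + cadj (Z x') ** Z x) (mat 1) + kron (mat 1) (Z y ** cadj (Z y') + cadj (Z y') ** Z y)"
      by (simp add: \<psi> \<phi> Z2_dsum cadj_add kron_rules cadj_W matrix_add_ldistrib matrix_add_rdistrib
          kron_add_left kron_add_right W_Z W_Zstar W_square kron_minus_right)
    also have "\<dots> = cinner \<psi> \<phi> *\<^sub>M mat 1"
      by (simp add: anti_star kron_cscale_left kron_cscale_right \<psi> \<phi> cinner_dsum cscale_add_left)
    finally show "Z2 \<psi> ** cadj (Z2 \<phi>) + cadj (Z2 \<phi>) ** Z2 \<psi> = cinner \<psi> \<phi> *\<^sub>M mat 1" .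
    have "Z2 \<psi> ** Z2 \<phi> + Z2 \<phi> ** Z2 \<psi>
        = kron (Z x ** Z x' + Z x' ** Z x) (mat 1) + kron (mat 1) (Z y ** Z y' + Z y' ** Z y)"
      by (simp add: \<psi> \<phi> Z2_dsum kron_rules matrix_add_ldistrib matrix_add_rdistrib
          kron_add_left kron_add_right W_Z W_square kron_minus_right)
    then show "Z2 \<psi> ** Z2 \<phi> + Z2 \<phi> ** Z2 \<psi> = 0"
      by (simp add: anti_Z)
  qed
qed

sublocale dbl: car Z2 by (rule CAR_Z2)

lemma kron_W_parity: "parity_op Z2 (kron W W)"
  unfolding parity_op_def
proof (intro conjI allI)
  fix \<xi> :: "complex ^ ('n + 'n)"
  obtain x y where \<xi>: "\<xi> = dsum x y" by (rule dsum_cases)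
  show "kron W W ** Z2 \<xi> = - (Z2 \<xi> ** kron W W)"
    by (simp add: \<xi> Z2_dsum kron_rules matrix_add_ldistrib matrix_add_rdistrib W_Z W_square
        kron_minus_left kron_minus_right)
qed (simp_all add: kron_rules W_square cadj_W)

text \<open>The second factor is reached directly; in the first, multiplying
  \<open>Z2 (dsum \<psi> 0)\<close> by \<open>kron (mat 1) W\<close> removes the attached
  \<open>W\<close>. Kronecker products of matrix units then give everything.\<close>

lemma star_alg_Z2: "star_alg (range Z2) = UNIV"
proof -
  have B: "kron (mat 1) X \<in> star_alg (range Z2)" for X
  proof -
    have "X \<in> star_alg (range Z)" by (simp add: star_alg_UNIV)
    then show ?thesis
    proof induction
      case (gen A)
      then obtain \<psi> where "A = Z \<psi>" by auto
      then have "kron (mat 1) A = Z2 (dsum 0 \<psi>)" by (simp add: Z2_dsum)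
      then show ?case by (auto intro: star_alg.gen)
    next
      case (mult A B)
      then show ?case using star_alg.mult[OF mult.IH] by (simp add: kron_rules)
    next
      case (star A)
      then show ?case using star_alg.star[OF star.IH] by (simp add: kron_rules)
    qed (simp_all add: kron_add_right kron_cscale_right star_alg.intros)
  qed
  have A: "kron X (mat 1) \<in> star_alg (range Z2)" for X
  proof -
    have "X \<in> star_alg (range Z)" by (simp add: star_alg_UNIV)
    then show ?thesis
    proof induction
      case (gen A)
      then obtain \<psi> where "A = Z \<psi>" by auto
      then have "kron A (mat 1) = Z2 (dsum \<psi> 0) ** kron (mat 1) W" by (simp add: Z2_dsum kron_rules W_square)
      then show ?case using B by (auto intro: star_alg.gen star_alg.mult)
    next
      case (mult A B)
      then show ?case using star_alg.mult[OF mult.IH] by (simp add: kron_rules)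
    next
      case (star A)
      then show ?case using star_alg.star[OF star.IH] by (simp add: kron_rules)
    qed (simp_all add: kron_add_left kron_cscale_left star_alg.intros)
  qed
  have AB: "kron X Y \<in> star_alg (range Z2)" for X Y
    using star_alg.mult[OF A[of X] B[of Y]] by (simp add: kron_rules)
  have munit: "munit p q = kron (munit (fst p) (fst q)) (munit (snd p) (snd q))" for p q :: "'k \<times> 'k"
    by (auto simp: munit_def kron_def vec_eq_iff prod_eq_iff)
  have zero: "0 \<in> star_alg (range Z2)"
    using star_alg.scale[OF dbl.mat1_in_star_alg, of 0] by simp
  have sum: "(\<Sum>i\<in>I. f i) \<in> star_alg (range Z2)" if "\<And>i. f i \<in> star_alg (range Z2)" for I :: "'b set" and f
    by (induction I rule: infinite_finite_induct) (auto simp: zero that intro: star_alg.add)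
  have "X \<in> star_alg (range Z2)" for X
    by (subst munit_expansion[of X]) (intro sum star_alg.scale, simp add: munit AB)
  then show ?thesis by auto
qed

text \<open>Conjugation by the controlled parity \<open>C\<close> turns \<open>Z(\<psi>) \<otimes> 1\<close> into \<open>Z(\<psi>) \<otimes> W\<close>.\<close>

definition C :: "complex ^ ('k \<times> 'k) ^ ('k \<times> 'k)" where
  "C = kron (mat 1) ((1/2) *\<^sub>R (mat 1 + W)) + kron W ((1/2) *\<^sub>R (mat 1 - W))"

definition embA :: "complex ^ 'k ^ 'k \<Rightarrow> complex ^ ('k \<times> 'k) ^ ('k \<times> 'k)" where
  "embA X = C ** kron X (mat 1) ** cadj C"

definition embB :: "complex ^ 'k ^ 'k \<Rightarrow> complex ^ ('k \<times> 'k) ^ ('k \<times> 'k)" where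
  "embB X = kron (mat 1) X"

lemma proj_rules:
  defines "p \<equiv> (1/2) *\<^sub>R (mat 1 + W)" and "m \<equiv> (1/2) *\<^sub>R (mat 1 - W)"
  shows "p ** p = p" "m ** m = m" "p ** m = 0" "m ** p = 0" "cadj p = p" "cadj m = m" "p + m = mat 1" "p - m = W"
  unfolding p_def m_def
  by (simp_all add: mat_simps W_square cadj_simps cadj_W algebra_simps flip: scaleR_add_left scaleR_left_distrib)

lemma C_props: "cadj C = C" "C ** C = mat 1"
proof -
  show "cadj C = C"
    unfolding C_def by (simp only: cadj_add kron_rules proj_rules cadj_W cadj_mat1)
  have "C ** C = kron (mat 1) ((1/2) *\<^sub>R (mat 1 + W)) + kron (mat 1) ((1/2) *\<^sub>R (mat 1 - W))"
    unfolding C_def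
    by (simp only: matrix_add_ldistrib matrix_add_rdistrib kron_rules proj_rules W_square kron_0
        matrix_mul_lid matrix_mul_rid add_0_left add_0_right)
  also have "\<dots> = mat 1"
    by (simp only: proj_rules kron_mat1 flip: kron_add_right)
  finally show "C ** C = mat 1" .
qed

text \<open>Even operators do not feel the controlled parity. This covers Gaussian densities, so the
  product of such a density in the first algebra with an element of the second is a plain
  \<open>kron\<close>.\<close>

lemma embA_commuting:
  assumes "W ** X = X ** W"
  shows "embA X = kron X (mat 1)"
proof -
  have "C ** kron X (mat 1) = kron X (mat 1) ** C"
    unfolding C_def
    by (simp only: matrix_add_ldistrib matrix_add_rdistrib kron_rules assms matrix_mul_lid matrix_mul_rid)
  then show ?thesis by (simp add: embA_def C_props flip: matrix_mul_assoc)
qed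

lemma embA_Z: "embA (Z \<psi>) = Z2 (dsum \<psi> 0)"
proof -
  have "C ** kron (Z \<psi>) (mat 1) = kron (Z \<psi>) W ** C"
  proof -
    have Wp: "W ** ((1/2) *\<^sub>R (mat 1 + W)) = (1/2) *\<^sub>R (mat 1 + W)"
      "W ** ((1/2) *\<^sub>R (mat 1 - W)) = - ((1/2) *\<^sub>R (mat 1 - W))"
      by (simp_all add: mat_simps W_square algebra_simps)
    show ?thesis
      unfolding C_def
      by (simp only: matrix_add_ldistrib matrix_add_rdistrib kron_rules W_Z Wp kron_minus_left kron_minus_right
          matrix_mul_lid matrix_mul_rid)
  qed
  then show ?thesis
    by (simp add: embA_def C_props Z2_dsum flip: matrix_mul_assoc)
qed

lemma embB_Z: "embB (Z \<psi>) = Z2 (dsum 0 \<psi>)"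
  by (simp add: embB_def Z2_dsum)

lemma star_hom_embA: "star_hom embA"
proof -
  have C: "C ** (C ** X) = X" for X by (simp add: matrix_mul_assoc C_props)
  show ?thesis
    by (simp add: star_hom_def embA_def C_props mat_simps cadj_mult kron_rules kron_add_left kron_cscale_left C
        flip: matrix_mul_assoc) (simp add: kron_rules matrix_mul_assoc)
qed

lemma star_hom_embB: "star_hom embB"
  by (simp add: star_hom_def embB_def kron_rules kron_add_right kron_cscale_right)

lemma inj_embB: "inj embB"
proof (rule injI)
  fix X Y assume "embB X = embB Y"
  then have "embB X $ (i, a) $ (i, b) = embB Y $ (i, a) $ (i, b)" for i a b by simp
  then show "X = Y" by (simp add: embB_def kron_def mat_def vec_eq_iff)
qed

lemma inj_embA: "inj embA"
proof (rule injI)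
  fix X Y assume "embA X = embA Y"
  then have "C ** embA X ** C = C ** embA Y ** C" by simp
  moreover have "C ** embA X ** C = kron X (mat 1)" for X
    unfolding embA_def C_props(1) by (simp add: C_props flip: matrix_mul_assoc) (simp add: C_props matrix_mul_assoc)
  ultimately have "kron X (mat 1 :: complex ^ 'k ^ 'k) $ (a, i) $ (b, i) = kron Y (mat 1) $ (a, i) $ (b, i)" for i a b
    by simp
  then show "X = Y" by (simp add: kron_def mat_def vec_eq_iff)
qed

text \<open>A star homomorphism is determined by its values on the field, since the field generates
  all operators; this resolves the \<open>THE\<close>.\<close>

lemma CAR_iso_eq:
  fixes Z' :: "complex ^ 'n \<Rightarrow> complex ^ 'l ^ 'l"
  assumes "star_hom \<theta>" "inj \<theta>" "\<And>\<psi>. \<theta> (Z \<psi>) = Z' \<psi>"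
  shows "CAR_iso Z Z' = \<theta>" "star_alg (range Z') = range \<theta>"
proof -
  have "\<theta> ` range Z = range Z'" using assms(3) by (auto simp: image_image)
  then show rng: "star_alg (range Z') = range \<theta>"
    using star_hom_image[OF assms(1), of "range Z"] by (simp add: star_alg_UNIV)
  show "CAR_iso Z Z' = \<theta>"
    unfolding CAR_iso_def
  proof (rule the_equality)
    show "star_hom \<theta> \<and> bij_betw \<theta> UNIV (star_alg (range Z')) \<and> (\<forall>\<psi>. \<theta> (Z \<psi>) = Z' \<psi>)"
      using assms rng by (simp add: bij_betw_def)
    fix \<theta>'
    assume *: "star_hom \<theta>' \<and> bij_betw \<theta>' UNIV (star_alg (range Z')) \<and> (\<forall>\<psi>. \<theta>' (Z \<psi>) = Z' \<psi>)"
    show "\<theta>' = \<theta>"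
    proof
      fix X
      show "\<theta>' X = \<theta> X"
        by (rule star_hom_eq_on[of _ _ "range Z"]) (use * assms in \<open>auto simp: star_alg_UNIV\<close>)
    qed
  qed
qed

lemma CAR_aut_eq:
  assumes "implements Z2 U \<Gamma>"
  shows "CAR_aut Z2 U = (\<lambda>X. \<Gamma> ** X ** cadj \<Gamma>)"
  unfolding CAR_aut_def
proof (rule the_equality)
  have \<Gamma>: "\<Gamma> ** cadj \<Gamma> = mat 1" "cadj \<Gamma> ** \<Gamma> = mat 1"
    using assms by (simp_all add: implements_def)
  show *: "star_hom (\<lambda>X. \<Gamma> ** X ** cadj \<Gamma>) \<and> bij (\<lambda>X. \<Gamma> ** X ** cadj \<Gamma>)
      \<and> (\<forall>\<xi>. \<Gamma> ** Z2 \<xi> ** cadj \<Gamma> = Z2 (U *v \<xi>))"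
    using star_hom_conj[OF \<Gamma>] assms by (simp add: implements_def)
  fix \<alpha>
  assume **: "star_hom \<alpha> \<and> bij \<alpha> \<and> (\<forall>\<xi>. \<alpha> (Z2 \<xi>) = Z2 (U *v \<xi>))"
  show "\<alpha> = (\<lambda>X. \<Gamma> ** X ** cadj \<Gamma>)"
  proof
    fix X
    show "\<alpha> X = \<Gamma> ** X ** cadj \<Gamma>"
      by (rule star_hom_eq_on[of \<alpha> "\<lambda>X. \<Gamma> ** X ** cadj \<Gamma>" "range Z2"])
        (use * ** in \<open>auto simp: star_alg_Z2\<close>)
  qed
qed

section \<open>Reduction to the first algebra\<close>

definition redA :: "complex ^ ('k \<times> 'k) ^ ('k \<times> 'k) \<Rightarrow> complex ^ 'k ^ 'k" where
  "redA Y = ptrace (C ** Y ** C)"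

lemma linear_redA: "linear redA"
proof -
  have "linear (\<lambda>Y. C ** Y ** C)" by (rule linearI) (simp_all add: mat_simps)
  from linear_compose[OF this linear_ptrace] show ?thesis
    by (simp add: redA_def[abs_def] o_def)
qed

lemma ntrace_redA: "ntrace (A ** redA Y) = ntrace (embA A ** Y)"
proof -
  have "ntrace (A ** redA Y) = ntrace ((kron A (mat 1) ** C ** Y) ** C)"
    by (simp add: redA_def ntrace_ptrace matrix_mul_assoc)
  also have "\<dots> = ntrace (C ** (kron A (mat 1) ** C ** Y))" by (rule ntrace_commute)
  finally show ?thesis by (simp add: embA_def C_props matrix_mul_assoc)
qed

lemma ntrace_embA: "ntrace (embA A) = ntrace A"
proof -
  have "ntrace (embA A) = ntrace (C ** (C ** kron A (mat 1)))"
    unfolding embA_def C_props by (rule ntrace_commute)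
  then show ?thesis by (simp add: matrix_mul_assoc C_props ntrace_kron)
qed

text \<open>\<open>redA\<close> is dual to \<open>embA\<close> for the trace form, and
  \<open>embA\<close> preserves the trace, so \<open>embA\<close> after \<open>redA\<close> is the
  orthogonal projection onto the range; definiteness of the form gives uniqueness.\<close>

lemma cond_exp_embA: "cond_exp (range embA) Y = embA (redA Y)"
  unfolding cond_exp_def
proof (rule the_equality)
  note hom = star_homD[OF star_hom_embA]
  have orth: "ntrace (cadj (embA A) ** (Y - embA E)) = ntrace (cadj A ** redA Y) - ntrace (cadj A ** E)" for A E
    by (simp add: mult_diff_right ntrace_diff ntrace_redA ntrace_embA flip: hom(4,5))
  show "embA (redA Y) \<in> range embA \<and> (\<forall>A\<in>range embA. ntrace (cadj A ** (Y - embA (redA Y))) = 0)"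
    by (auto simp: orth)
  fix Y'
  assume "Y' \<in> range embA \<and> (\<forall>A\<in>range embA. ntrace (cadj A ** (Y - Y')) = 0)"
  then obtain E where E: "Y' = embA E" "\<And>A. ntrace (cadj (embA A) ** (Y - embA E)) = 0" by blast
  have "ntrace (cadj (redA Y - E) ** (redA Y - E)) = 0"
    by (metis orth E(2) mult_diff_right ntrace_diff)
  then show "Y' = embA (redA Y)" using ntrace_adj_self E(1) by fastforce
qed

lemma embA_word: "embA (word_op Z w) = word_op Z2 (map (\<lambda>x. (fst x, dsum (snd x) 0)) w)"
proof (induction w)
  case (Cons x w)
  have "embA (ladder Z x) = ladder Z2 (fst x, dsum (snd x) 0)"
    by (simp add: ladder_def embA_Z star_homD[OF star_hom_embA])
  then show ?case by (simp add: Cons star_homD[OF star_hom_embA])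
qed (simp add: star_homD[OF star_hom_embA])

text \<open>Letters of the first field carry \<open>W\<close> in the second slot; it passes through
  \<open>\<rho>2\<close> by evenness, and the two one-factor relations add up.\<close>

lemma gauss_kron:
  assumes "gauss Z Q1 \<rho>1" "gauss Z Q2 \<rho>2"
  shows "gauss Z2 (block_mat Q1 0 0 Q2) (kron \<rho>1 \<rho>2)"
proof -
  let ?Q = "block_mat Q1 0 0 Q2"
  note W1 = gauss_commute_W[OF assms(1)] and W2 = gauss_commute_W[OF assms(2)]
  have lad: "ladder Z2 (b, dsum x y) = kron (ladder Z (b, x)) W + kron (mat 1) (ladder Z (b, y))" for b x y
    by (simp add: ladder_def Z2_dsum cadj_add kron_rules cadj_W)
  have tw: "twist ?Q (b, dsum x y) = (b, dsum (snd (twist Q1 (b, x))) (snd (twist Q2 (b, y))))" for b x y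
    by (simp add: twist_def block_mat_dsum dsum_diff)
  have "kron \<rho>1 \<rho>2 ** ladder Z2 x = kron \<rho>1 \<rho>2 ** ladder Z2 (twist ?Q x) + ladder Z2 (twist ?Q x) ** kron \<rho>1 \<rho>2" for x
  proof -
    obtain b y z where x: "x = (b, dsum y z)" by (cases x) (metis dsum_cases)
    have t: "(b, snd (twist Q (b, \<phi>))) = twist Q (b, \<phi>)" for Q \<phi> by (simp add: twist_def)
    have r1: "\<rho>1 ** ladder Z (b, y) = \<rho>1 ** ladder Z (twist Q1 (b, y)) + ladder Z (twist Q1 (b, y)) ** \<rho>1"
      using assms(1) unfolding gauss_def by blast
    have r2: "\<rho>2 ** ladder Z (b, z) = \<rho>2 ** ladder Z (twist Q2 (b, z)) + ladder Z (twist Q2 (b, z)) ** \<rho>2"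
      using assms(2) unfolding gauss_def by blast
    show ?thesis
      unfolding x tw lad t matrix_add_ldistrib matrix_add_rdistrib kron_rules r1 r2 W2
        matrix_mul_lid matrix_mul_rid kron_add_left kron_add_right
      by (simp add: add_ac)
  qed
  moreover have "kron W W ** kron \<rho>1 \<rho>2 = kron \<rho>1 \<rho>2 ** kron W W"
    by (simp add: kron_rules W1 W2)
  moreover have "ntrace (kron \<rho>1 \<rho>2) = 1"
    using assms by (simp add: ntrace_kron gauss_def)
  ultimately show ?thesis unfolding gauss_def using kron_W_parity by blast
qed

text \<open>On symbols: \<open>T'\<close> and \<open>Q\<close> form a block diagonal symbol,
  \<open>ehk_unitary S\<close> conjugates it, and the conditional expectation keeps the upper left
  block. For self-adjoint \<open>S\<close> both square roots in \<open>ehk_unitary\<close> equal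
  \<open>D\<close>.\<close>

lemma ehk_gauss:
  assumes S: "cadj S = S" and D: "cadj D = D" "op_sqrt (mat 1 - S ** S) = D" "D ** D = mat 1 - S ** S" "S ** D = D ** S"
    and T': "ehk_T S R = T'" "cadj T' = T'"
  shows "linear (ehk Z S R)"
    and "gauss Z Q \<rho> \<Longrightarrow> gauss Z (D ** T' ** D + S ** Q ** S) \<rho>' \<Longrightarrow> ehk Z S R \<rho> = \<rho>'"
proof -
  let ?U = "ehk_unitary S"
  have U: "?U = block_mat (- D) S S D"
    by (simp add: ehk_unitary_def S D)
  have Usa: "cadj ?U = ?U" by (simp add: U cadj_block_mat cadj_minus S D)
  have UU: "?U ** ?U = mat 1"
  proof (rule mat_eq_dsumI)
    fix x y
    have "D ** D + S ** S = mat 1" by (simp add: D)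
    then have 1: "D *v (D *v z) + S *v (S *v z) = z" for z
      by (metis matrix_vector_mul_assoc matrix_vector_mult_add_rdistrib matrix_vector_mul_lid)
    have 2: "S *v (D *v z) = D *v (S *v z)" for z
      by (simp add: matrix_vector_mul_assoc D)
    show "(?U ** ?U) *v dsum x y = mat 1 *v dsum x y"
      unfolding matrix_vector_mul_assoc[symmetric] U block_mat_dsum
      using 1[of x] 1[of y]
      by (simp add: mv_minus mv_minus_right matrix_vector_right_distrib 2 algebra_simps)
  qed
  obtain \<Gamma> where \<Gamma>: "implements Z2 ?U \<Gamma>"
    using dbl.ex_implements_reflection[OF Usa UU] by blast
  have gT: "gauss Z T' (gig_density Z T')"
    by (rule gauss_gig_density) (simp add: selfadj_def T')
  have isoA: "CAR_iso Z (\<lambda>\<psi>. Z2 (dsum \<psi> 0)) = embA"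
    "star_alg (range (\<lambda>\<psi>. Z2 (dsum \<psi> 0))) = range embA"
    using CAR_iso_eq[OF star_hom_embA inj_embA embA_Z] by simp_all
  have isoB: "CAR_iso Z (\<lambda>\<psi>. Z2 (dsum 0 \<psi>)) = embB"
    using CAR_iso_eq(1)[OF star_hom_embB inj_embB embB_Z] by simp
  have ehk: "ehk Z S R X = redA (\<Gamma> ** kron (gig_density Z T') X ** cadj \<Gamma>)" for X
    unfolding ehk_def Let_def Z2_def[symmetric] isoA isoB T'(1) CAR_aut_eq[OF \<Gamma>] cond_exp_embA
    by (simp add: inv_f_f[OF inj_embA] embA_commuting[OF gauss_commute_W[OF gT]] embB_def kron_rules)
  show "linear (ehk Z S R)"
  proof -
    have "linear (\<lambda>X. \<Gamma> ** kron (gig_density Z T') X ** cadj \<Gamma>)"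
      by (rule linearI) (simp_all add: kron_add_right kron_scaleR_right mat_simps)
    from linear_compose[OF this linear_redA] show ?thesis
      by (simp add: ehk[abs_def] o_def)
  qed
  let ?Q' = "D ** T' ** D + S ** Q ** S"
  assume \<rho>: "gauss Z Q \<rho>" and \<rho>': "gauss Z ?Q' \<rho>'"
  let ?X = "\<Gamma> ** kron (gig_density Z T') \<rho> ** cadj \<Gamma>" and ?B = "?U ** block_mat T' 0 0 Q ** cadj ?U"
  have X: "gauss Z2 ?B ?X"
    by (rule dbl.gauss_conj[OF \<Gamma> gauss_kron[OF gT \<rho>]])
  \<comment> \<open>Only the first component matters: pairing with vectors \<open>dsum x 0\<close>
    discards the second.\<close>
  have B: "?B *v dsum y 0 = dsum (?Q' *v y) (D *v (Q *v (S *v y)) - S *v (T' *v (D *v y)))" for y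
    unfolding Usa unfolding matrix_vector_mul_assoc[symmetric] U block_mat_dsum
    by (simp add: mv_minus mv_minus_right matrix_vector_mult_add_rdistrib flip: matrix_vector_mul_assoc)
  have "redA ?X = \<rho>'"
  proof (rule ntrace_words_eqI)
    fix w :: "(bool \<times> (complex ^ 'n)) list"
    let ?w = "map (\<lambda>x. (fst x, dsum (snd x) (0 :: complex ^ 'n))) w"
    have "ntrace (redA ?X ** word_op Z w) = ntrace (word_op Z w ** redA ?X)" by (rule ntrace_commute)
    also have "\<dots> = ntrace (word_op Z2 ?w ** ?X)"
      by (simp only: ntrace_redA embA_word)
    also have "\<dots> = ntrace (?X ** word_op Z2 ?w)" by (rule ntrace_commute)
    also have "\<dots> = wick ?B ?w" by (rule dbl.gauss_wick[OF X])
    also have "\<dots> = wick ?Q' w"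
      by (rule wick_isometry) (simp_all add: B cinner_dsum)
    also have "\<dots> = ntrace (\<rho>' ** word_op Z w)" by (simp add: gauss_wick[OF \<rho>'])
    finally show "ntrace (redA ?X ** word_op Z w) = ntrace (\<rho>' ** word_op Z w)" .
  qed
  then show "ehk Z S R \<rho> = \<rho>'" by (simp add: ehk)
qed

end

section \<open>The Mehler semigroup\<close>

lemma mexp_neg_has_vector_derivative:
  "((\<lambda>t. mexp ((- t) *\<^sub>R A)) has_vector_derivative - (A ** mexp ((- t) *\<^sub>R A))) (at t within S)"
  using mexp_has_vector_derivative[of "- A" t S] by (simp add: mult_minus_left)

lemma mexp_neg_commute: "A ** mexp ((- t) *\<^sub>R A) = mexp ((- t) *\<^sub>R A) ** A"
  by (rule mexp_commute)

lemma has_vector_derivative_matrix_mult: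
  fixes f :: "real \<Rightarrow> complex ^ 'n ^ 'm" and g :: "real \<Rightarrow> complex ^ 'l ^ 'n"
  assumes "(f has_vector_derivative f') (at x within S)" "(g has_vector_derivative g') (at x within S)"
  shows "((\<lambda>x. f x ** g x) has_vector_derivative (f x ** g' + f' ** g x)) (at x within S)"
  using bounded_bilinear.has_vector_derivative[OF bounded_bilinear_matrix_mult assms] .

lemma has_vector_derivative_mult_const:
  fixes f :: "real \<Rightarrow> complex ^ 'n ^ 'm"
  assumes "(f has_vector_derivative f') (at x within S)"
  shows "((\<lambda>x. f x ** B) has_vector_derivative (f' ** B)) (at x within S)"
  using has_vector_derivative_matrix_mult[OF assms has_vector_derivative_const[of B]] by simp

lemma ex_linear_projection:
  fixes V :: "'a::real_vector set"
  assumes "subspace V"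
  shows "\<exists>p. linear p \<and> (\<forall>x. p x \<in> V) \<and> (\<forall>x\<in>V. p x = x)"
  using linear_exists_left_inverse_on[of "\<lambda>x. x" V] assms by (auto simp: linear_id[unfolded id_def])

lemma at_Ici_neq_bot: "at (0::real) within {0..} \<noteq> bot"
  by (simp add: at_within_Ici_at_right)

text \<open>A linear projection onto the subspace fixes the curve, hence also its
  derivative.\<close>

lemma derivative_in_subspace:
  fixes V :: "'a::euclidean_space set"
  assumes V: "subspace V" and d: "(f has_vector_derivative y) (at 0 within {0..})"
    and f: "\<And>s. 0 \<le> s \<Longrightarrow> f s \<in> V"
  shows "y \<in> V"
proof -
  obtain p where p: "linear p" "\<And>x. p x \<in> V" "\<And>x. x \<in> V \<Longrightarrow> p x = x"
    using ex_linear_projection[OF V] by blast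
  have "bounded_linear p" using p(1) by (simp add: linear_conv_bounded_linear)
  from bounded_linear.has_vector_derivative[OF this d]
  have "((\<lambda>s. p (f s)) has_vector_derivative p y) (at 0 within {0..})" .
  then have "(f has_vector_derivative p y) (at 0 within {0..})"
    by (rule has_vector_derivative_transform[rotated 2]) (use f p in auto)
  then have "y = p y"
    using d at_Ici_neq_bot vector_derivative_unique_within by blast
  then show ?thesis using p(2)[of y] by simp
qed

text \<open>The Taylor remainders of a solution of \<open>u' = g u\<close> are iterated integrals of the solution,
  so the exponential series converges to it.\<close>

lemma linear_ode_op_exp:
  fixes u :: "real \<Rightarrow> 'a::euclidean_space"
  assumes g: "linear g" and t: "0 \<le> t"
    and u: "\<And>s. s \<in> {0..t} \<Longrightarrow> (u has_vector_derivative g (u s)) (at s within {0..t})"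
  shows "op_exp (\<lambda>X. t *\<^sub>R g X) (u 0) = u t"
proof -
  have bl: "bounded_linear g" using g by (simp add: linear_conv_bounded_linear)
  obtain c where c: "c > 0" "\<And>x. norm (g x) \<le> norm x * c"
    using bounded_linear.pos_bounded[OF bl] by blast
  have cont: "continuous_on {0..t} u"
    by (rule continuous_on_vector_derivative[OF u])
  obtain M where M: "\<And>s. s \<in> {0..t} \<Longrightarrow> norm (u s) \<le> M"
    using compact_imp_bounded[OF compact_continuous_image[OF cont compact_Icc]]
    unfolding bounded_iff by blast
  define P where "P m s = (\<Sum>i<m. (s ^ i / fact i) *\<^sub>R (g ^^ i) (u 0))" for m and s :: real
  \<comment> \<open>The Taylor polynomials satisfy the equation up to a shift in degree, so each
    remainder has \<open>g\<close> of the previous one as its derivative.\<close>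
  have dP: "((\<lambda>s. P (Suc m) s) has_vector_derivative g (P m s)) (at s within S)" for m s S
  proof -
    have "((\<lambda>s. (s ^ Suc i / fact (Suc i)) *\<^sub>R (g ^^ Suc i) (u 0)) has_vector_derivative (s ^ i / fact i) *\<^sub>R (g ^^ Suc i) (u 0)) (at s within S)" for i
    proof -
      have "((\<lambda>s. s ^ Suc i / fact (Suc i)) has_real_derivative (s ^ i / fact i)) (at s within S)"
        by (rule derivative_eq_intros refl | simp)+
      from has_vector_derivative_scaleR[OF this has_vector_derivative_const] show ?thesis
        by simp
    qed
    then have "((\<lambda>s. \<Sum>i<m. (s ^ Suc i / fact (Suc i)) *\<^sub>R (g ^^ Suc i) (u 0)) has_vector_derivative (\<Sum>i<m. (s ^ i / fact i) *\<^sub>R (g ^^ Suc i) (u 0))) (at s within S)"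
      by (rule has_vector_derivative_sum)
    from has_vector_derivative_add[OF has_vector_derivative_const[of "u 0"] this]
    show ?thesis
      by (simp add: P_def sum.lessThan_Suc_shift linear_sum[OF g] linear_scale[OF g] del: sum.lessThan_Suc)
  qed
  have bound: "norm (u s - P m s) \<le> M * ((c * s) ^ m / fact m)" if "s \<in> {0..t}" for m s
    using that
  proof (induction m arbitrary: s)
    case 0
    then show ?case using M by (simp add: P_def)
  next
    case (Suc m)
    show ?case
    proof (cases "s = 0")
      case True
      then show ?thesis by (simp add: P_def power_0_left sum.lessThan_Suc_shift del: sum.lessThan_Suc)
    next
      case False
      then have s: "0 < s" "s \<le> t" using Suc.prems by auto
      have du: "(u has_vector_derivative g (u x)) (at x within {0..s})" if "x \<in> {0..s}" for x
        using u[of x] that s by (auto intro: has_vector_derivative_within_subset)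
      have d: "((\<lambda>x. u x - P (Suc m) x) has_vector_derivative g (u x - P m x)) (at x within {0..s})" if "x \<in> {0..s}" for x
        using has_vector_derivative_diff[OF du[OF that] dP] by (simp add: linear_diff[OF g])
      have d\<phi>: "((\<lambda>x. M * ((c * x) ^ Suc m / fact (Suc m))) has_vector_derivative (M * ((c * x) ^ m / fact m) * c)) (at x within T)" for x T
        unfolding has_real_derivative_iff_has_vector_derivative[symmetric]
        by (rule derivative_eq_intros refl | simp)+
      have "norm ((u s - P (Suc m) s) - (u 0 - P (Suc m) 0)) \<le> M * ((c * s) ^ Suc m / fact (Suc m)) - M * ((c * 0) ^ Suc m / fact (Suc m))"
      proof (rule differentiable_bound_general[OF s(1)])
        show "continuous_on {0..s} (\<lambda>x. u x - P (Suc m) x)"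
          by (rule continuous_on_vector_derivative[OF d])
        show "continuous_on {0..s} (\<lambda>x. M * ((c * x) ^ Suc m / fact (Suc m)))"
          by (rule continuous_on_vector_derivative[OF d\<phi>])
        show "((\<lambda>x. M * ((c * x) ^ Suc m / fact (Suc m))) has_vector_derivative (M * ((c * x) ^ m / fact m) * c)) (at x)" for x
          by (rule d\<phi>)
        fix x assume x: "0 < x" "x < s"
        show "((\<lambda>x. u x - P (Suc m) x) has_vector_derivative g (u x - P m x)) (at x)"
          unfolding at_within_Icc_at[OF x, symmetric] using x by (intro d) simp
        show "norm (g (u x - P m x)) \<le> M * ((c * x) ^ m / fact m) * c"
          using c Suc.IH[of x] x s by (intro order.trans[OF c(2)] mult_right_mono) auto
      qed
      then show ?thesis
        by (simp add: P_def power_0_left sum.lessThan_Suc_shift del: sum.lessThan_Suc)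
    qed
  qed
  have "(\<lambda>m. P m t) \<longlonglongrightarrow> u t"
  proof -
    have "(\<lambda>m. (c * t) ^ m /\<^sub>R fact m) \<longlonglongrightarrow> 0"
      by (rule summable_LIMSEQ_zero[OF summable_exp_generic])
    then have "(\<lambda>m. M * ((c * t) ^ m / fact m)) \<longlonglongrightarrow> 0"
      using tendsto_mult_right_zero by (fastforce simp: divide_inverse mult.commute)
    then have "(\<lambda>m. u t - P m t) \<longlonglongrightarrow> 0"
      by (rule Lim_null_comparison[rotated]) (use bound t in auto)
    then have "(\<lambda>m. u t - (u t - P m t)) \<longlonglongrightarrow> u t - 0"
      by (intro tendsto_intros)
    then show ?thesis by simp
  qed
  moreover have "((\<lambda>X. t *\<^sub>R g X) ^^ i) x = t ^ i *\<^sub>R (g ^^ i) x" for i x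
    by (induction i) (simp_all add: linear_scale[OF g])
  ultimately have "(\<lambda>m. (1 / fact m) *\<^sub>R ((\<lambda>X. t *\<^sub>R g X) ^^ m) (u 0)) sums u t"
    by (simp add: sums_def P_def)
  then show ?thesis by (simp add: op_exp_def sums_iff)
qed

lemma pos_op_0: "pos_op 0"
  by (simp add: pos_op_def selfadj_def)

lemma pos_op_mat1: "pos_op (mat 1)"
  by (simp add: pos_op_def selfadj_def Re_cinner)

text \<open>The difference \<open>E\<close> of two candidates vanishes on the kernel of
  \<open>D\<close> and satisfies \<open>D ** E ** D = 0\<close>. So the square of \<open>E\<close>
  kills the range of \<open>D\<close>, hence so does the self-adjoint \<open>E\<close>; every
  eigenvector of \<open>D\<close> lies in its kernel or its range.\<close>

lemma ehk_T_eq: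
  fixes S D T :: "complex ^ 'n ^ 'n"
  assumes S: "cadj S = S" and \<psi>: "orthonormal \<psi> CARD('n)" and D: "D = diag_op \<psi> d"
    "op_sqrt (mat 1 - S ** S) = D" "D ** D = mat 1 - S ** S"
    and T: "T \<in> symbols" "op_ker (mat 1 - S ** S) \<subseteq> op_ker T" and R: "R = D ** T ** D"
  shows "ehk_T S R = T"
  unfolding ehk_T_def S D(2)
proof (rule the_equality)
  show "T \<in> symbols \<and> op_ker (mat 1 - S ** S) \<subseteq> op_ker T \<and> R = D ** T ** D"
    using T R by simp
  fix T' assume T': "T' \<in> symbols \<and> op_ker (mat 1 - S ** S) \<subseteq> op_ker T' \<and> R = D ** T' ** D"
  define E where "E = T' - T"
  have E: "cadj E = E"
    using T T' by (simp add: E_def cadj_diff symbols_def pos_op_def selfadj_def)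
  have DED: "D ** E ** D = 0" using T' R by (simp add: E_def mat_simps)
  have ker: "E *v x = 0" if "D *v x = 0" for x
  proof -
    have "(mat 1 - S ** S) *v x = 0"
      using that by (simp flip: D(3) matrix_vector_mul_assoc)
    then have "T' *v x = 0" "T *v x = 0" using T T' by (auto simp: op_ker_def)
    then show ?thesis by (simp add: E_def matrix_vector_mult_diff_rdistrib)
  qed
  have ED: "E *v (D *v x) = 0" for x
  proof -
    have "D *v (E *v (D *v x)) = 0"
      using arg_cong[OF DED, of "\<lambda>A. A *v x"] by (simp flip: matrix_vector_mul_assoc)
    then have "E *v (E *v (D *v x)) = 0" by (rule ker)
    then have "cinner (E *v (D *v x)) (E *v (D *v x)) = 0"
      by (simp add: cinner_mv_left E)
    then show ?thesis by (simp add: cinner_self_eq_0)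
  qed
  have "E *v \<psi> j = 0 *v \<psi> j" if j: "j < CARD('n)" for j
  proof (cases "d j = 0")
    case True
    then show ?thesis
      using ker[of "\<psi> j"] diag_op_eigen[OF \<psi> j, of d] by (simp add: D(1))
  next
    case False
    then have "\<psi> j = D *v ((1 / d j) *\<^sub>R \<psi> j)"
      using diag_op_eigen[OF \<psi> j, of d] by (simp add: D(1) mv_scaleR_right)
    then show ?thesis using ED by (metis matrix_vector_mult_0)
  qed
  then have "E = 0" by (rule eq_if_eq_on_basis[OF \<psi>])
  then show "T' = T" by (simp add: E_def)
qed

text \<open>In an eigenbasis of \<open>H\<close> the contraction \<open>S\<close> and the root
  \<open>D\<close> of \<open>mat 1 - S ** S\<close> are diagonal. \<open>T\<close> commutes with
  \<open>D\<close>, a function of \<open>H\<close>, which turns \<open>D ** T ** D\<close> into the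
  stated inhomogeneity.\<close>

lemma (in car_irr) mehler_props:
  assumes T: "T \<in> symbols" and H: "pos_op H" "H ** T = T ** H" and ker: "op_ker H \<subseteq> op_ker T" and t: "0 \<le> t"
  defines "S \<equiv> mexp ((- t) *\<^sub>R H)"
  shows "linear (mehler Z H T t)"
    and "gauss Z Q \<rho> \<Longrightarrow> gauss Z (S ** Q ** S + (mat 1 - S ** S) ** T) \<rho>' \<Longrightarrow> mehler Z H T t \<rho> = \<rho>'"
proof -
  obtain \<psi> h where sd: "spectral_decomp H \<psi> h"
    using H ex_spectral_decomp pos_op_def by blast
  then have \<psi>: "orthonormal \<psi> CARD('n)" and Hd: "H = diag_op \<psi> h"
    by (simp_all add: spectral_decomp_iff)
  have h: "0 \<le> h j" if "j < CARD('n)" for j by (rule spectral_pos[OF H(1) sd that])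
  define d where "d j = sqrt (1 - exp (- 2 * t * h j))" for j
  define D where "D = diag_op \<psi> d"
  have S: "S = diag_op \<psi> (\<lambda>j. exp (- t * h j))"
    unfolding S_def Hd diag_op_scaleR mexp_diag_op[OF \<psi>] ..
  have SS: "S ** S = diag_op \<psi> (\<lambda>j. exp (- 2 * t * h j))"
    unfolding S diag_op_mult[OF \<psi>] by (simp add: mult_exp_exp algebra_simps)
  have SS': "mexp ((- 2 * t) *\<^sub>R H) = S ** S"
    unfolding SS Hd diag_op_scaleR mexp_diag_op[OF \<psi>] ..
  have one: "mat 1 - S ** S = diag_op \<psi> (\<lambda>j. 1 - exp (- 2 * t * h j))"
    unfolding SS diag_op_1[OF \<psi>, symmetric] diag_op_diff ..
  have nonneg: "0 \<le> 1 - exp (- 2 * t * h j)" if "j < CARD('n)" for j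
    using h[OF that] t by (simp add: mult_nonneg_nonneg)
  have sq: "op_sqrt (mat 1 - S ** S) = D"
    unfolding one D_def d_def by (rule op_sqrt_diag_op[OF \<psi> nonneg])
  have DD: "D ** D = mat 1 - S ** S"
    unfolding one D_def diag_op_mult[OF \<psi>] using nonneg by (simp add: diag_op_def d_def)
  have SD: "S ** D = D ** S"
    unfolding S D_def diag_op_mult[OF \<psi>] by (simp add: mult.commute)
  have sa: "cadj S = S" "cadj D = D"
    using diag_op_selfadj[of \<psi>] by (simp_all add: S D_def selfadj_def)
  have TD: "T ** D = D ** T"
    unfolding D_def using H(2)[symmetric] unfolding Hd
    by (rule diag_op_commute[OF \<psi>]) (simp add: d_def)
  \<comment> \<open>At time 0 the contraction is 1, so \<open>mat 1 - S ** S\<close> vanishes and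
    the kernel condition forces the symbol 0; at positive times the symbol is \<open>T\<close>
    itself.\<close>
  define T' where "T' = (if t = 0 then 0 else T)"
  have DTD: "D ** T' ** D = (mat 1 - S ** S) ** T"
  proof (cases "t = 0")
    case True
    then have "S = mat 1" by (simp add: S_def)
    then show ?thesis using True by (simp add: T'_def)
  next
    case False
    have "D ** T ** D = D ** (T ** D)" by (simp only: matrix_mul_assoc)
    also have "\<dots> = D ** D ** T" by (simp only: TD matrix_mul_assoc)
    finally have "D ** T ** D = D ** D ** T" .
    then show ?thesis using False by (simp add: T'_def DD)
  qed
  have T'sym: "T' \<in> symbols" using T by (simp add: T'_def symbols_def pos_op_0 pos_op_mat1)
  have ehkT: "ehk_T S ((mat 1 - S ** S) ** T) = T'"
  proof (rule ehk_T_eq[OF sa(1) \<psi> D_def sq DD T'sym _ DTD[symmetric]])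
    show "op_ker (mat 1 - S ** S) \<subseteq> op_ker T'"
    proof (cases "t = 0")
      case True
      then show ?thesis by (simp add: T'_def op_ker_def)
    next
      case False
      \<comment> \<open>For positive \<open>t\<close> the factor
        \<open>1 - exp (- 2 * t * h j)\<close> vanishes exactly when \<open>h j\<close> does, so the
        kernel in question lies in that of \<open>H\<close>.\<close>
      have "H *v x = 0" if "(mat 1 - S ** S) *v x = 0" for x
      proof (rule vec_eq_if_eq_on_basis[OF \<psi>])
        fix j assume j: "j < CARD('n)"
        have c: "cinner (\<psi> j) (diag_op \<psi> f *v x) = f j * cinner (\<psi> j) x" for f
          using diag_op_selfadj[of \<psi> f]
          by (simp add: cinner_mv selfadj_def diag_op_eigen[OF \<psi> j] smult_scaleR cinner_smult_left)
        have "complex_of_real (1 - exp (- 2 * t * h j)) * cinner (\<psi> j) x = 0"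
        proof -
          have "complex_of_real (1 - exp (- 2 * t * h j)) * cinner (\<psi> j) x = cinner (\<psi> j) ((mat 1 - S ** S) *v x)"
            by (simp only: one c)
          then show ?thesis using that by (simp only: cinner_0)
        qed
        then have "1 - exp (- 2 * t * h j) = 0 \<or> cinner (\<psi> j) x = 0"
          by (metis mult_eq_0_iff of_real_eq_0_iff)
        then have "h j = 0 \<or> cinner (\<psi> j) x = 0" using False by auto
        then show "cinner (\<psi> j) (H *v x) = cinner (\<psi> j) 0"
          by (auto simp: Hd c)
      qed
      then show ?thesis using ker False by (auto simp: T'_def op_ker_def)
    qed
  qed
  have T'sa: "cadj T' = T'" using T'sym by (simp add: symbols_def pos_op_def selfadj_def)
  have m: "mehler Z H T t = ehk Z S ((mat 1 - S ** S) ** T)"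
    unfolding mehler_def SS' S_def ..
  note ehk = ehk_gauss[OF sa sq DD SD ehkT T'sa]
  show "linear (mehler Z H T t)" unfolding m by (rule ehk(1))
  show "mehler Z H T t \<rho> = \<rho>'"
    if "gauss Z Q \<rho>" "gauss Z (S ** Q ** S + (mat 1 - S ** S) ** T) \<rho>'"
    unfolding m by (rule ehk(2)[OF that(1)]) (use that(2) in \<open>simp add: DTD add.commute\<close>)
qed

section \<open>The flow of symbols\<close>

lemma pos_op_conj:
  assumes "pos_op B"
  shows "pos_op (E ** B ** cadj E)"
proof -
  have "cinner x ((E ** B ** cadj E) *v x) = cinner (cadj E *v x) (B *v (cadj E *v x))" for x
    by (simp add: cinner_mv_left flip: matrix_vector_mul_assoc)
  then show ?thesis
    using assms by (simp add: pos_op_def selfadj_def cadj_mult matrix_mul_assoc)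
qed

lemma pos_op_add: "pos_op A \<Longrightarrow> pos_op B \<Longrightarrow> pos_op (A + B)"
  by (simp add: pos_op_def selfadj_def cadj_add matrix_vector_mult_add_rdistrib cinner_add_right)

text \<open>The square root of \<open>H\<close> commutes with \<open>A\<close>, so the product is
  the conjugation of \<open>A\<close> by it.\<close>

lemma pos_op_mult_commuting:
  assumes H: "pos_op H" and A: "pos_op A" and comm: "H ** A = A ** H"
  shows "pos_op (H ** (A :: complex ^ 'n ^ 'n))"
proof -
  obtain \<psi> h where sd: "spectral_decomp H \<psi> h"
    using H ex_spectral_decomp pos_op_def by blast
  then have \<psi>: "orthonormal \<psi> CARD('n)" and Hd: "H = diag_op \<psi> h"
    by (simp_all add: spectral_decomp_iff)
  define D where "D = diag_op \<psi> (\<lambda>j. sqrt (h j))"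
  have "D ** D = H"
    unfolding D_def Hd diag_op_mult[OF \<psi>] using spectral_pos[OF H sd] by (simp add: diag_op_def)
  moreover have "A ** D = D ** A"
    unfolding D_def using comm[symmetric] unfolding Hd by (rule diag_op_commute[OF \<psi>]) simp
  ultimately have "H ** A = D ** A ** D"
    by (metis matrix_mul_assoc)
  moreover have "cadj D = D" using diag_op_selfadj[of \<psi>] by (simp add: D_def selfadj_def)
  ultimately show ?thesis using pos_op_conj[OF A, of D] by simp
qed

lemma pos_op_integral:
  fixes f :: "real \<Rightarrow> complex ^ 'n ^ 'n"
  assumes "f integrable_on S" "\<And>s. s \<in> S \<Longrightarrow> pos_op (f s)"
  shows "pos_op (integral S f)"
proof -
  have "cadj (integral S f) = integral S (cadj \<circ> f)"
    by (simp add: integral_linear[OF assms(1) bounded_linear_cadj])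
  also have "\<dots> = integral S f"
    using assms(2) by (intro integral_cong) (simp add: pos_op_def selfadj_def)
  finally have sa: "selfadj (integral S f)" by (simp add: selfadj_def)
  have "0 \<le> Re (cinner x (integral S f *v x))" for x
  proof -
    have "linear (\<lambda>A. Re (cinner x (A *v x)))"
      by (rule linearI) (simp_all add: matrix_vector_mult_add_rdistrib cinner_add_right mv_scaleR cinner_scaleR_right)
    then have bl: "bounded_linear (\<lambda>A. Re (cinner x (A *v x)))" by (simp add: linear_conv_bounded_linear)
    have "Re (cinner x (integral S f *v x)) = integral S ((\<lambda>A. Re (cinner x (A *v x))) \<circ> f)"
      by (simp add: integral_linear[OF assms(1) bl])
    also have "0 \<le> \<dots>"
      using assms(2) integrable_linear[OF assms(1) bl] by (intro integral_nonneg) (auto simp: pos_op_def)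
    finally show ?thesis .
  qed
  then show ?thesis using sa by (simp add: pos_op_def)
qed

text \<open>Solves \<open>q' = - A q - q A\<^sup>* + B\<close>.\<close>

definition affine_flow :: "complex ^ 'n ^ 'n \<Rightarrow> complex ^ 'n ^ 'n \<Rightarrow> complex ^ 'n ^ 'n \<Rightarrow> real \<Rightarrow> complex ^ 'n ^ 'n" where
  "affine_flow A B Q t = mexp ((- t) *\<^sub>R A) ** Q ** mexp ((- t) *\<^sub>R cadj A)
     + integral {0..t} (\<lambda>s. mexp ((- s) *\<^sub>R A) ** B ** mexp ((- s) *\<^sub>R cadj A))"

lemma affine_flow_0: "affine_flow A B Q 0 = Q"
  by (simp add: affine_flow_def)

lemma cadj_mexp_neg: "cadj (mexp ((- t) *\<^sub>R A)) = mexp ((- t) *\<^sub>R cadj A)"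
  by (simp add: cadj_mexp cadj_scaleR cadj_minus)

lemma conj_flow_derivative:
  "((\<lambda>t. mexp ((- t) *\<^sub>R A) ** Q ** mexp ((- t) *\<^sub>R cadj A)) has_vector_derivative
      - (A ** (mexp ((- t) *\<^sub>R A) ** Q ** mexp ((- t) *\<^sub>R cadj A)))
      - (mexp ((- t) *\<^sub>R A) ** Q ** mexp ((- t) *\<^sub>R cadj A)) ** cadj A) (at t within S)"
proof -
  have "(mexp ((- t) *\<^sub>R A) ** Q) ** - (cadj A ** mexp ((- t) *\<^sub>R cadj A)) + - (A ** mexp ((- t) *\<^sub>R A)) ** Q ** mexp ((- t) *\<^sub>R cadj A)
      = - (A ** (mexp ((- t) *\<^sub>R A) ** Q ** mexp ((- t) *\<^sub>R cadj A))) - (mexp ((- t) *\<^sub>R A) ** Q ** mexp ((- t) *\<^sub>R cadj A)) ** cadj A"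
    unfolding mexp_neg_commute[of "cadj A"]
    by (simp only: mult_minus_left mult_minus_right matrix_mul_assoc) simp
  then show ?thesis
    using has_vector_derivative_matrix_mult[OF
        has_vector_derivative_mult_const[OF mexp_neg_has_vector_derivative[of A t S], of Q]
        mexp_neg_has_vector_derivative[of "cadj A" t S]]
    by simp
qed

lemma conj_flow_continuous:
  "continuous_on S (\<lambda>t. mexp ((- t) *\<^sub>R A) ** Q ** mexp ((- t) *\<^sub>R cadj A))"
  by (rule continuous_on_vector_derivative[OF conj_flow_derivative])

lemma conj_flow_integrable:
  "(\<lambda>t. mexp ((- t) *\<^sub>R A) ** Q ** mexp ((- t) *\<^sub>R cadj A)) integrable_on {a..b::real}"
  using integrable_continuous_interval[OF conj_flow_continuous] .

text \<open>The integrand solves the homogeneous equation, so applying its linear vector field under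
  the integral produces boundary values. This lets the derivative of the Duhamel term be written as
  the affine field evaluated at that term.\<close>

lemma conj_flow_ftc:
  assumes "0 \<le> t"
  shows "- (A ** integral {0..t} (\<lambda>s. mexp ((- s) *\<^sub>R A) ** B ** mexp ((- s) *\<^sub>R cadj A)))
    - integral {0..t} (\<lambda>s. mexp ((- s) *\<^sub>R A) ** B ** mexp ((- s) *\<^sub>R cadj A)) ** cadj A
    = mexp ((- t) *\<^sub>R A) ** B ** mexp ((- t) *\<^sub>R cadj A) - B"
proof -
  let ?f = "\<lambda>s. mexp ((- s) *\<^sub>R A) ** B ** mexp ((- s) *\<^sub>R cadj A)"
  let ?h = "\<lambda>X. - (A ** X) - X ** cadj A"
  have "linear ?h" by (rule linearI) (simp_all add: mat_simps algebra_simps)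
  then have bl: "bounded_linear ?h" by (simp add: linear_conv_bounded_linear)
  have "((\<lambda>s. ?h (?f s)) has_integral (?f t - ?f 0)) {0..t}"
    using assms conj_flow_derivative by (rule fundamental_theorem_of_calculus)
  then have "integral {0..t} (?h \<circ> ?f) = ?f t - ?f 0" by (simp add: integral_unique o_def)
  then show ?thesis
    unfolding integral_linear[OF conj_flow_integrable bl] by simp
qed

lemma affine_flow_derivative:
  assumes s: "s \<in> {0..t}"
  shows "(affine_flow A B Q has_vector_derivative
      - (A ** affine_flow A B Q s) - affine_flow A B Q s ** cadj A + B) (at s within {0..t})"
proof -
  have "((\<lambda>u. integral {0..u} (\<lambda>s. mexp ((- s) *\<^sub>R A) ** B ** mexp ((- s) *\<^sub>R cadj A))) has_vector_derivative
      mexp ((- s) *\<^sub>R A) ** B ** mexp ((- s) *\<^sub>R cadj A)) (at s within {0..t})"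
    by (rule integral_has_vector_derivative[OF conj_flow_continuous s])
  from has_vector_derivative_add[OF conj_flow_derivative[of A Q s] this]
  show ?thesis
    unfolding affine_flow_def[abs_def]
  proof (rule back_subst[of "\<lambda>y. (_ has_vector_derivative y) _"])
    have ftc: "mexp ((- s) *\<^sub>R A) ** B ** mexp ((- s) *\<^sub>R cadj A)
        = - (A ** integral {0..s} (\<lambda>s. mexp ((- s) *\<^sub>R A) ** B ** mexp ((- s) *\<^sub>R cadj A)))
          - integral {0..s} (\<lambda>s. mexp ((- s) *\<^sub>R A) ** B ** mexp ((- s) *\<^sub>R cadj A)) ** cadj A + B"
      using conj_flow_ftc[of s A B] s by (simp add: algebra_simps)
    show "- (A ** (mexp ((- s) *\<^sub>R A) ** Q ** mexp ((- s) *\<^sub>R cadj A))) - mexp ((- s) *\<^sub>R A) ** Q ** mexp ((- s) *\<^sub>R cadj A) ** cadj A +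
        mexp ((- s) *\<^sub>R A) ** B ** mexp ((- s) *\<^sub>R cadj A) =
      - (A ** (mexp ((- s) *\<^sub>R A) ** Q ** mexp ((- s) *\<^sub>R cadj A) + integral {0..s} (\<lambda>s. mexp ((- s) *\<^sub>R A) ** B ** mexp ((- s) *\<^sub>R cadj A)))) -
      (mexp ((- s) *\<^sub>R A) ** Q ** mexp ((- s) *\<^sub>R cadj A) + integral {0..s} (\<lambda>s. mexp ((- s) *\<^sub>R A) ** B ** mexp ((- s) *\<^sub>R cadj A))) ** cadj A + B"
      by (subst ftc) (simp add: matrix_add_ldistrib matrix_add_rdistrib)
  qed
qed

lemma affine_flow_selfadj:
  assumes "selfadj Q" "selfadj B"
  shows "selfadj (affine_flow A B Q t)"
proof -
  have c: "cadj (mexp ((- s) *\<^sub>R A) ** X ** mexp ((- s) *\<^sub>R cadj A)) = mexp ((- s) *\<^sub>R A) ** X ** mexp ((- s) *\<^sub>R cadj A)"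
    if "selfadj X" for X s
    using that by (simp only: cadj_mult cadj_mexp_neg[of _ "cadj A"] cadj_mexp_neg[of _ A] cadj_cadj selfadj_def matrix_mul_assoc)
  have "cadj (integral {0..t} (\<lambda>s. mexp ((- s) *\<^sub>R A) ** B ** mexp ((- s) *\<^sub>R cadj A)))
      = integral {0..t} (cadj \<circ> (\<lambda>s. mexp ((- s) *\<^sub>R A) ** B ** mexp ((- s) *\<^sub>R cadj A)))"
    by (simp only: integral_linear[OF conj_flow_integrable bounded_linear_cadj])
  then show ?thesis
    unfolding selfadj_def affine_flow_def cadj_add
    by (simp only: c[OF assms(1)] c[OF assms(2)] o_def)
qed

lemma affine_flow_pos:
  assumes "pos_op Q" "pos_op B"
  shows "pos_op (affine_flow A B Q t)"
proof -
  have "pos_op (mexp ((- s) *\<^sub>R A) ** X ** mexp ((- s) *\<^sub>R cadj A))" if "pos_op X" for s X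
    using pos_op_conj[OF that, of "mexp ((- s) *\<^sub>R A)"] by (simp only: cadj_mexp_neg)
  then show ?thesis
    unfolding affine_flow_def using assms by (intro pos_op_add pos_op_integral conj_flow_integrable)
qed

text \<open>\<open>mat 1\<close> is a rest point for the source \<open>A + cadj A\<close>, so the
  complement of a solution follows a flow of the same kind; the bound by 1 thereby becomes
  positivity.\<close>

lemma affine_flow_complement:
  assumes "0 \<le> t"
  shows "mat 1 - affine_flow A B Q t = affine_flow A (A + cadj A - B) (mat 1 - Q) t"
proof -
  let ?I = "\<lambda>B. integral {0..t} (\<lambda>s. mexp ((- s) *\<^sub>R A) ** B ** mexp ((- s) *\<^sub>R cadj A))"
  let ?E = "\<lambda>Q. mexp ((- t) *\<^sub>R A) ** Q ** mexp ((- t) *\<^sub>R cadj A)"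
  have "((\<lambda>s. - (A ** (mexp ((- s) *\<^sub>R A) ** mat 1 ** mexp ((- s) *\<^sub>R cadj A))) - (mexp ((- s) *\<^sub>R A) ** mat 1 ** mexp ((- s) *\<^sub>R cadj A)) ** cadj A) has_integral (?E (mat 1) - mat 1)) {0..t}"
    using fundamental_theorem_of_calculus[OF assms conj_flow_derivative[of A "mat 1"]] by simp
  moreover have "- (A ** (mexp ((- s) *\<^sub>R A) ** mat 1 ** mexp ((- s) *\<^sub>R cadj A))) - (mexp ((- s) *\<^sub>R A) ** mat 1 ** mexp ((- s) *\<^sub>R cadj A)) ** cadj A
      = - (mexp ((- s) *\<^sub>R A) ** (A + cadj A) ** mexp ((- s) *\<^sub>R cadj A))" for s
    unfolding matrix_mul_rid matrix_add_ldistrib matrix_add_rdistrib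
    by (simp only: matrix_mul_assoc mexp_neg_commute[of A]) (simp only: mexp_neg_commute[of "cadj A", symmetric] flip: matrix_mul_assoc, simp)
  ultimately have "((\<lambda>s. - (mexp ((- s) *\<^sub>R A) ** (A + cadj A) ** mexp ((- s) *\<^sub>R cadj A))) has_integral (?E (mat 1) - mat 1)) {0..t}"
    by simp
  from has_integral_neg[OF this] have "?I (A + cadj A) = mat 1 - ?E (mat 1)"
    by (simp add: integral_unique)
  moreover have "?I (A + cadj A - B) = ?I (A + cadj A) - ?I B"
    by (simp only: mult_diff_left mult_diff_right integral_diff[OF conj_flow_integrable conj_flow_integrable])
  ultimately show ?thesis
    by (simp add: affine_flow_def mult_diff_left mult_diff_right)
qed

lemma affine_flow_symbols:
  assumes t: "0 \<le> t" and Q: "Q \<in> symbols" and B: "pos_op B" "pos_op (A + cadj A - B)"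
  shows "affine_flow A B Q t \<in> symbols"
  unfolding symbols_def mem_Collect_eq affine_flow_complement[OF t]
  using Q B by (auto simp: symbols_def intro!: affine_flow_pos)

lemma frechet_curve:
  assumes F: "\<And>Q. F differentiable (at Q)" and q: "(q has_vector_derivative v) (at s within S)"
  shows "((\<lambda>s. F (q s)) has_vector_derivative frechet_derivative F (at (q s)) v) (at s within S)"
  using vector_derivative_diff_chain_within[OF q has_derivative_at_withinI[OF frechet_derivative_works[THEN iffD1, OF F]]]
  by (simp add: o_def)

section \<open>Generators on Gaussian operators\<close>

context car_irr
begin

text \<open>Checked on an eigenbasis of \<open>K\<close>, where conjugation multiplies a creator by
  a phase.\<close>

lemma implements_dGamma:
  assumes "selfadj K"
  shows "implements Z (mexp ((- s) *\<^sub>R (\<i> *\<^sub>M K))) (mexp ((- s) *\<^sub>R (\<i> *\<^sub>M dGamma K)))"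
proof -
  let ?U = "mexp ((- s) *\<^sub>R (\<i> *\<^sub>M K))" and ?\<Gamma> = "mexp ((- s) *\<^sub>R (\<i> *\<^sub>M dGamma K))"
  have "cadj ?U = mexp (- ((- s) *\<^sub>R (\<i> *\<^sub>M K)))" "cadj ?\<Gamma> = mexp (- ((- s) *\<^sub>R (\<i> *\<^sub>M dGamma K)))"
    using assms by (simp_all add: cadj_mexp cadj_simps cadj_dGamma selfadj_def cscale_minus)
  then have inv: "?U ** cadj ?U = mat 1" "cadj ?U ** ?U = mat 1" "?\<Gamma> ** cadj ?\<Gamma> = mat 1" "cadj ?\<Gamma> ** ?\<Gamma> = mat 1"
    using mexp_minus_right mexp_minus_left by metis+
  obtain \<psi> \<kappa> where "spectral_decomp K \<psi> \<kappa>"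
    using ex_spectral_decomp[OF assms] by blast
  then have \<psi>: "orthonormal \<psi> CARD('n)" and K: "K = diag_op \<psi> \<kappa>" by (simp_all add: spectral_decomp_iff)
  have "?\<Gamma> ** Z \<xi> ** cadj ?\<Gamma> = Z (?U *v \<xi>)" for \<xi>
  proof (rule antilinear_eq_on_basis[OF \<psi>, where f = "\<lambda>\<xi>. ?\<Gamma> ** Z \<xi> ** cadj ?\<Gamma>" and g = "\<lambda>\<xi>. Z (?U *v \<xi>)"])
    fix j assume j: "j < CARD('n)"
    let ?c = "complex_of_real (- s) * (\<i> * complex_of_real (\<kappa> j))"
    have e: "((- s) *\<^sub>R (\<i> *\<^sub>M K)) *v \<psi> j = ?c *s \<psi> j"
      using diag_op_eigen[OF \<psi> j, of \<kappa>] by (simp only: K[symmetric] mv_scaleR mv_cscale smult_scaleR vector_smult_assoc)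
    have "?\<Gamma> = mexp (dGamma ((- s) *\<^sub>R (\<i> *\<^sub>M K)))" by (simp only: dGamma_scaleR dGamma_cscale)
    with mexp_dGamma_ladder[OF e] have "?\<Gamma> ** cadj (Z (\<psi> j)) = exp ?c *\<^sub>M (cadj (Z (\<psi> j)) ** ?\<Gamma>)" by (simp only:)
    then have "?\<Gamma> ** cadj (Z (\<psi> j)) ** cadj ?\<Gamma> = exp ?c *\<^sub>M (cadj (Z (\<psi> j)) ** (?\<Gamma> ** cadj ?\<Gamma>))"
      by (simp only: cscale_mult_left matrix_mul_assoc)
    then have "?\<Gamma> ** cadj (Z (\<psi> j)) ** cadj ?\<Gamma> = cadj (Z (exp ?c *s \<psi> j))"
      by (simp only: inv matrix_mul_rid Z_smult cadj_cscale complex_cnj_cnj)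
    from arg_cong[OF this, of cadj] show "?\<Gamma> ** Z (\<psi> j) ** cadj ?\<Gamma> = Z (?U *v \<psi> j)"
      by (simp only: mexp_eigen[OF e] cadj_mult cadj_cadj matrix_mul_assoc)
  qed (simp_all add: Z_add Z_smult mat_simps matrix_vector_right_distrib mv_smult)
  then show ?thesis using inv by (simp add: implements_def)
qed

text \<open>The operation at time \<open>s\<close> moves the symbol along the curve
  \<open>q\<close>, so the derivative is that of \<open>F\<close> along \<open>q\<close>. It is
  one-sided at 0, as the operations are controlled for nonnegative times.\<close>

lemma mehler_generator_gauss:
  assumes T: "T \<in> symbols" and H: "pos_op H" "H ** T = T ** H" and ker: "op_ker H \<subseteq> op_ker T"
    and F: "\<And>Q. F differentiable (at Q)" "\<And>Q. selfadj Q \<Longrightarrow> gauss Z Q (F Q)" and Q: "selfadj Q"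
  shows "((\<lambda>s. mehler Z H T s (F Q)) has_vector_derivative
    frechet_derivative F (at Q) (- (H ** Q) - Q ** H + (H ** T + T ** H))) (at 0 within {0..})"
proof -
  have Hsa: "cadj H = H" and Tsa: "cadj T = T"
    using H T by (simp_all add: pos_op_def selfadj_def symbols_def)
  define S where "S s = mexp ((- s) *\<^sub>R H)" for s
  have S: "cadj (S s) = S s" "S 0 = mat 1" for s
    by (simp_all add: S_def cadj_mexp cadj_scaleR cadj_minus Hsa)
  have ST: "S s ** T = T ** S s" for s
    unfolding S_def using H(2) by (intro mexp_intertwine) (simp add: mat_simps)
  define q where "q s = S s ** Q ** S s + (mat 1 - S s ** S s) ** T" for s
  have SXS: "((\<lambda>s. S s ** X ** S s) has_vector_derivative - (H ** X) - X ** H) (at 0 within {0..})" for X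
    using conj_flow_derivative[of H X 0 "{0..}"] by (simp add: S_def Hsa)
  then have "((\<lambda>s. S s ** S s) has_vector_derivative - H - H) (at 0 within {0..})"
    using SXS[of "mat 1"] by (simp only: matrix_mul_lid matrix_mul_rid)
  note SS = has_vector_derivative_mult_const[OF has_vector_derivative_diff[OF has_vector_derivative_const[of "mat 1"] this], of T]
  have "0 - (- H - H) = H + H" by simp
  then have "(0 - (- H - H)) ** T = H ** T + T ** H" by (simp only: matrix_add_rdistrib H(2))
  with has_vector_derivative_add[OF SXS[of Q] SS]
  have q': "(q has_vector_derivative (- (H ** Q) - Q ** H + (H ** T + T ** H))) (at 0 within {0..})"
    unfolding q_def[abs_def] by (simp only:)
  have q0: "q 0 = Q" by (simp add: q_def S)
  have qsa: "selfadj (q s)" for s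
  proof -
    have "T ** (S s ** S s) = S s ** S s ** T" by (metis ST matrix_mul_assoc)
    then show ?thesis
      using Q by (simp add: selfadj_def q_def cadj_simps S Tsa mult_diff_left mult_diff_right matrix_mul_assoc)
  qed
  have m: "mehler Z H T s (F Q) = F (q s)" if "0 \<le> s" for s
    using mehler_props(2)[OF T H ker that F(2)[OF Q]] F(2)[OF qsa[of s]] unfolding q_def S_def .
  show ?thesis
    using frechet_curve[OF F(1) q'] unfolding q0
    by (rule has_vector_derivative_transform[rotated 2]) (use m in auto)
qed

text \<open>Conjugation by the implementers of the unitary group of \<open>K\<close> is
  differentiated at 0 in two ways: directly, giving the commutator, and through \<open>F\<close>
  along the conjugated symbols.\<close>

lemma coherent_generator_gauss:
  assumes K: "selfadj K"
    and F: "\<And>Q. F differentiable (at Q)" "\<And>Q \<rho>. gauss Z Q \<rho> \<Longrightarrow> \<rho> = F Q" and Q: "selfadj Q"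
  shows "coherent_generator Z K (F Q) = frechet_derivative F (at Q) ((- \<i>) *\<^sub>M (K ** Q - Q ** K))"
proof -
  have FQ: "gauss Z Q (F Q)" using gauss_gig_density[OF Q] F(2) by metis
  let ?U = "\<lambda>s. mexp ((- s) *\<^sub>R (\<i> *\<^sub>M K))" and ?\<Gamma> = "\<lambda>s. mexp ((- s) *\<^sub>R (\<i> *\<^sub>M dGamma K))"
  have cK: "cadj (\<i> *\<^sub>M K) = - (\<i> *\<^sub>M K)" "cadj (\<i> *\<^sub>M dGamma K) = - (\<i> *\<^sub>M dGamma K)"
    using K by (simp_all add: cadj_cscale cadj_dGamma selfadj_def cscale_minus)
  have deriv: "((\<lambda>s. mexp ((- s) *\<^sub>R A) ** X ** cadj (mexp ((- s) *\<^sub>R A))) has_vector_derivative - (A ** X) - X ** cadj A) (at 0)"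
    for A X :: "complex ^ 'm ^ 'm"
    using conj_flow_derivative[of A X 0 UNIV] unfolding cadj_mexp_neg by simp
  have eq: "?\<Gamma> s ** F Q ** cadj (?\<Gamma> s) = F (?U s ** Q ** cadj (?U s))" for s
    using F(2)[OF gauss_conj[OF implements_dGamma[OF K] FQ]] .
  have "((\<lambda>s. ?\<Gamma> s ** F Q ** cadj (?\<Gamma> s)) has_vector_derivative
      frechet_derivative F (at Q) (- (\<i> *\<^sub>M K ** Q) - Q ** cadj (\<i> *\<^sub>M K))) (at 0)"
    using frechet_curve[OF F(1) deriv[of "\<i> *\<^sub>M K" Q]] unfolding eq by simp
  from vector_derivative_unique_at[OF this deriv]
  have "frechet_derivative F (at Q) (- (\<i> *\<^sub>M K ** Q) - Q ** cadj (\<i> *\<^sub>M K))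
      = - (\<i> *\<^sub>M dGamma K ** F Q) - F Q ** cadj (\<i> *\<^sub>M dGamma K)" .
  moreover have "- (\<i> *\<^sub>M K ** Q) - Q ** cadj (\<i> *\<^sub>M K) = (- \<i>) *\<^sub>M (K ** Q - Q ** K)"
    unfolding cK by (simp add: mat_simps cscale_diff cscale_minus)
  moreover have "- (\<i> *\<^sub>M dGamma K ** F Q) - F Q ** cadj (\<i> *\<^sub>M dGamma K) = coherent_generator Z K (F Q)"
    unfolding cK by (simp add: coherent_generator_def second_quant_dGamma[OF K] mat_simps cscale_diff cscale_minus)
  ultimately show ?thesis by simp
qed

lemma linear_coherent_generator: "linear (coherent_generator Z K)"
  by (rule linearI)
    (simp_all add: coherent_generator_def mat_simps cscale_add cscale_diff cscale_minus cscale_scaleR_commute algebra_simps)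

lemma op_exp_gig_density:
  assumes T: "T \<in> symbols" and H: "pos_op H" "H ** T = T ** H" and ker: "op_ker H \<subseteq> op_ker T"
    and K: "selfadj K" and t: "0 \<le> t" and Q: "selfadj Q"
  shows "op_exp (\<lambda>X. t *\<^sub>R (semigroup_generator (mehler Z H T) X + coherent_generator Z K X)) (gig_density Z Q)
    = gig_density Z (affine_flow (H + \<i> *\<^sub>M K) (H ** T + T ** H) Q t)"
proof -
  obtain F where F: "\<And>Q. F differentiable (at Q)" "\<And>Q \<rho>. gauss Z Q \<rho> \<Longrightarrow> \<rho> = F Q"
    using ex_gauss_param by blast
  have gig: "gig_density Z Q = F Q" if "selfadj Q" for Q
    using F(2)[OF gauss_gig_density[OF that]] .
  have FG: "gauss Z Q (F Q)" if "selfadj Q" for Q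
    using gauss_gig_density[OF that] gig[OF that] by simp
  define L where "L X = semigroup_generator (mehler Z H T) X + coherent_generator Z K X" for X
  define A where "A = H + \<i> *\<^sub>M K"
  define B where "B = H ** T + T ** H"
  define v where "v Q = - (A ** Q) - Q ** cadj A + B" for Q
  have Hsa: "cadj H = H" and Tsa: "cadj T = T" and Ksa: "cadj K = K"
    using H T K by (simp_all add: pos_op_def selfadj_def symbols_def)
  have Bsa: "selfadj B" by (simp add: B_def selfadj_def cadj_simps Hsa Tsa add.commute)
  have gen: "semigroup_generator (mehler Z H T) X = y"
    if "((\<lambda>s. mehler Z H T s X) has_vector_derivative y) (at 0 within {0..})" for X y
    unfolding semigroup_generator_def by (rule vector_derivative_within[OF at_Ici_neq_bot that])
  have lin: "linear (frechet_derivative F (at Q))" for Q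
    using F(1) linear_frechet_derivative by blast
  have LF: "L (F Q) = frechet_derivative F (at Q) (v Q)" if "selfadj Q" for Q
  proof -
    have "v Q = (- (H ** Q) - Q ** H + (H ** T + T ** H)) + (- \<i>) *\<^sub>M (K ** Q - Q ** K)"
      by (simp add: v_def A_def B_def cadj_simps Hsa Ksa mat_simps cscale_diff cscale_minus algebra_simps)
    then show ?thesis
      using gen[OF mehler_generator_gauss[OF T H ker F(1) FG that]] coherent_generator_gauss[OF K F that]
      by (simp add: L_def linear_add[OF lin])
  qed
  define V where "V = span (F ` {Q. selfadj Q})"
  have V: "subspace V" by (simp add: V_def)
  have FV: "F Q \<in> V" if "selfadj Q" for Q unfolding V_def using that by (intro span_base) auto
  \<comment> \<open>\<open>vector_derivative\<close> is an arbitrary value where no derivative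
    exists, so additivity and homogeneity of \<open>L\<close> are derived on \<open>Dom\<close>
    only.\<close>
  define Dom where "Dom X \<longleftrightarrow> (\<exists>y. ((\<lambda>s. mehler Z H T s X) has_vector_derivative y) (at 0 within {0..}))" for X
  have Dom_add: "Dom (X + Y) \<and> L (X + Y) = L X + L Y" if dom: "Dom X" "Dom Y" for X Y
  proof -
    obtain x y where x: "((\<lambda>s. mehler Z H T s X) has_vector_derivative x) (at 0 within {0..})"
      and y: "((\<lambda>s. mehler Z H T s Y) has_vector_derivative y) (at 0 within {0..})"
      using dom unfolding Dom_def by blast
    have "((\<lambda>s. mehler Z H T s (X + Y)) has_vector_derivative x + y) (at 0 within {0..})"
      using has_vector_derivative_add[OF x y]
      by (rule has_vector_derivative_transform[rotated 2])
        (auto simp: linear_add[OF mehler_props(1)[OF T H ker]])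
    then show ?thesis
      using gen x y by (auto simp: Dom_def L_def linear_add[OF linear_coherent_generator])
  qed
  have Dom_scale: "Dom (r *\<^sub>R X) \<and> L (r *\<^sub>R X) = r *\<^sub>R L X" if dom: "Dom X" for X r
  proof -
    obtain x where x: "((\<lambda>s. mehler Z H T s X) has_vector_derivative x) (at 0 within {0..})"
      using dom unfolding Dom_def by blast
    have "((\<lambda>s. r *\<^sub>R mehler Z H T s X) has_vector_derivative r *\<^sub>R x) (at 0 within {0..})"
      by (rule bounded_linear.has_vector_derivative[OF bounded_linear_scaleR_right x])
    then have "((\<lambda>s. mehler Z H T s (r *\<^sub>R X)) has_vector_derivative r *\<^sub>R x) (at 0 within {0..})"
      by (rule has_vector_derivative_transform[rotated 2])
        (auto simp: linear_scale[OF mehler_props(1)[OF T H ker]])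
    then show ?thesis
      using gen x by (auto simp: Dom_def L_def linear_scale[OF linear_coherent_generator] scaleR_add_right)
  qed
  have DomF: "Dom (F Q)" if "selfadj Q" for Q
    using mehler_generator_gauss[OF T H ker F(1) FG that] by (auto simp: Dom_def)
  \<comment> \<open>\<open>L (F Q)\<close> is the derivative of \<open>F\<close> along a straight
    line of self-adjoint matrices, that is, of a curve inside \<open>V\<close>.\<close>
  have LFV: "L (F Q) \<in> V" if Q: "selfadj Q" for Q
  proof -
    have vsa: "selfadj (v Q)"
      using Q Bsa by (simp add: v_def selfadj_def cadj_simps)
    have "((\<lambda>s. Q + s *\<^sub>R v Q) has_vector_derivative v Q) (at 0 within {0..})"
      by (auto intro!: derivative_eq_intros)
    from frechet_curve[OF F(1) this]
    have "((\<lambda>s. F (Q + s *\<^sub>R v Q)) has_vector_derivative L (F Q)) (at 0 within {0..})"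
      by (simp add: LF[OF Q])
    then show ?thesis
      by (rule derivative_in_subspace[OF V])
        (use Q vsa in \<open>auto intro!: FV simp: selfadj_def cadj_simps\<close>)
  qed
  have "V \<subseteq> {X. Dom X \<and> L X \<in> V}"
    unfolding V_def
  proof (rule span_minimal, fold V_def)
    show "F ` {Q. selfadj Q} \<subseteq> {X. Dom X \<and> L X \<in> V}"
      using DomF LFV by auto
    have "Dom 0 \<and> L 0 = 0"
      using Dom_scale[of "F 0" 0] DomF[of 0] by (simp add: selfadj_def)
    then show "subspace {X. Dom X \<and> L X \<in> V}"
      using Dom_add Dom_scale V by (auto simp: subspace_def)
  qed
  then have VD: "Dom X" "L X \<in> V" if "X \<in> V" for X using that by auto
  \<comment> \<open>\<open>linear_ode_op_exp\<close> asks for a linear map on the whole space;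
    precomposing with a projection onto \<open>V\<close> provides one that agrees with
    \<open>L\<close> on \<open>V\<close>.\<close>
  obtain p where p: "linear p" "\<And>x. p x \<in> V" "\<And>x. x \<in> V \<Longrightarrow> p x = x"
    using ex_linear_projection[OF V] by blast
  have lin_g: "linear (\<lambda>X. L (p X))"
    by (rule linearI)
      (use Dom_add Dom_scale VD(1) p(2) in \<open>simp_all add: linear_add[OF p(1)] linear_scale[OF p(1)]\<close>)
  define \<gamma> where "\<gamma> = affine_flow A B Q"
  have \<gamma>: "selfadj (\<gamma> s)" for s
    unfolding \<gamma>_def by (rule affine_flow_selfadj[OF Q Bsa])
  have ode: "((\<lambda>s. F (\<gamma> s)) has_vector_derivative L (p (F (\<gamma> s)))) (at s within {0..t})" if "s \<in> {0..t}" for s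
  proof -
    have "(\<gamma> has_vector_derivative v (\<gamma> s)) (at s within {0..t})"
      unfolding \<gamma>_def v_def by (rule affine_flow_derivative[OF that])
    from frechet_curve[OF F(1) this] show ?thesis
      by (simp add: p(3)[OF FV[OF \<gamma>]] LF[OF \<gamma>])
  qed
  have "op_exp (\<lambda>X. t *\<^sub>R L (p X)) (F (\<gamma> 0)) = F (\<gamma> t)"
    by (rule linear_ode_op_exp[OF lin_g t ode])
  \<comment> \<open>By invariance of \<open>V\<close> the two families of iterates agree on
    \<open>F Q\<close>, so both exponential series have the same terms.\<close>
  moreover have "((\<lambda>X. t *\<^sub>R L X) ^^ m) (F Q) = ((\<lambda>X. t *\<^sub>R L (p X)) ^^ m) (F Q) \<and> ((\<lambda>X. t *\<^sub>R L X) ^^ m) (F Q) \<in> V" for m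
  proof (induction m)
    case 0
    show ?case using FV[OF Q] by simp
  next
    case (Suc m)
    let ?X = "((\<lambda>X. t *\<^sub>R L (p X)) ^^ m) (F Q)"
    have X: "((\<lambda>X. t *\<^sub>R L X) ^^ m) (F Q) = ?X" "?X \<in> V" using Suc.IH by auto
    show ?case
      using VD(2)[OF X(2)] by (simp add: X(1) p(3)[OF X(2)] subspace_scale[OF V])
  qed
  ultimately have "op_exp (\<lambda>X. t *\<^sub>R L X) (F Q) = F (\<gamma> t)"
    by (simp add: op_exp_def \<gamma>_def affine_flow_0)
  then show ?thesis
    using gig[OF Q] gig[OF \<gamma>[of t]] by (simp add: L_def \<gamma>_def A_def B_def)
qed

end

theorem theorem5p19:
  fixes Z :: "complex ^ 'n \<Rightarrow> complex ^ 'k ^ 'k"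
    and T H K :: "complex ^ 'n ^ 'n"
    and \<L>\<^sub>1 \<L>\<^sub>2 :: "complex ^ 'k ^ 'k \<Rightarrow> complex ^ 'k ^ 'k"
    and t :: real
  assumes "CAR_field Z" and "CAR_irreducible Z"
    and "T \<in> symbols"
    and "pos_op H" and "H ** T - T ** H = 0" and "op_ker H \<subseteq> op_ker T"
    and "\<L>\<^sub>1 = semigroup_generator (mehler Z H T)"
    and "selfadj K" and "\<L>\<^sub>2 = coherent_generator Z K"
    and "0 \<le> t"
  shows "is_symbol_map Z (op_exp (\<lambda>X. t *\<^sub>R (\<L>\<^sub>1 X + \<L>\<^sub>2 X)))
           (\<lambda>Q. mexp ((- t) *\<^sub>R (H + \<i> *\<^sub>M K)) ** Q ** mexp ((- t) *\<^sub>R (H - \<i> *\<^sub>M K))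
              + integral {0..t} (\<lambda>s. mexp ((- s) *\<^sub>R (H + \<i> *\<^sub>M K)) ** (H ** T + T ** H)
                                    ** mexp ((- s) *\<^sub>R (H - \<i> *\<^sub>M K))))"
proof -
  interpret car_irr Z by unfold_locales (fact assms)+
  let ?A = "H + \<i> *\<^sub>M K" and ?B = "H ** T + T ** H"
  have comm: "H ** T = T ** H" using assms(5) by simp
  have T: "pos_op T" "pos_op (mat 1 - T)" using assms(3) by (auto simp: symbols_def)
  have Hsa: "cadj H = H" and Ksa: "cadj K = K"
    using assms(4,8) by (simp_all add: pos_op_def selfadj_def)
  have adj: "cadj ?A = H - \<i> *\<^sub>M K" by (simp add: cadj_simps Hsa Ksa cscale_minus)
  have "pos_op ?B"
    unfolding comm[symmetric] by (intro pos_op_add pos_op_mult_commuting[OF assms(4) T(1) comm])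
  \<comment> \<open>The source of the complementary flow is positive because
    \<open>mat 1 - T\<close> is positive and commutes with \<open>H\<close>.\<close>
  moreover have "?A + cadj ?A - ?B = H ** (mat 1 - T) + H ** (mat 1 - T)"
    by (simp add: adj mult_diff_right comm)
  moreover have "pos_op (H ** (mat 1 - T))"
    using assms(4) T(2) by (rule pos_op_mult_commuting) (simp add: mult_diff_left mult_diff_right comm)
  ultimately have sym: "affine_flow ?A ?B Q t \<in> symbols" if "Q \<in> symbols" for Q
    using affine_flow_symbols[OF assms(10) that] pos_op_add by metis
  have "op_exp (\<lambda>X. t *\<^sub>R (\<L>\<^sub>1 X + \<L>\<^sub>2 X)) (gig_density Z Q) = gig_density Z (affine_flow ?A ?B Q t)"
    if "Q \<in> symbols" for Q
    using op_exp_gig_density[OF assms(3,4) comm assms(6,8,10)] that assms(7,9)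
    by (simp add: symbols_def pos_op_def)
  then show ?thesis
    using sym unfolding is_symbol_map_def gig_states_def affine_flow_def adj by auto
qed

end
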